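(* Let $\mathsf D\subset\mathbf R^3$ be a simply connected bounded Lipschitz domain, let $\Omega\Subset\mathsf D$ be open, let $z=0\in\mathsf D\setminus\overline\Omega$, and let $\omega\subset\mathbf R^3$ be open and bounded with $0\in\omega$. Let $a_1,a_2:\mathbf R^3\to\mathbf R^3$ be continuously differentiable and suppose there are constants $c_1,c_2,c_3>0$ such that for $i=1,2$ and all $x,y\in\mathbf R^3$: (i) $(a_i(x)-a_i(y))\cdot(x-y)\ge c_1|x-y|^2$; (ii) $|a_i(x)-a_i(y)|\le c_2|x-y|$; (iii) $|\partial a_i(x)-\partial a_i(y)|\le c_3|x-y|$. For $\varepsilon\ge 0$ let $u_\varepsilon\in V(\mathsf D)$ be the unique solution of the state equation with inclusion $\Omega_\varepsilon$ (see context; $\Omega_0=\Omega$), and let $K_\varepsilon^*$, $\varepsilon>0$, be defined as in the context. Assume that $\operatorname{curl}u_0\in C^\alpha(\overline{B_\delta(z)})^3$ for some $\delta>0$ (with $\overline{B_\delta(z)}\subset\mathsf D$) and some $0<\alpha<1$, and set $U_0:=\operatorname{curl}u_0(z)$. Then: (i) There exists a unique $K\in\dot{BLC}(\mathbf R^3)$ such that $$\int_{\mathbf R^3}\big(\mathcal A_\omega(x,\operatorname{curl}K+U_0)-\mathcal A_\omega(x,U_0)\big)\cdot\operatorname{curl}\varphi\,dx=-\int_\omega\big(a_1(U_0)-a_2(U_0)\big)\cdot\operatorname{curl}\varphi\,dx\quad\text{for all }\varphi\in BLC(\mathbf R^3),$$ where $\mathcal A_\omega(x,y):=a_1(y)\chi_\omega(x)+a_2(y)\chi_{\mathbf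 R^3\setminus\omega}(x)$. (ii) $\operatorname{curl}K_\varepsilon^*\to\operatorname{curl}K$ strongly in $L_2(\mathbf R^3)^3$ as $\varepsilon\searrow 0$.
   Context: Function spaces. For an open bounded set $\mathsf D\subset\mathbf R^3$, $H(\mathsf D,\operatorname{curl})=\{u\in L_2(\mathsf D)^3:\operatorname{curl}u\in L_2(\mathsf D)^3\}$; $H_0(\mathsf D,\operatorname{curl})=\{u\in H(\mathsf D,\operatorname{curl}):\int_{\mathsf D}\operatorname{curl}u\cdot v\,dx=\int_{\mathsf D}u\cdot\operatorname{curl}v\,dx\ \forall v\in H^1(\mathsf D)^3\}$; $V(\mathsf D)=\{u\in H_0(\mathsf D,\operatorname{curl}):\operatorname{div}u=0\text{ in }\mathsf D\}$. $BLC(\mathbf R^3)$ is the closure of $\mathcal C:=\{\varphi\in C_c^\infty(\mathbf R^3)^3:\operatorname{div}\varphi=0\}$ with respect to $|\varphi|_{H(\mathbf R^3,\operatorname{curl})}:=\big(\int_{\mathbf R^3}|\operatorname{curl}\varphi|^2dx\big)^{1/2}$, understood as a completion realised by functions: $u\in L_{2,loc}(\mathbf R^3)^3$ belongs to $BLC(\mathbf R^3)$ iff there are a sequence $(\varphi_n)\subset\mathcal C$ that is Cauchy with respect to $|\cdot|_{H(\mathbf R^3,\operatorname{curl})}$ and constants $c_n\in\mathbf R^3$ with $\varphi_n+c_n\to u$ in $L_{2,loc}(\mathbf R^3)^3$. $\dot{BLC}(\mathbf R^3)$ is the quotient of $BLC(\mathbf R^3)$ by constant (vector) functions. State equation. $\omega_\varepsilon:=z+\varepsilon\omega$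 for $\varepsilon>0$, $\Omega_\varepsilon:=\Omega\cup\omega_\varepsilon$, $\Omega_0:=\Omega$ ($\varepsilon$ small enough that $\omega_\varepsilon\subset\mathsf D$). $\mathcal A_{\Omega_\varepsilon}(x,y):=a_1(y)$ for $x\in\Omega_\varepsilon$ and $a_2(y)$ for $x\in\mathsf D\setminus\Omega_\varepsilon$. $u_\varepsilon\in V(\mathsf D)$ is the unique solution of $$\int_{\mathsf D}\mathcal A_{\Omega_\varepsilon}(x,\operatorname{curl}u_\varepsilon)\cdot\operatorname{curl}v\,dx=\langle F,v\rangle\quad\forall v\in V(\mathsf D),\qquad \langle F,v\rangle=\int_{\Omega_1}J\cdot v\,dx+\int_{\Omega_2}M\cdot\operatorname{curl}v\,dx,$$ with fixed open sets $\Omega_1,\Omega_2\subset\mathsf D$ and $J,M\in L_2(\mathsf D)^3$. Regular decomposition and $K_\varepsilon^*$. Every $u\in H_0(\mathsf D,\operatorname{curl})$ can be written as $u=\nabla\phi+u^*$ with $\phi\in H_0^1(\mathsf D)$, $u^*\in H_0^1(\mathsf D)^3$. For each $\varepsilon\ge0$ fix such a decomposition $u_\varepsilon=\nabla\phi_\varepsilon+u_\varepsilon^*$, extend $u_\varepsilon^*$ by zero to $\mathbf R^3$, and set $K_\varepsilon^*(x):=\varepsilon^{-1}(u_\varepsilon^*-u_0^* )(\varepsilon x)$, $x\in\mathbf R^3$, $\varepsilon>0$. (Since $\operatorname{curl}u_\varepsilon^*=\operatorname{curl}u_\varepsilon$, $\operatorname{curl}K_\varepsilon^*$ does not depend on the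 chosen decomposition.) *)

theory Defs
  imports "HOL-Analysis.Analysis"
begin

type_synonym vec3 = "real^3"

definition partial :: "3 \<Rightarrow> (vec3 \<Rightarrow> real) \<Rightarrow> vec3 \<Rightarrow> real" where
  "partial i f x = frechet_derivative f (at x) (axis i 1)"

definition grad :: "(vec3 \<Rightarrow> real) \<Rightarrow> vec3 \<Rightarrow> vec3" where
  "grad f x = (\<chi> i. partial i f x)"

definition divergence :: "(vec3 \<Rightarrow> vec3) \<Rightarrow> vec3 \<Rightarrow> real" where
  "divergence f x = (\<Sum>i\<in>UNIV. partial i (\<lambda>y. f y $ i) x)"

definition curl :: "(vec3 \<Rightarrow> vec3) \<Rightarrow> vec3 \<Rightarrow> vec3" where
  "curl f x = vector
     [partial 2 (\<lambda>y. f y $ 3) x - partial 3 (\<lambda>y. f y $ 2) x,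
      partial 3 (\<lambda>y. f y $ 1) x - partial 1 (\<lambda>y. f y $ 3) x,
      partial 1 (\<lambda>y. f y $ 2) x - partial 2 (\<lambda>y. f y $ 1) x]"

primrec Ck :: "nat \<Rightarrow> (vec3 \<Rightarrow> real) \<Rightarrow> bool" where
  "Ck 0 f \<longleftrightarrow> continuous_on UNIV f"
| "Ck (Suc k) f \<longleftrightarrow> (\<forall>x. f differentiable (at x)) \<and> (\<forall>i. Ck k (partial i f))"

definition smooth :: "(vec3 \<Rightarrow> real) \<Rightarrow> bool" where
  "smooth f \<longleftrightarrow> (\<forall>k. Ck k f)"

definition compact_support_in :: "vec3 set \<Rightarrow> (vec3 \<Rightarrow> 'b::zero) \<Rightarrow> bool" where
  "compact_support_in S f \<longleftrightarrow> compact (closure {x. f x \<noteq> 0}) \<and> closure {x. f x \<noteq> 0} \<subseteq> S"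

definition test_functions :: "vec3 set \<Rightarrow> (vec3 \<Rightarrow> real) set" where
  "test_functions S = {f. smooth f \<and> compact_support_in S f}"

definition test_fields :: "vec3 set \<Rightarrow> (vec3 \<Rightarrow> vec3) set" where
  "test_fields S = {f. (\<forall>i. smooth (\<lambda>x. f x $ i)) \<and> compact_support_in S f}"

text \<open>Elements of Lebesgue and Sobolev spaces are represented by actual functions, with Borel
  representatives; values outside the domain \<open>S\<close> are irrelevant, and so are null sets.\<close>

definition L2_on :: "vec3 set \<Rightarrow> (vec3 \<Rightarrow> 'b::euclidean_space) \<Rightarrow> bool" where
  "L2_on S f \<longleftrightarrow> set_borel_measurable lborel S f \<and> set_integrable lborel S (\<lambda>x. (norm (f x))\<^sup>2)"

definition L2_loc :: "vec3 set \<Rightarrow> (vec3 \<Rightarrow> 'b::euclidean_space) \<Rightarrow> bool" where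
  "L2_loc S f \<longleftrightarrow> (\<forall>C. compact C \<and> C \<subseteq> S \<longrightarrow> L2_on C f)"

definition L1_loc :: "vec3 set \<Rightarrow> (vec3 \<Rightarrow> 'b::euclidean_space) \<Rightarrow> bool" where
  "L1_loc S f \<longleftrightarrow> (\<forall>C. compact C \<and> C \<subseteq> S \<longrightarrow> set_integrable lborel C f)"

text \<open>The membership requirements exclude the default value \<open>0\<close> of a divergent integral.\<close>

definition tendsto_L2 ::
  "vec3 set \<Rightarrow> ('i \<Rightarrow> vec3 \<Rightarrow> 'b::euclidean_space) \<Rightarrow> (vec3 \<Rightarrow> 'b) \<Rightarrow> 'i filter \<Rightarrow> bool" where
  "tendsto_L2 S f g F \<longleftrightarrow>
     (\<forall>\<^sub>F i in F. L2_on S (f i)) \<and> L2_on S g \<and>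
     ((\<lambda>i. sqrt (LINT x:S|lborel. (norm (f i x - g x))\<^sup>2)) \<longlongrightarrow> 0) F"

definition has_weak_grad :: "vec3 set \<Rightarrow> (vec3 \<Rightarrow> real) \<Rightarrow> (vec3 \<Rightarrow> vec3) \<Rightarrow> bool" where
  "has_weak_grad S f g \<longleftrightarrow> L1_loc S f \<and> L1_loc S g \<and>
     (\<forall>\<psi>\<in>test_fields S.
        (LINT x:S|lborel. f x * divergence \<psi> x) = - (LINT x:S|lborel. g x \<bullet> \<psi> x))"

definition has_weak_curl :: "vec3 set \<Rightarrow> (vec3 \<Rightarrow> vec3) \<Rightarrow> (vec3 \<Rightarrow> vec3) \<Rightarrow> bool" where
  "has_weak_curl S u w \<longleftrightarrow> L1_loc S u \<and> L1_loc S w \<and>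
     (\<forall>\<psi>\<in>test_fields S.
        (LINT x:S|lborel. u x \<bullet> curl \<psi> x) = (LINT x:S|lborel. w x \<bullet> \<psi> x))"

text \<open>On open sets weak derivatives are unique up to null sets; an arbitrary representative
  is selected.\<close>

definition weak_grad :: "vec3 set \<Rightarrow> (vec3 \<Rightarrow> real) \<Rightarrow> vec3 \<Rightarrow> vec3" where
  "weak_grad S f = (SOME g. has_weak_grad S f g)"

definition weak_curl :: "vec3 set \<Rightarrow> (vec3 \<Rightarrow> vec3) \<Rightarrow> vec3 \<Rightarrow> vec3" where
  "weak_curl S u = (SOME w. has_weak_curl S u w)"

definition weakly_div_free :: "vec3 set \<Rightarrow> (vec3 \<Rightarrow> vec3) \<Rightarrow> bool" where
  "weakly_div_free S u \<longleftrightarrow> L1_loc S u \<and>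
     (\<forall>\<psi>\<in>test_functions S. (LINT x:S|lborel. u x \<bullet> grad \<psi> x) = 0)"

definition H1 :: "vec3 set \<Rightarrow> (vec3 \<Rightarrow> real) set" where
  "H1 S = {f. L2_on S f \<and> (\<exists>g. L2_on S g \<and> has_weak_grad S f g)}"

definition H1_vec :: "vec3 set \<Rightarrow> (vec3 \<Rightarrow> vec3) set" where
  "H1_vec S = {u. \<forall>i. (\<lambda>x. u x $ i) \<in> H1 S}"

definition H1_0 :: "vec3 set \<Rightarrow> (vec3 \<Rightarrow> real) set" where
  "H1_0 S = {f \<in> H1 S. \<exists>\<psi>. (\<forall>n. \<psi> n \<in> test_functions S) \<and>
     tendsto_L2 S \<psi> f sequentially \<and>
     tendsto_L2 S (\<lambda>n. grad (\<psi> n)) (weak_grad S f) sequentially}"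

definition H1_0_vec :: "vec3 set \<Rightarrow> (vec3 \<Rightarrow> vec3) set" where
  "H1_0_vec S = {u. \<forall>i. (\<lambda>x. u x $ i) \<in> H1_0 S}"

definition H_curl :: "vec3 set \<Rightarrow> (vec3 \<Rightarrow> vec3) set" where
  "H_curl S = {u. L2_on S u \<and> (\<exists>w. L2_on S w \<and> has_weak_curl S u w)}"

definition H0_curl :: "vec3 set \<Rightarrow> (vec3 \<Rightarrow> vec3) set" where
  "H0_curl S = {u \<in> H_curl S. \<forall>v\<in>H1_vec S.
     (LINT x:S|lborel. weak_curl S u x \<bullet> v x) = (LINT x:S|lborel. u x \<bullet> weak_curl S v x)}"

definition V_space :: "vec3 set \<Rightarrow> (vec3 \<Rightarrow> vec3) set" where
  "V_space S = {u \<in> H0_curl S. weakly_div_free S u}"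

definition div_free_test_fields :: "(vec3 \<Rightarrow> vec3) set" where
  "div_free_test_fields = {f \<in> test_fields UNIV. \<forall>x. divergence f x = 0}"

definition curl_seminorm :: "(vec3 \<Rightarrow> vec3) \<Rightarrow> real" where
  "curl_seminorm f = sqrt (LINT x|lborel. (norm (curl f x))\<^sup>2)"

definition BLC :: "(vec3 \<Rightarrow> vec3) set" where
  "BLC = {u. L2_loc UNIV u \<and>
     (\<exists>(f :: nat \<Rightarrow> vec3 \<Rightarrow> vec3) (c :: nat \<Rightarrow> vec3).
        (\<forall>n. f n \<in> div_free_test_fields) \<and>
        (\<forall>e>0. \<exists>N. \<forall>m\<ge>N. \<forall>n\<ge>N. curl_seminorm (\<lambda>x. f m x - f n x) < e) \<and>
        (\<forall>C. compact C \<longrightarrow> tendsto_L2 C (\<lambda>n x. f n x + c n) u sequentially))}"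

definition BLC_rel :: "((vec3 \<Rightarrow> vec3) \<times> (vec3 \<Rightarrow> vec3)) set" where
  "BLC_rel = {(u, v). u \<in> BLC \<and> v \<in> BLC \<and> (\<exists>c. AE x in lborel. u x - v x = c)}"

lemma equiv_BLC_rel: "equiv BLC BLC_rel"
proof (rule equivI)
  show "BLC_rel \<subseteq> BLC \<times> BLC"
    by (auto simp: BLC_rel_def)
  show "refl_on BLC BLC_rel"
    by (auto simp: BLC_rel_def refl_on_def)
  show "sym BLC_rel"
  proof (rule symI)
    fix u v assume "(u, v) \<in> BLC_rel"
    then obtain c where uv: "u \<in> BLC" "v \<in> BLC" and "AE x in lborel. u x - v x = c"
      by (auto simp: BLC_rel_def)
    from this(3) have "AE x in lborel. v x - u x = - c"
      by eventually_elim auto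
    with uv show "(v, u) \<in> BLC_rel"
      by (auto simp: BLC_rel_def)
  qed
  show "trans BLC_rel"
  proof (rule transI)
    fix u v w assume "(u, v) \<in> BLC_rel" "(v, w) \<in> BLC_rel"
    then obtain c d where uw: "u \<in> BLC" "w \<in> BLC"
      and "AE x in lborel. u x - v x = c" "AE x in lborel. v x - w x = d"
      by (auto simp: BLC_rel_def)
    from this(3,4) have "AE x in lborel. u x - w x = c + d"
      by eventually_elim auto
    with uw show "(u, w) \<in> BLC_rel"
      by (auto simp: BLC_rel_def)
  qed
qed

definition BLC_dot :: "(vec3 \<Rightarrow> vec3) set set" where
  "BLC_dot = BLC // BLC_rel"

text \<open>Near each boundary point, in suitable orthonormal coordinates, the domain is the strict
  subgraph of a Lipschitz function.\<close>

definition lipschitz_domain :: "vec3 set \<Rightarrow> bool" where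
  "lipschitz_domain D \<longleftrightarrow> open D \<and> connected D \<and> D \<noteq> {} \<and>
     (\<forall>p\<in>frontier D. \<exists>U (T :: vec3 \<Rightarrow> vec3) (g :: real \<times> real \<Rightarrow> real) L.
        open U \<and> p \<in> U \<and> orthogonal_transformation T \<and> L-lipschitz_on UNIV g \<and>
        D \<inter> U = {x \<in> U. T (x - p) $ 3 < g (T (x - p) $ 1, T (x - p) $ 2)})"

definition holder_on :: "real \<Rightarrow> vec3 set \<Rightarrow> (vec3 \<Rightarrow> vec3) \<Rightarrow> bool" where
  "holder_on \<alpha> S w \<longleftrightarrow> (\<exists>C. \<forall>x\<in>S. \<forall>y\<in>S. norm (w x - w y) \<le> C * norm (x - y) powr \<alpha>)"

definition scaled_inclusion :: "vec3 \<Rightarrow> vec3 set \<Rightarrow> real \<Rightarrow> vec3 set" where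
  "scaled_inclusion z \<omega> \<epsilon> = (\<lambda>y. z + \<epsilon> *\<^sub>R y) ` \<omega>"

definition perturbed_set :: "vec3 set \<Rightarrow> vec3 \<Rightarrow> vec3 set \<Rightarrow> real \<Rightarrow> vec3 set" where
  "perturbed_set \<Omega> z \<omega> \<epsilon> = (if \<epsilon> = 0 then \<Omega> else \<Omega> \<union> scaled_inclusion z \<omega> \<epsilon>)"

definition admissible :: "vec3 set \<Rightarrow> vec3 \<Rightarrow> vec3 set \<Rightarrow> real set" where
  "admissible D z \<omega> = insert 0 {\<epsilon>. 0 < \<epsilon> \<and> scaled_inclusion z \<omega> \<epsilon> \<subseteq> D}"

definition two_phase ::
  "(vec3 \<Rightarrow> vec3) \<Rightarrow> (vec3 \<Rightarrow> vec3) \<Rightarrow> vec3 set \<Rightarrow> vec3 \<Rightarrow> vec3 \<Rightarrow> vec3" where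
  "two_phase a1 a2 S x y = (if x \<in> S then a1 y else a2 y)"

definition state_solution ::
  "(vec3 \<Rightarrow> vec3) \<Rightarrow> (vec3 \<Rightarrow> vec3) \<Rightarrow> vec3 set \<Rightarrow> vec3 set \<Rightarrow> vec3 set \<Rightarrow>
   (vec3 \<Rightarrow> vec3) \<Rightarrow> (vec3 \<Rightarrow> vec3) \<Rightarrow> vec3 set \<Rightarrow> (vec3 \<Rightarrow> vec3) \<Rightarrow> bool" where
  "state_solution a1 a2 D \<Omega>1 \<Omega>2 J M S u \<longleftrightarrow> u \<in> V_space D \<and>
     (\<forall>v\<in>V_space D.
        (LINT x:D|lborel. two_phase a1 a2 S x (weak_curl D u x) \<bullet> weak_curl D v x) =
        (LINT x:\<Omega>1|lborel. J x \<bullet> v x) + (LINT x:\<Omega>2|lborel. M x \<bullet> weak_curl D v x))"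

definition regular_decomposition ::
  "vec3 set \<Rightarrow> (vec3 \<Rightarrow> vec3) \<Rightarrow> (vec3 \<Rightarrow> real) \<Rightarrow> (vec3 \<Rightarrow> vec3) \<Rightarrow> bool" where
  "regular_decomposition D u \<phi> us \<longleftrightarrow> \<phi> \<in> H1_0 D \<and> us \<in> H1_0_vec D \<and>
     (AE x in lborel. x \<in> D \<longrightarrow> u x = weak_grad D \<phi> x + us x)"

definition extend_by_zero :: "vec3 set \<Rightarrow> (vec3 \<Rightarrow> vec3) \<Rightarrow> vec3 \<Rightarrow> vec3" where
  "extend_by_zero D u x = (if x \<in> D then u x else 0)"

definition K_star :: "vec3 set \<Rightarrow> (real \<Rightarrow> vec3 \<Rightarrow> vec3) \<Rightarrow> real \<Rightarrow> vec3 \<Rightarrow> vec3" where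
  "K_star D us \<epsilon> x = (1 / \<epsilon>) *\<^sub>R
     (extend_by_zero D (us \<epsilon>) (\<epsilon> *\<^sub>R x) - extend_by_zero D (us 0) (\<epsilon> *\<^sub>R x))"

definition corrector_equation ::
  "(vec3 \<Rightarrow> vec3) \<Rightarrow> (vec3 \<Rightarrow> vec3) \<Rightarrow> vec3 set \<Rightarrow> vec3 \<Rightarrow> (vec3 \<Rightarrow> vec3) \<Rightarrow> bool" where
  "corrector_equation a1 a2 \<omega> U0 K \<longleftrightarrow> (\<forall>\<psi>\<in>BLC.
     (LINT x|lborel. (two_phase a1 a2 \<omega> x (weak_curl UNIV K x + U0) - two_phase a1 a2 \<omega> x U0)
        \<bullet> weak_curl UNIV \<psi> x) =
     - (LINT x:\<omega>|lborel. (a1 U0 - a2 U0) \<bullet> weak_curl UNIV \<psi> x))"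

end

theory Submission
  imports Defs
begin

text \<open>
  All curls are treated as elements of the Hilbert space $L_2(\mathbf R^3)^3$. Since
  $|\nabla\varphi| = |\mathrm{curl}\,\varphi|$ in $L_2$ for divergence-free test fields, Hardy's
  inequality identifies $\dot{BLC}(\mathbf R^3)$ with the closed span $W$ of their curls, and the
  corrector equation becomes a strongly monotone Lipschitz equation on $W$, solved by Banach's
  fixed point theorem.

  For the convergence, a Liouville theorem (an $L_2$ function orthogonal to all Laplacians of test
  functions vanishes) shows that curls of arbitrary test fields lie in $W$, hence so does
  $\mathrm{curl}\,K_\varepsilon^*$. Given a divergence-free test field $\varphi$ with
  $\mathrm{curl}\,\varphi$ close to $\mathrm{curl}\,K$, both the rescaled state equation and the
  corrector equation may be tested with $\mathrm{curl}\,K_\varepsilon^* - \mathrm{curl}\,\varphi$; strong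
  monotonicity then bounds this difference by $\|\mathrm{curl}\,K - \mathrm{curl}\,\varphi\|$ plus a
  term that vanishes because $\mathrm{curl}\,u_0(\varepsilon x) \to U_0$ uniformly on compact sets.
\<close>

section \<open>Monotone equations in Hilbert spaces\<close>

text \<open>The obstacle is a mismatch of test fields. \<open>K_star\<close> need not be
  divergence-free, so it is no obvious test field for the corrector equation; the corrector
  \<open>K\<close> has unbounded support, so its rescaling does not fit into \<open>D\<close> and
  cannot be subtracted inside the state equation. On the level of curls both conflicts disappear:
  the regular parts may be replaced by \<open>u \<epsilon> - u 0\<close>, which lies in
  \<open>V_space D\<close> and has the same curl, and \<open>K\<close> is replaced by a compactly
  supported field \<open>f\<close>, fixed before \<epsilon> is taken small. The comparison is
  arranged so that the unknown curl cancels from the residual. Away from \<omega> and the support of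
  \<open>f\<close> the residual is only \<open>A \<omega> x (w x + U) - A \<omega> x U\<close>,
  which is bounded by \<open>c2 * norm (w x)\<close> and hence by the approximation error of
  \<open>f\<close>. Thus no decay rate of \<open>K\<close> at infinity enters, and the closeness of
  \<open>curl u_0\<close> to \<open>U0\<close> matters only on one fixed ball of the rescaled
  variable.\<close>

lemma ex_orthogonal_projection:
  fixes W :: "'a::{real_inner,complete_space} set"
  assumes W: "subspace W" "closed W"
  shows "\<exists>p\<in>W. \<forall>v\<in>W. (x - p) \<bullet> v = 0"
proof -
  define d where "d = (INF w\<in>W. (norm (x - w))\<^sup>2)"
  have ne: "W \<noteq> {}" using subspace_0[OF W(1)] by auto
  have bdd: "bdd_below ((\<lambda>w. (norm (x - w))\<^sup>2) ` W)"
    by (rule bdd_belowI[of _ 0]) auto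
  have d_le: "d \<le> (norm (x - w))\<^sup>2" if "w \<in> W" for w
    unfolding d_def using cINF_lower[OF bdd that] .
  \<comment> \<open>The near-minimisers of the distance form a decreasing sequence of nonempty
    closed sets; once their diameters tend to 0, completeness puts a common point into all of
    them.\<close>
  define S where "S n = {w\<in>W. (norm (x - w))\<^sup>2 \<le> d + inverse (real (Suc n))}" for n
  have "\<exists>a. \<forall>n. a \<in> S n"
  proof (rule decreasing_closed_nest)
    fix n
    have "S n = W \<inter> {w. (norm (x - w))\<^sup>2 \<le> d + inverse (real (Suc n))}"
      by (auto simp: S_def)
    then show "closed (S n)"
      using W(2) by (auto intro!: closed_Int closed_Collect_le continuous_intros)
    show "S n \<noteq> {}"
    proof -
      have "d < d + inverse (real (Suc n))" by simp
      then obtain w where "w \<in> W" "(norm (x - w))\<^sup>2 < d + inverse (real (Suc n))"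
        unfolding d_def using cINF_less_iff[OF ne bdd] by blast
      then show ?thesis by (auto simp: S_def intro!: exI[of _ w])
    qed
  next
    fix m n :: nat assume "m \<le> n"
    then have "inverse (real (Suc n)) \<le> inverse (real (Suc m))" by simp
    then have "y \<le> d + inverse (real (Suc m))" if "y \<le> d + inverse (real (Suc n))" for y
      using that by linarith
    then show "S n \<subseteq> S m" unfolding S_def by blast
  next
    fix e :: real assume "e > 0"
    \<comment> \<open>The parallelogram law, with the midpoint again in \<open>W\<close>, bounds the
      squared distance of two points of \<open>S n\<close> by \<open>4 / (n + 1)\<close>.\<close>
    then obtain n where n: "inverse (real (Suc n)) < e\<^sup>2 / 4"
      using reals_Archimedean[of "e\<^sup>2 / 4"] by auto
    have "dist v w < e" if v: "v \<in> S n" and w: "w \<in> S n" for v w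
    proof -
      have vw: "v \<in> W" "w \<in> W" using v w by (auto simp: S_def)
      have "(1/2) *\<^sub>R (v + w) \<in> W"
        using W(1) vw by (simp add: subspace_add subspace_scale)
      then have "d \<le> (norm (x - (1/2) *\<^sub>R (v + w)))\<^sup>2" by (rule d_le)
      moreover have "(norm (v - w))\<^sup>2 = 2 * (norm (x - v))\<^sup>2 + 2 * (norm (x - w))\<^sup>2
          - 4 * (norm (x - (1/2) *\<^sub>R (v + w)))\<^sup>2"
        by (simp add: power2_norm_eq_inner inner_simps inner_commute algebra_simps)
      ultimately have "(norm (v - w))\<^sup>2 < e\<^sup>2"
        using v w n by (auto simp: S_def)
      then show ?thesis using \<open>e > 0\<close> by (simp add: dist_norm power_less_imp_less_base)
    qed
    then show "\<exists>n. \<forall>x\<in>S n. \<forall>y\<in>S n. dist x y < e" by blast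
  qed blast
  then obtain p where p: "\<And>n. p \<in> S n" by blast
  have pW: "p \<in> W" using p[of 0] by (simp add: S_def)
  have "(norm (x - p))\<^sup>2 \<le> d"
  proof (rule field_le_epsilon)
    fix e :: real assume "e > 0"
    then obtain n where "inverse (real (Suc n)) < e" using reals_Archimedean by auto
    then show "(norm (x - p))\<^sup>2 \<le> d + e" using p[of n] by (simp add: S_def)
  qed
  have "(x - p) \<bullet> v = 0" if "v \<in> W" for v
  proof (cases "v = 0")
    case False
    \<comment> \<open>This \<open>t\<close> minimises the quadratic
      \<open>(norm (x - p - t v))^2\<close>. Optimality of \<open>p\<close> at \<open>t = 0\<close>
      then leaves no room for the gain
      \<open>((x - p) \<bullet> v)^2 / (v \<bullet> v)\<close>.\<close>
    define t where "t = ((x - p) \<bullet> v) / (v \<bullet> v)"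
    have "p + t *\<^sub>R v \<in> W" using W(1) pW that by (simp add: subspace_add subspace_scale)
    then have "(norm (x - p))\<^sup>2 \<le> (norm (x - (p + t *\<^sub>R v)))\<^sup>2"
      using d_le \<open>(norm (x - p))\<^sup>2 \<le> d\<close> order_trans by blast
    also have "\<dots> = (norm (x - p))\<^sup>2 - 2 * t * ((x - p) \<bullet> v) + t\<^sup>2 * (v \<bullet> v)"
      unfolding power2_norm_eq_inner diff_diff_eq[symmetric]
      by (simp add: inner_diff_left inner_diff_right inner_commute power2_eq_square)
    also have "\<dots> = (norm (x - p))\<^sup>2 - ((x - p) \<bullet> v)\<^sup>2 / (v \<bullet> v)"
      using False by (simp add: t_def field_simps power2_eq_square)
    finally have "((x - p) \<bullet> v)\<^sup>2 / (v \<bullet> v) \<le> 0" by simp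
    moreover have "v \<bullet> v > 0" using False by simp
    ultimately have "((x - p) \<bullet> v)\<^sup>2 \<le> 0" by (simp add: divide_le_0_iff)
    then show ?thesis by simp
  qed simp
  with pW show ?thesis by blast
qed

text \<open>The solution is the fixed point of \<open>w \<mapsto> P (w - t N w)\<close> on \<open>W\<close>, where \<open>P\<close> is the orthogonal
  projection and \<open>t = c / L\<^sup>2\<close>.\<close>

lemma strongly_monotone_equation:
  fixes W :: "'a::{real_inner,complete_space} set" and N :: "'a \<Rightarrow> 'a"
  assumes W: "subspace W" "closed W" and c: "c > 0"
    and mono: "\<And>x y. (N x - N y) \<bullet> (x - y) \<ge> c * (norm (x - y))\<^sup>2"
    and lip: "\<And>x y. norm (N x - N y) \<le> L0 * norm (x - y)"
  shows "\<exists>w\<in>W. \<forall>v\<in>W. N w \<bullet> v = 0"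
proof -
  \<comment> \<open>Raising the constant to at least \<open>c\<close> makes it positive and keeps
    \<open>1 - c^2 / L^2\<close> nonnegative under the square root. On a trivial space
    \<open>L0\<close> could even be negative.\<close>
  define L where "L = max L0 c"
  have L: "L > 0" "c \<le> L" using c by (auto simp: L_def)
  have lip': "norm (N x - N y) \<le> L * norm (x - y)" for x y
    by (rule order_trans[OF lip]) (simp add: L_def mult_right_mono)
  obtain P where P: "\<And>x. P x \<in> W" "\<And>x v. v \<in> W \<Longrightarrow> (x - P x) \<bullet> v = 0"
    using ex_orthogonal_projection[OF W] by metis
  have P_contr: "norm (P x - P y) \<le> norm (x - y)" for x y
  proof -
    have "P x - P y \<in> W" using P(1) W(1) by (simp add: subspace_diff)
    then have "(x - P x) \<bullet> (P x - P y) = 0" "(y - P y) \<bullet> (P x - P y) = 0"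
      using P(2) by auto
    then have "(norm (P x - P y))\<^sup>2 = (x - y) \<bullet> (P x - P y)"
      by (simp add: power2_norm_eq_inner inner_simps)
    also have "\<dots> \<le> norm (x - y) * norm (P x - P y)" by (rule norm_cauchy_schwarz)
    finally show ?thesis
      by (cases "P x = P y") (simp_all add: power2_eq_square)
  qed
  define t where "t = c / L\<^sup>2"
  have t: "t > 0" using c L by (simp add: t_def)
  \<comment> \<open>Expanding the square and inserting both bounds gives the factor
    \<open>1 - 2 t c + t^2 L^2\<close>, which is \<open>1 - c^2 / L^2\<close> for
    \<open>t = c / L^2\<close>.\<close>
  define k where "k = sqrt (1 - c\<^sup>2 / L\<^sup>2)"
  have cl: "c\<^sup>2 / L\<^sup>2 \<le> 1" "0 < c\<^sup>2 / L\<^sup>2" using c L by (auto simp: divide_simps power_mono)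
  have "\<exists>!w\<in>W. P (w - t *\<^sub>R N w) = w"
  proof (rule Banach_fix)
    show "complete W" using W(2) complete_eq_closed by blast
    show "W \<noteq> {}" using subspace_0[OF W(1)] by auto
    show "0 \<le> k" "k < 1" using cl by (auto simp: k_def)
    show "(\<lambda>w. P (w - t *\<^sub>R N w)) ` W \<subseteq> W" using P(1) by auto
    fix x y
    have *: "(norm (a - t *\<^sub>R b))\<^sup>2 = (norm a)\<^sup>2 - 2 * t * (b \<bullet> a) + t\<^sup>2 * (norm b)\<^sup>2" for a b :: 'a
      unfolding power2_norm_eq_inner
      by (simp add: inner_diff_left inner_diff_right inner_commute power2_eq_square)
    have "(norm ((x - t *\<^sub>R N x) - (y - t *\<^sub>R N y)))\<^sup>2
        = (norm (x - y))\<^sup>2 - 2 * t * ((N x - N y) \<bullet> (x - y)) + t\<^sup>2 * (norm (N x - N y))\<^sup>2"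
      unfolding *[symmetric] by (simp add: scaleR_diff_right algebra_simps)
    also have "\<dots> \<le> (norm (x - y))\<^sup>2 - 2 * t * (c * (norm (x - y))\<^sup>2) + t\<^sup>2 * (L * norm (x - y))\<^sup>2"
      using t mono[where ?x=x and ?y=y] lip'[where ?x=x and ?y=y]
      by (intro add_mono diff_mono mult_left_mono power_mono) auto
    also have "\<dots> = k\<^sup>2 * (norm (x - y))\<^sup>2"
      using cl L by (simp add: k_def t_def power_mult_distrib field_simps power2_eq_square)
    finally have "norm ((x - t *\<^sub>R N x) - (y - t *\<^sub>R N y)) \<le> k * norm (x - y)"
      using cl by (rule_tac power2_le_imp_le) (simp_all add: power_mult_distrib k_def)
    then show "dist (P (x - t *\<^sub>R N x)) (P (y - t *\<^sub>R N y)) \<le> k * dist x y"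
      unfolding dist_norm by (rule order_trans[OF P_contr])
  qed
  then obtain w where w: "w \<in> W" "P (w - t *\<^sub>R N w) = w" by auto
  have "N w \<bullet> v = 0" if "v \<in> W" for v
    using P(2)[OF that, of "w - t *\<^sub>R N w"] w(2) t by simp
  with w(1) show ?thesis by blast
qed

section \<open>The Hilbert space of square integrable vector fields\<close>

lemma L2_on_UNIV_iff:
  "L2_on UNIV f \<longleftrightarrow> f \<in> borel_measurable borel \<and> integrable lborel (\<lambda>x. (norm (f x))\<^sup>2)"
  by (simp add: L2_on_def set_borel_measurable_def set_integrable_def)

lemma L2_on_iff_indicator: "L2_on S f \<longleftrightarrow> L2_on UNIV (\<lambda>x. indicator S x *\<^sub>R f x)"
proof -
  have "(norm (indicator S x *\<^sub>R f x))\<^sup>2 = indicator S x *\<^sub>R (norm (f x))\<^sup>2" for x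
    by (auto simp: indicator_def)
  then show ?thesis
    by (simp add: L2_on_UNIV_iff L2_on_def set_borel_measurable_def set_integrable_def)
qed

lemma L2_measurable: "L2_on UNIV f \<Longrightarrow> f \<in> borel_measurable borel"
  and L2_integrable_norm: "L2_on UNIV f \<Longrightarrow> integrable lborel (\<lambda>x. (norm (f x))\<^sup>2)"
  by (auto simp: L2_on_UNIV_iff)

lemma L2_dominated:
  assumes f: "L2_on UNIV f" and g: "g \<in> borel_measurable borel"
    and le: "\<And>x. norm (g x) \<le> C * norm (f x)"
  shows "L2_on UNIV g"
  unfolding L2_on_UNIV_iff
proof (intro conjI g)
  show "integrable lborel (\<lambda>x. (norm (g x))\<^sup>2)"
  proof (rule Bochner_Integration.integrable_bound)
    show "integrable lborel (\<lambda>x. C\<^sup>2 * (norm (f x))\<^sup>2)"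
      using L2_integrable_norm[OF f] by simp
    show "(\<lambda>x. (norm (g x))\<^sup>2) \<in> borel_measurable lborel" using g by simp
    show "AE x in lborel. norm ((norm (g x))\<^sup>2) \<le> norm (C\<^sup>2 * (norm (f x))\<^sup>2)"
      using power_mono[OF le norm_ge_zero, of _ 2] by (simp add: power_mult_distrib)
  qed
qed

lemma L2_zero [simp]: "L2_on UNIV (\<lambda>x. 0)"
  by (simp add: L2_on_UNIV_iff)

lemma L2_scaleR: "L2_on UNIV f \<Longrightarrow> L2_on UNIV (\<lambda>x. c *\<^sub>R f x)"
  by (rule L2_dominated[of f _ "\<bar>c\<bar>"]) (auto simp: L2_on_UNIV_iff)

lemma L2_add:
  assumes f: "L2_on UNIV f" and g: "L2_on UNIV g"
  shows "L2_on UNIV (\<lambda>x. f x + g x)"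
  unfolding L2_on_UNIV_iff
proof
  show "integrable lborel (\<lambda>x. (norm (f x + g x))\<^sup>2)"
  proof (rule Bochner_Integration.integrable_bound)
    show "integrable lborel (\<lambda>x. 2 * (norm (f x))\<^sup>2 + 2 * (norm (g x))\<^sup>2)"
      using L2_integrable_norm[OF f] L2_integrable_norm[OF g] by simp
    show "(\<lambda>x. (norm (f x + g x))\<^sup>2) \<in> borel_measurable lborel"
      using L2_measurable[OF f] L2_measurable[OF g] by simp
    have "(norm (f x + g x))\<^sup>2 \<le> 2 * (norm (f x))\<^sup>2 + 2 * (norm (g x))\<^sup>2" for x
    proof -
      have "(norm (f x + g x))\<^sup>2 \<le> (norm (f x) + norm (g x))\<^sup>2"
        by (simp add: norm_triangle_ineq power_mono)
      also have "\<dots> \<le> 2 * (norm (f x))\<^sup>2 + 2 * (norm (g x))\<^sup>2"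
        using sum_squares_bound[of "norm (f x)" "norm (g x)"]
        by (simp add: power2_sum)
      finally show ?thesis .
    qed
    then show "AE x in lborel. norm ((norm (f x + g x))\<^sup>2)
        \<le> norm (2 * (norm (f x))\<^sup>2 + 2 * (norm (g x))\<^sup>2)"
      by simp
  qed
qed (use L2_measurable[OF f] L2_measurable[OF g] in simp)

lemma L2_diff: "L2_on UNIV f \<Longrightarrow> L2_on UNIV g \<Longrightarrow> L2_on UNIV (\<lambda>x. f x - g x)"
  using L2_add[of f "\<lambda>x. (-1) *\<^sub>R g x"] L2_scaleR[of g "-1"] by simp

lemma L2_cong_AE:
  assumes "L2_on UNIV f" "g \<in> borel_measurable borel" "AE x in lborel. f x = g x"
  shows "L2_on UNIV g"
  unfolding L2_on_UNIV_iff
proof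
  show "integrable lborel (\<lambda>x. (norm (g x))\<^sup>2)"
    by (rule integrable_cong_AE_imp[OF L2_integrable_norm[OF assms(1)]])
       (use assms in auto)
qed fact

lemma L2_inner_integrable:
  assumes f: "L2_on UNIV f" and g: "L2_on UNIV g"
  shows "integrable lborel (\<lambda>x. f x \<bullet> g x)"
proof (rule Bochner_Integration.integrable_bound)
  show "integrable lborel (\<lambda>x. (norm (f x))\<^sup>2 + (norm (g x))\<^sup>2)"
    using L2_integrable_norm[OF f] L2_integrable_norm[OF g] by simp
  show "(\<lambda>x. f x \<bullet> g x) \<in> borel_measurable lborel"
    using L2_measurable[OF f] L2_measurable[OF g] by simp
  have "\<bar>f x \<bullet> g x\<bar> \<le> (norm (f x))\<^sup>2 + (norm (g x))\<^sup>2" for x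
  proof -
    have "\<bar>f x \<bullet> g x\<bar> \<le> norm (f x) * norm (g x)" by (rule Cauchy_Schwarz_ineq2)
    also have "2 * \<dots> \<le> (norm (f x))\<^sup>2 + (norm (g x))\<^sup>2"
      using sum_squares_bound[of "norm (f x)" "norm (g x)"] by simp
    finally show ?thesis by (smt (verit) mult_nonneg_nonneg norm_ge_zero)
  qed
  then show "AE x in lborel. norm (f x \<bullet> g x) \<le> norm ((norm (f x))\<^sup>2 + (norm (g x))\<^sup>2)"
    by simp
qed

text \<open>Along a subsequence the squared increments sum up even after multiplication with \<open>4\<^sup>k\<close>, which
  forces pointwise convergence almost everywhere; Fatou's lemma does the rest.\<close>

lemma L2_complete:
  fixes f :: "nat \<Rightarrow> vec3 \<Rightarrow> 'b::euclidean_space"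
  assumes f: "\<And>n. L2_on UNIV (f n)"
    and Cauchy: "\<And>e. e > 0 \<Longrightarrow> \<exists>N. \<forall>m\<ge>N. \<forall>n\<ge>N. (LINT x|lborel. (norm (f m x - f n x))\<^sup>2) < e"
  shows "\<exists>g. L2_on UNIV g \<and> (\<lambda>n. LINT x|lborel. (norm (f n x - g x))\<^sup>2) \<longlonglongrightarrow> 0"
proof -
  have f_meas [measurable]: "f n \<in> borel_measurable borel" for n
    using f by (rule L2_measurable)
  have int: "integrable lborel (\<lambda>x. (norm (f m x - f n x))\<^sup>2)" for m n
    by (rule L2_integrable_norm[OF L2_diff[OF f f]])
  \<comment> \<open>The rate \<open>1/8\<close> is chosen against the later factor
    \<open>4^k\<close>: the weighted increments still sum like \<open>(1/2)^k\<close>.\<close>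
  have "\<forall>k. \<exists>N. \<forall>m\<ge>N. \<forall>n\<ge>N. (LINT x|lborel. (norm (f m x - f n x))\<^sup>2) < (1/8)^k"
    by (intro allI Cauchy) simp
  then obtain N where "\<forall>k. \<forall>m\<ge>N k. \<forall>n\<ge>N k. (LINT x|lborel. (norm (f m x - f n x))\<^sup>2) < (1/8)^k"
    by (auto dest: choice)
  then have N: "(LINT x|lborel. (norm (f m x - f n x))\<^sup>2) < (1/8)^k" if "m \<ge> N k" "n \<ge> N k" for k m n
    using that by blast
  \<comment> \<open>Summation turns the thresholds into a nondecreasing index sequence with
    \<open>N k \<le> r k\<close>, so that all terms from index \<open>r k\<close> on are within
    \<open>(1/8)^k\<close> of each other in squared norm.\<close>
  define r where "r k = (\<Sum>i\<le>k. N i)" for k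
  have r_mono: "r j \<le> r k" if "j \<le> k" for j k
    unfolding r_def using that by (intro sum_mono2) auto
  have N_r: "N k \<le> r k" for k
    unfolding r_def by (intro member_le_sum) auto
  have small: "(\<integral>\<^sup>+x. ennreal ((norm (f m x - f n x))\<^sup>2) \<partial>lborel) \<le> ennreal ((1/8)^k)"
    if "m \<ge> r k" "n \<ge> r k" for m n k
    using N[of k m n] N_r[of k] that int[of m n]
    by (subst nn_integral_eq_integral) (auto intro!: ennreal_leI)
  define d where "d k x = (norm (f (r (Suc k)) x - f (r k) x))\<^sup>2" for k x
  have [measurable]: "d k \<in> borel_measurable borel" for k unfolding d_def by measurable
  have "(\<integral>\<^sup>+x. (\<Sum>k. ennreal (4^k * d k x)) \<partial>lborel) = (\<Sum>k. \<integral>\<^sup>+x. ennreal (4^k * d k x) \<partial>lborel)"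
    by (rule nn_integral_suminf) simp
  also have "\<dots> \<le> (\<Sum>k. ennreal ((1/2)^k))"
  proof (rule suminf_le)
    fix k
    have "(\<integral>\<^sup>+x. ennreal (4^k * d k x) \<partial>lborel) = ennreal (4^k) * (\<integral>\<^sup>+x. ennreal (d k x) \<partial>lborel)"
      by (simp add: ennreal_mult' nn_integral_cmult)
    also have "\<dots> \<le> ennreal (4^k) * ennreal ((1/8)^k)"
      unfolding d_def by (intro mult_left_mono small r_mono) auto
    also have "\<dots> = ennreal ((1/2)^k)"
      by (simp add: ennreal_mult'[symmetric] power_mult_distrib[symmetric])
    finally show "(\<integral>\<^sup>+x. ennreal (4^k * d k x) \<partial>lborel) \<le> ennreal ((1/2)^k)" .
  qed auto
  also have "\<dots> < \<infinity>"
    by (subst suminf_ennreal2) (auto simp: summable_geometric)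
  finally have "AE x in lborel. (\<Sum>k. ennreal (4^k * d k x)) \<noteq> \<infinity>"
    by (intro nn_integral_PInf_AE) auto
  then have conv: "AE x in lborel. convergent (\<lambda>k. f (r k) x)"
  proof eventually_elim
    fix x assume fin: "(\<Sum>k. ennreal (4^k * d k x)) \<noteq> \<infinity>"
    have "summable (\<lambda>k. 4^k * d k x)"
      by (rule summable_suminf_not_top) (use fin in \<open>auto simp: d_def\<close>)
    then obtain B where B: "B > 0" "\<And>k. norm (4^k * d k x) \<le> B"
      using summable_imp_Bseq unfolding Bseq_def by blast
    \<comment> \<open>Terms of a convergent series are bounded, and a bound on
      \<open>4^k * d k x\<close> is geometric decay with ratio \<open>1/2\<close> of the increments
      themselves. Their series therefore converges absolutely, and it telescopes.\<close>
    have le: "norm (f (r (Suc k)) x - f (r k) x) \<le> sqrt B * (1/2)^k" for k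
    proof (rule power2_le_imp_le)
      have "((1/2)^k)\<^sup>2 = ((1/4)^k :: real)"
        unfolding power2_eq_square power_mult_distrib[symmetric] by simp
      then have "(sqrt B * (1/2)^k)\<^sup>2 = B * (1/4)^k"
        using B(1) unfolding power_mult_distrib by simp
      moreover have "4^k * d k x \<le> B"
        using B(2)[of k] by simp
      then have "d k x \<le> B * (1/4)^k"
        by (simp add: power_one_over pos_le_divide_eq mult.commute)
      ultimately show "(norm (f (r (Suc k)) x - f (r k) x))\<^sup>2 \<le> (sqrt B * (1/2)^k)\<^sup>2"
        by (simp add: d_def)
    qed (use B(1) in simp)
    have "summable (\<lambda>k. sqrt B * (1/2)^k)"
      by (rule summable_mult, rule summable_geometric) simp
    then have "summable (\<lambda>k. f (r (Suc k)) x - f (r k) x)"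
      by (rule summable_comparison_test'[where N = 0]) (rule le)
    then have "convergent (\<lambda>n. \<Sum>k<n. f (r (Suc k)) x - f (r k) x)"
      by (simp add: summable_iff_convergent)
    then have "convergent (\<lambda>n. f (r n) x - f (r 0) x)"
      unfolding sum_lessThan_telescope[of "\<lambda>k. f (r k) x"] .
    then show "convergent (\<lambda>k. f (r k) x)"
      by (rule convergent_diff_const_right_iff[THEN iffD1])
  qed
  define g where "g x = lim (\<lambda>k. f (r k) x)" for x
  have [measurable]: "g \<in> borel_measurable borel"
    unfolding g_def by (rule borel_measurable_lim_metric) simp
  have lim: "AE x in lborel. (\<lambda>k. f (r k) x) \<longlonglongrightarrow> g x"
    using conv by eventually_elim (simp add: g_def convergent_LIMSEQ_iff)
  have bound: "(\<integral>\<^sup>+x. ennreal ((norm (f n x - g x))\<^sup>2) \<partial>lborel) \<le> ennreal ((1/8)^K)"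
    if n: "n \<ge> r K" for n K
  proof -
    have "(\<integral>\<^sup>+x. ennreal ((norm (f n x - g x))\<^sup>2) \<partial>lborel)
        = (\<integral>\<^sup>+x. liminf (\<lambda>k. ennreal ((norm (f n x - f (r k) x))\<^sup>2)) \<partial>lborel)"
    proof (rule nn_integral_cong_AE)
      show "AE x in lborel. ennreal ((norm (f n x - g x))\<^sup>2)
          = liminf (\<lambda>k. ennreal ((norm (f n x - f (r k) x))\<^sup>2))"
        using lim
      proof eventually_elim
        fix x assume "(\<lambda>k. f (r k) x) \<longlonglongrightarrow> g x"
        then have "(\<lambda>k. ennreal ((norm (f n x - f (r k) x))\<^sup>2)) \<longlonglongrightarrow> ennreal ((norm (f n x - g x))\<^sup>2)"
          by (intro tendsto_ennrealI tendsto_intros)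
        then show "ennreal ((norm (f n x - g x))\<^sup>2)
            = liminf (\<lambda>k. ennreal ((norm (f n x - f (r k) x))\<^sup>2))"
          by (rule lim_imp_Liminf[OF sequentially_bot, symmetric])
      qed
    qed
    also have "\<dots> \<le> liminf (\<lambda>k. \<integral>\<^sup>+x. ennreal ((norm (f n x - f (r k) x))\<^sup>2) \<partial>lborel)"
      by (rule nn_integral_liminf) simp
    also have "\<dots> \<le> ennreal ((1/8)^K)"
    proof (rule Liminf_le)
      show "\<forall>\<^sub>F k in sequentially. (\<integral>\<^sup>+x. ennreal ((norm (f n x - f (r k) x))\<^sup>2) \<partial>lborel) \<le> ennreal ((1/8)^K)"
        using eventually_ge_at_top[of K]
        by eventually_elim (intro small n r_mono)
    qed simp
    finally show ?thesis .
  qed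
  have int_g: "integrable lborel (\<lambda>x. (norm (f n x - g x))\<^sup>2)"
    "(LINT x|lborel. (norm (f n x - g x))\<^sup>2) \<le> (1/8)^K" if "n \<ge> r K" for n K
  proof -
    show int: "integrable lborel (\<lambda>x. (norm (f n x - g x))\<^sup>2)"
    proof (rule integrableI_bounded)
      show "(\<integral>\<^sup>+x. ennreal (norm ((norm (f n x - g x))\<^sup>2)) \<partial>lborel) < \<infinity>"
        using bound[OF that] by (auto intro: le_less_trans)
    qed simp
    have "ennreal (LINT x|lborel. (norm (f n x - g x))\<^sup>2) \<le> ennreal ((1/8)^K)"
      using bound[OF that] nn_integral_eq_integral[OF int] by simp
    then show "(LINT x|lborel. (norm (f n x - g x))\<^sup>2) \<le> (1/8)^K"
      by (subst (asm) ennreal_le_iff) auto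
  qed
  have "L2_on UNIV (\<lambda>x. f (r 0) x - g x)"
    using int_g(1)[of 0 "r 0"] by (simp add: L2_on_UNIV_iff)
  then have "L2_on UNIV g"
    using L2_diff[OF f[of "r 0"]] by fastforce
  moreover have "(\<lambda>n. LINT x|lborel. (norm (f n x - g x))\<^sup>2) \<longlonglongrightarrow> 0"
  proof (rule LIMSEQ_I)
    fix e :: real assume "e > 0"
    then obtain K where K: "(1/8)^K < e" using real_arch_pow_inv[of e "1/8"] by auto
    have "norm ((LINT x|lborel. (norm (f n x - g x))\<^sup>2) - 0) < e" if "n \<ge> r K" for n
    proof -
      have "0 \<le> (LINT x|lborel. (norm (f n x - g x))\<^sup>2)" by simp
      then show ?thesis using int_g(2)[OF that] K by simp
    qed
    then show "\<exists>no. \<forall>n\<ge>no. norm ((LINT x|lborel. (norm (f n x - g x))\<^sup>2) - 0) < e" by blast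
  qed
  ultimately show ?thesis by blast
qed

section \<open>Square integrable fields modulo null sets as a complete inner product space\<close>

definition L2_rel :: "(vec3 \<Rightarrow> vec3) \<Rightarrow> (vec3 \<Rightarrow> vec3) \<Rightarrow> bool" where
  "L2_rel f g \<longleftrightarrow> L2_on UNIV f \<and> L2_on UNIV g \<and> (AE x in lborel. f x = g x)"

lemma part_equivp_L2_rel: "part_equivp L2_rel"
proof (rule part_equivpI)
  show "\<exists>f. L2_rel f f" by (rule exI[of _ "\<lambda>_. 0"]) (simp add: L2_rel_def)
  show "symp L2_rel" by (auto simp: symp_def L2_rel_def elim: eventually_mono)
  show "transp L2_rel" by (rule transpI) (auto simp: L2_rel_def elim: eventually_elim2)
qed

\<comment> \<open>The relation is reflexive exactly on square integrable fields, so a partial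
  quotient yields a type without any carrier condition. As a type it can be made an instance of
  \<open>real_inner\<close> and \<open>complete_space\<close>, which the abstract results on
  projections and monotone equations require.\<close>
quotient_type L2field = "vec3 \<Rightarrow> vec3" / partial: L2_rel
  by (rule part_equivp_L2_rel)

lemma integral_inner_cong_AE:
  assumes "L2_on UNIV f" "L2_on UNIV f'" "L2_on UNIV g" "L2_on UNIV g'"
    "AE x in lborel. f x = f' x" "AE x in lborel. g x = g' x"
  shows "(LINT x|lborel. f x \<bullet> g x) = (LINT x|lborel. f' x \<bullet> g' x)"
proof (rule integral_cong_AE)
  show "AE x in lborel. f x \<bullet> g x = f' x \<bullet> g' x"
    using assms(5,6) by eventually_elim simp
qed (use assms(1-4)[THEN L2_measurable] in simp_all)

instantiation L2field :: real_inner
begin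

lift_definition zero_L2field :: L2field is "\<lambda>x. 0"
  by (simp add: L2_rel_def)

lift_definition plus_L2field :: "L2field \<Rightarrow> L2field \<Rightarrow> L2field" is "\<lambda>f g x. f x + g x"
  by (auto simp: L2_rel_def intro: L2_add elim: eventually_elim2)

lift_definition minus_L2field :: "L2field \<Rightarrow> L2field \<Rightarrow> L2field" is "\<lambda>f g x. f x - g x"
  by (auto simp: L2_rel_def intro: L2_diff elim: eventually_elim2)

lift_definition scaleR_L2field :: "real \<Rightarrow> L2field \<Rightarrow> L2field" is "\<lambda>c f x. c *\<^sub>R f x"
  by (auto simp: L2_rel_def intro: L2_scaleR elim: eventually_mono)

lift_definition inner_L2field :: "L2field \<Rightarrow> L2field \<Rightarrow> real" is "\<lambda>f g. LINT x|lborel. f x \<bullet> g x"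
  by (rule integral_inner_cong_AE) (auto simp: L2_rel_def)

definition uminus_L2field :: "L2field \<Rightarrow> L2field" where
  "uminus_L2field f = 0 - f"
definition norm_L2field :: "L2field \<Rightarrow> real" where
  "norm_L2field f = sqrt (f \<bullet> f)"
definition sgn_L2field :: "L2field \<Rightarrow> L2field" where
  "sgn_L2field f = inverse (norm f) *\<^sub>R f"
definition dist_L2field :: "L2field \<Rightarrow> L2field \<Rightarrow> real" where
  "dist_L2field f g = norm (f - g)"
definition uniformity_L2field :: "(L2field \<times> L2field) filter" where
  "uniformity_L2field = (INF e\<in>{0<..}. principal {(x, y). dist x y < e})"
definition open_L2field :: "L2field set \<Rightarrow> bool" where
  "open_L2field U \<longleftrightarrow> (\<forall>x\<in>U. eventually (\<lambda>(x', y). x' = x \<longrightarrow> y \<in> U) uniformity)"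

instance
proof
  fix f g h :: L2field and a b :: real
  show "f + g + h = f + (g + h)"
    by transfer (auto simp: L2_rel_def add.assoc intro!: L2_add)
  show "f + g = g + f"
    by transfer (auto simp: L2_rel_def add.commute intro!: L2_add)
  show "0 + f = f"
    by transfer (auto simp: L2_rel_def)
  show "f - g = f + - g"
    unfolding uminus_L2field_def
    by transfer (auto simp: L2_rel_def intro!: L2_add L2_diff)
  show "- f + f = 0"
    unfolding uminus_L2field_def
    by transfer (auto simp: L2_rel_def intro!: L2_add L2_diff)
  show "a *\<^sub>R (f + g) = a *\<^sub>R f + a *\<^sub>R g"
    by transfer (auto simp: L2_rel_def scaleR_add_right intro!: L2_add L2_scaleR)
  show "(a + b) *\<^sub>R f = a *\<^sub>R f + b *\<^sub>R f"
    by transfer (auto simp: L2_rel_def scaleR_add_left intro!: L2_add L2_scaleR)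
  show "a *\<^sub>R b *\<^sub>R f = (a * b) *\<^sub>R f"
    by transfer (auto simp: L2_rel_def intro!: L2_scaleR)
  show "1 *\<^sub>R f = f"
    by transfer (auto simp: L2_rel_def)
  show "dist f g = norm (f - g)" by (simp add: dist_L2field_def)
  show "sgn f = inverse (norm f) *\<^sub>R f" by (simp add: sgn_L2field_def)
  show "uniformity = (INF e\<in>{0<..}. principal {(x, y). dist x (y::L2field) < e})"
    by (simp add: uniformity_L2field_def)
  show "open U = (\<forall>x\<in>U. eventually (\<lambda>(x', y). x' = x \<longrightarrow> y \<in> U) uniformity)" for U :: "L2field set"
    by (simp add: open_L2field_def)
  show "f \<bullet> g = g \<bullet> f"
    by transfer (simp add: inner_commute)
  show "(f + g) \<bullet> h = f \<bullet> h + g \<bullet> h"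
    by transfer (auto simp: inner_add_left L2_rel_def L2_inner_integrable)
  show "(a *\<^sub>R f) \<bullet> g = a * (f \<bullet> g)"
    by transfer simp
  show "0 \<le> f \<bullet> f"
    by transfer simp
  show "f \<bullet> f = 0 \<longleftrightarrow> f = 0"
  proof transfer
    fix f :: "vec3 \<Rightarrow> vec3" assume "L2_rel f f"
    then have "L2_on UNIV f" by (simp add: L2_rel_def)
    then show "((LINT x|lborel. f x \<bullet> f x) = 0) = L2_rel f (\<lambda>x. 0)"
      using L2_inner_integrable[of f f]
      by (subst integral_nonneg_eq_0_iff_AE) (auto simp: L2_rel_def)
  qed
  show "norm f = sqrt (f \<bullet> f)" by (simp add: norm_L2field_def)
qed

end

abbreviation toL2 :: "(vec3 \<Rightarrow> vec3) \<Rightarrow> L2field" where "toL2 \<equiv> abs_L2field"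

lemma L2field_cases:
  obtains f where "L2_on UNIV f" "F = toL2 f"
proof -
  have "L2_rel (rep_L2field F) (rep_L2field F)"
    using Quotient3_rep_reflp[OF Quotient3_L2field] .
  then show ?thesis
    using that[of "rep_L2field F"] Quotient3_abs_rep[OF Quotient3_L2field, of F]
    by (auto simp: L2_rel_def)
qed

lemma toL2_eq_iff: "L2_on UNIV f \<Longrightarrow> L2_on UNIV g \<Longrightarrow> toL2 f = toL2 g \<longleftrightarrow> (AE x in lborel. f x = g x)"
  using Quotient3_rel[OF Quotient3_L2field, of f g] by (auto simp: L2_rel_def)

lemma toL2_add: "L2_on UNIV f \<Longrightarrow> L2_on UNIV g \<Longrightarrow> toL2 (\<lambda>x. f x + g x) = toL2 f + toL2 g"
  by (simp add: plus_L2field.abs_eq L2_rel_def)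

lemma toL2_diff: "L2_on UNIV f \<Longrightarrow> L2_on UNIV g \<Longrightarrow> toL2 (\<lambda>x. f x - g x) = toL2 f - toL2 g"
  by (simp add: minus_L2field.abs_eq L2_rel_def)

lemma toL2_scaleR: "L2_on UNIV f \<Longrightarrow> toL2 (\<lambda>x. c *\<^sub>R f x) = c *\<^sub>R toL2 f"
  by (simp add: scaleR_L2field.abs_eq L2_rel_def)

lemma toL2_inner: "L2_on UNIV f \<Longrightarrow> L2_on UNIV g \<Longrightarrow> toL2 f \<bullet> toL2 g = (LINT x|lborel. f x \<bullet> g x)"
  by (simp add: inner_L2field.abs_eq L2_rel_def)

lemma toL2_norm_power2: "L2_on UNIV f \<Longrightarrow> (norm (toL2 f))\<^sup>2 = (LINT x|lborel. (norm (f x))\<^sup>2)"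
  by (simp add: power2_norm_eq_inner toL2_inner)

lemma toL2_norm: "L2_on UNIV f \<Longrightarrow> norm (toL2 f) = sqrt (LINT x|lborel. (norm (f x))\<^sup>2)"
  by (metis norm_ge_zero real_sqrt_unique toL2_norm_power2)

lemma tendsto_toL2_iff:
  assumes "\<And>i. L2_on UNIV (f i)" "L2_on UNIV g"
  shows "((\<lambda>i. toL2 (f i)) \<longlongrightarrow> toL2 g) F \<longleftrightarrow>
    ((\<lambda>i. sqrt (LINT x|lborel. (norm (f i x - g x))\<^sup>2)) \<longlongrightarrow> 0) F"
proof -
  have "norm (toL2 (f i) - toL2 g) = sqrt (LINT x|lborel. (norm (f i x - g x))\<^sup>2)" for i
    using assms by (simp add: toL2_diff[symmetric] toL2_norm L2_diff)
  then show ?thesis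
    by (subst LIM_zero_iff[symmetric], subst tendsto_norm_zero_iff[symmetric]) simp
qed

instance L2field :: complete_space
proof
  fix X :: "nat \<Rightarrow> L2field" assume X: "Cauchy X"
  have "\<forall>n. \<exists>f. L2_on UNIV f \<and> X n = toL2 f" by (meson L2field_cases)
  then obtain f where f: "\<And>n. L2_on UNIV (f n)" "\<And>n. X n = toL2 (f n)" by metis
  have "\<exists>g. L2_on UNIV g \<and> (\<lambda>n. LINT x|lborel. (norm (f n x - g x))\<^sup>2) \<longlonglongrightarrow> 0"
  proof (rule L2_complete[OF f(1)])
    fix e :: real assume "e > 0"
    then obtain N where N: "\<And>m n. m \<ge> N \<Longrightarrow> n \<ge> N \<Longrightarrow> norm (X m - X n) < sqrt e"
      using X unfolding Cauchy_def dist_norm by (metis real_sqrt_gt_zero)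
    have "(LINT x|lborel. (norm (f m x - f n x))\<^sup>2) < e" if "m \<ge> N" "n \<ge> N" for m n
      using N[OF that] f by (simp add: toL2_diff[symmetric] toL2_norm L2_diff)
    then show "\<exists>N. \<forall>m\<ge>N. \<forall>n\<ge>N. (LINT x|lborel. (norm (f m x - f n x))\<^sup>2) < e" by blast
  qed
  then obtain g where g: "L2_on UNIV g" "(\<lambda>n. LINT x|lborel. (norm (f n x - g x))\<^sup>2) \<longlonglongrightarrow> 0" by blast
  have "(\<lambda>n. toL2 (f n)) \<longlonglongrightarrow> toL2 g"
    unfolding tendsto_toL2_iff[OF f(1) g(1)] using tendsto_real_sqrt[OF g(2)] by simp
  then show "convergent X" by (auto simp: convergent_def f(2)[abs_def])
qed

section \<open>Smooth functions and test functions\<close>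

lemma partial_eqI: "(f has_derivative f') (at x) \<Longrightarrow> partial i f x = f' (axis i 1)"
  unfolding partial_def using frechet_derivative_at by metis

lemma Ck_add: "Ck k f \<Longrightarrow> Ck k g \<Longrightarrow> Ck k (\<lambda>x. f x + g x)"
proof (induction k arbitrary: f g)
  case (Suc k)
  have "partial i (\<lambda>x. f x + g x) = (\<lambda>x. partial i f x + partial i g x)" for i
  proof
    fix x
    have "((\<lambda>x. f x + g x) has_derivative
        (\<lambda>h. frechet_derivative f (at x) h + frechet_derivative g (at x) h)) (at x)"
      using Suc.prems by (intro has_derivative_add) (auto simp: frechet_derivative_works[symmetric])
    from partial_eqI[OF this] show "partial i (\<lambda>x. f x + g x) x = partial i f x + partial i g x"
      by (simp add: partial_def)
  qed
  with Suc show ?case by (auto intro!: differentiable_add)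
qed (auto intro: continuous_on_add)

lemma Ck_cmult: "Ck k f \<Longrightarrow> Ck k (\<lambda>x. c * f x)"
proof (induction k arbitrary: f)
  case (Suc k)
  have "partial i (\<lambda>x. c * f x) = (\<lambda>x. c * partial i f x)" for i
    using Suc.prems by (auto simp: partial_def fun_eq_iff frechet_derivative_works
        intro!: frechet_derivative_at[symmetric, THEN fun_cong] has_derivative_mult_right)
  with Suc show ?case by (auto intro!: differentiable_mult)
qed (auto intro: continuous_on_mult continuous_on_const)

lemma smooth_differentiable: "smooth f \<Longrightarrow> f differentiable (at x)"
  unfolding smooth_def using Ck.simps(2)[of 0 f] by blast

lemma smooth_partial: "smooth f \<Longrightarrow> smooth (partial i f)"
  unfolding smooth_def using Ck.simps(2) by blast

lemma smooth_continuous: "smooth f \<Longrightarrow> continuous_on UNIV f"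
  unfolding smooth_def using Ck.simps(1) by blast

lemma smooth_has_derivative: "smooth f \<Longrightarrow> (f has_derivative frechet_derivative f (at x)) (at x)"
  using smooth_differentiable frechet_derivative_works by blast

lemma smooth_add: "smooth f \<Longrightarrow> smooth g \<Longrightarrow> smooth (\<lambda>x. f x + g x)"
  by (simp add: smooth_def Ck_add)

lemma smooth_cmult: "smooth f \<Longrightarrow> smooth (\<lambda>x. c * f x)"
  by (simp add: smooth_def Ck_cmult)

lemma smooth_minus: "smooth f \<Longrightarrow> smooth (\<lambda>x. - f x)"
  using smooth_cmult[of f "-1"] by simp

lemma partial_add:
  "smooth f \<Longrightarrow> smooth g \<Longrightarrow> partial i (\<lambda>x. f x + g x) x = partial i f x + partial i g x"
  unfolding partial_def[of i f] partial_def[of i g]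
  by (rule partial_eqI) (intro has_derivative_add smooth_has_derivative)

lemma partial_cmult: "smooth f \<Longrightarrow> partial i (\<lambda>x. c * f x) x = c * partial i f x"
  unfolding partial_def[of i f]
  by (rule partial_eqI) (intro has_derivative_mult_right smooth_has_derivative)

lemma partial_minus: "smooth f \<Longrightarrow> partial i (\<lambda>x. - f x) x = - partial i f x"
  using partial_cmult[of f i "-1"] by simp

lemma partial_diff:
  "smooth f \<Longrightarrow> smooth g \<Longrightarrow> partial i (\<lambda>x. f x - g x) x = partial i f x - partial i g x"
  using partial_add[of f "\<lambda>x. - g x" i x] by (simp add: smooth_minus partial_minus)

lemma partial_mult:
  assumes "smooth f" "smooth g"
  shows "partial i (\<lambda>x. f x * g x) x = f x * partial i g x + partial i f x * g x"
  unfolding partial_def[of i f] partial_def[of i g]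
  by (rule partial_eqI[where f' = "\<lambda>h. f x * frechet_derivative g (at x) h + frechet_derivative f (at x) h * g x"])
     (intro has_derivative_mult smooth_has_derivative assms)

lemma smooth_mult:
  assumes "smooth f" "smooth g" shows "smooth (\<lambda>x. f x * g x)"
proof -
  \<comment> \<open>The induction keeps both factors smooth instead of \<open>Ck k\<close>: the
    product rule leaves one factor undifferentiated, and smoothness, unlike the order
    \<open>k\<close>, is not lowered by \<open>partial\<close>.\<close>
  have "smooth f \<Longrightarrow> smooth g \<Longrightarrow> Ck k (\<lambda>x. f x * g x)" for k f g
  proof (induction k arbitrary: f g)
    case 0
    then show ?case by (auto intro: continuous_on_mult smooth_continuous)
  next
    case (Suc k)
    have "partial i (\<lambda>x. f x * g x) = (\<lambda>x. f x * partial i g x + partial i f x * g x)" for i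
      using partial_mult[OF Suc.prems] by (simp add: fun_eq_iff)
    then show ?case
      using Suc.prems Suc.IH[OF Suc.prems(1) smooth_partial[OF Suc.prems(2)]]
        Suc.IH[OF smooth_partial[OF Suc.prems(1)] Suc.prems(2)]
      by (auto intro!: Ck_add differentiable_mult smooth_differentiable[OF Suc.prems(1)]
          smooth_differentiable[OF Suc.prems(2)])
  qed
  with assms show ?thesis by (simp add: smooth_def)
qed

lemma Ck_const: "Ck k (\<lambda>x. c)"
proof (induction k arbitrary: c)
  case (Suc k)
  have "partial i (\<lambda>x. c) = (\<lambda>x. 0)" for i by (simp add: partial_def fun_eq_iff)
  with Suc show ?case by simp
qed simp

lemma smooth_const: "smooth (\<lambda>x. c)"
  by (simp add: smooth_def Ck_const)

lemma partial_affine: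
  assumes "f differentiable (at (a + c *\<^sub>R x))"
  shows "partial i (\<lambda>x. f (a + c *\<^sub>R x)) x = c * partial i f (a + c *\<^sub>R x)"
proof -
  let ?f' = "frechet_derivative f (at (a + c *\<^sub>R x))"
  have f': "(f has_derivative ?f') (at (a + c *\<^sub>R x))"
    using assms frechet_derivative_works by blast
  have "((\<lambda>x. f (a + c *\<^sub>R x)) has_derivative (\<lambda>h. ?f' (c *\<^sub>R h))) (at x)"
    by (rule has_derivative_compose[of "\<lambda>x. a + c *\<^sub>R x" _ x UNIV f, OF _ f'])
       (auto intro!: derivative_eq_intros)
  from partial_eqI[OF this] show ?thesis
    using linear_cmul[OF has_derivative_linear[OF f']] by (simp add: partial_def)
qed

lemma smooth_affine: assumes "smooth f" shows "smooth (\<lambda>x. f (a + c *\<^sub>R x))"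
proof -
  \<comment> \<open>The statement is generalised over \<open>f\<close>, since the induction step
    applies it to the partial derivatives of \<open>f\<close>.\<close>
  have "smooth f \<Longrightarrow> Ck k (\<lambda>x. f (a + c *\<^sub>R x))" for k f
  proof (induction k arbitrary: f)
    case 0
    then show ?case
      by (auto intro!: continuous_on_compose2[OF smooth_continuous] continuous_intros)
  next
    case (Suc k)
    have "partial i (\<lambda>x. f (a + c *\<^sub>R x)) = (\<lambda>x. c * partial i f (a + c *\<^sub>R x))" for i
      using Suc.prems by (simp add: fun_eq_iff partial_affine smooth_differentiable)
    moreover have "(\<lambda>x. f (a + c *\<^sub>R x)) differentiable at x" for x
      by (rule differentiable_compose[of f "\<lambda>x. a + c *\<^sub>R x" x UNIV])
         (auto intro!: smooth_differentiable Suc.prems derivative_intros)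
    ultimately show ?case using Suc by (auto intro!: Ck_cmult smooth_partial)
  qed
  with assms show ?thesis by (simp add: smooth_def)
qed

lemma DERIV_line:
  assumes "smooth f"
  shows "((\<lambda>s. f (y + s *\<^sub>R axis i 1)) has_real_derivative partial i f (y + s *\<^sub>R axis i 1)) (at s)"
proof -
  let ?f' = "frechet_derivative f (at (y + s *\<^sub>R axis i 1))"
  have f': "(f has_derivative ?f') (at (y + s *\<^sub>R axis i 1))"
    by (rule smooth_has_derivative[OF assms])
  have "((\<lambda>s. f (y + s *\<^sub>R axis i 1)) has_derivative (\<lambda>h. ?f' (h *\<^sub>R axis i 1))) (at s)"
    by (rule has_derivative_compose[of "\<lambda>s. y + s *\<^sub>R axis i 1" _ s UNIV f, OF _ f'])
       (auto intro!: derivative_eq_intros)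
  then show ?thesis
    using linear_cmul[OF has_derivative_linear[OF f']]
    by (simp add: partial_def has_field_derivative_def mult.commute[of _ "frechet_derivative f _ _"])
qed

text \<open>The mean value theorem is applied in direction \<open>i\<close> to a difference taken in
  direction \<open>j\<close>, and then in direction \<open>j\<close> to the resulting derivative.
  The left-hand side is symmetric in \<open>i\<close> and \<open>j\<close>, the right-hand side is
  not.\<close>

lemma second_difference:
  assumes f: "smooth f" and h: "h > 0"
  shows "\<exists>\<xi> \<eta>. 0 < \<xi> \<and> \<xi> < h \<and> 0 < \<eta> \<and> \<eta> < h \<and>
    f (x + h *\<^sub>R axis i 1 + h *\<^sub>R axis j 1) - f (x + h *\<^sub>R axis i 1) - f (x + h *\<^sub>R axis j 1) + f x
     = h\<^sup>2 * partial j (partial i f) (x + \<xi> *\<^sub>R axis i 1 + \<eta> *\<^sub>R axis j 1)"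
proof -
  let ?e = "axis i 1 :: vec3" and ?d = "axis j 1 :: vec3"
  have "\<exists>\<xi>>0. \<xi> < h \<and> (f ((x + h *\<^sub>R ?d) + h *\<^sub>R ?e) - f (x + h *\<^sub>R ?e))
      - (f ((x + h *\<^sub>R ?d) + 0 *\<^sub>R ?e) - f (x + 0 *\<^sub>R ?e))
      = (h - 0) * (partial i f ((x + h *\<^sub>R ?d) + \<xi> *\<^sub>R ?e) - partial i f (x + \<xi> *\<^sub>R ?e))"
    by (rule MVT2[OF h]) (intro DERIV_diff DERIV_line f)
  then obtain \<xi> where \<xi>: "0 < \<xi>" "\<xi> < h" and 1:
    "f (x + h *\<^sub>R ?d + h *\<^sub>R ?e) - f (x + h *\<^sub>R ?e) - f (x + h *\<^sub>R ?d) + f x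
      = h * (partial i f (x + h *\<^sub>R ?d + \<xi> *\<^sub>R ?e) - partial i f (x + \<xi> *\<^sub>R ?e))"
    by auto
  have "\<exists>\<eta>>0. \<eta> < h \<and> partial i f ((x + \<xi> *\<^sub>R ?e) + h *\<^sub>R ?d) - partial i f ((x + \<xi> *\<^sub>R ?e) + 0 *\<^sub>R ?d)
      = (h - 0) * partial j (partial i f) ((x + \<xi> *\<^sub>R ?e) + \<eta> *\<^sub>R ?d)"
    by (rule MVT2[OF h]) (intro DERIV_line smooth_partial f)
  then obtain \<eta> where "0 < \<eta>" "\<eta> < h"
    "partial i f (x + \<xi> *\<^sub>R ?e + h *\<^sub>R ?d) - partial i f (x + \<xi> *\<^sub>R ?e)
      = h * partial j (partial i f) (x + \<xi> *\<^sub>R ?e + \<eta> *\<^sub>R ?d)"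
    by auto
  with \<xi> 1 show ?thesis
    by (intro exI[of _ \<xi>] exI[of _ \<eta>]) (simp add: power2_eq_square add_ac)
qed

text \<open>Schwarz's theorem. The two orders of expanding one second difference give both mixed
  derivatives, at points near \<open>x\<close>, the same value; continuity rules out a gap between
  them at \<open>x\<close>.\<close>

lemma partial_commute:
  assumes f: "smooth f"
  shows "partial i (partial j f) x = partial j (partial i f) x"
proof (rule ccontr)
  let ?A = "partial i (partial j f)" and ?B = "partial j (partial i f)"
  assume ne: "?A x \<noteq> ?B x"
  define \<epsilon> where "\<epsilon> = \<bar>?A x - ?B x\<bar> / 2"
  have \<epsilon>: "\<epsilon> > 0" using ne by (simp add: \<epsilon>_def)
  have "isCont ?A x" "isCont ?B x"
    using f smooth_continuous[OF smooth_partial[OF smooth_partial[OF f]]]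
    by (auto simp: continuous_on_eq_continuous_at)
  then have "\<exists>d>0. \<forall>y. dist y x < d \<longrightarrow> dist (?A y) (?A x) < \<epsilon>"
    "\<exists>d>0. \<forall>y. dist y x < d \<longrightarrow> dist (?B y) (?B x) < \<epsilon>"
    using \<epsilon> by (auto simp: continuous_at_eps_delta)
  then obtain d1 d2 where d1: "d1 > 0" "\<forall>y. dist y x < d1 \<longrightarrow> dist (?A y) (?A x) < \<epsilon>"
      and d2: "d2 > 0" "\<forall>y. dist y x < d2 \<longrightarrow> dist (?B y) (?B x) < \<epsilon>"
    by blast
  define d where "d = min d1 d2"
  have d: "d > 0" "\<And>y. dist y x < d \<Longrightarrow> \<bar>?A y - ?A x\<bar> < \<epsilon>"
    "\<And>y. dist y x < d \<Longrightarrow> \<bar>?B y - ?B x\<bar> < \<epsilon>"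
    using d1 d2 by (auto simp: d_def dist_real_def)
  \<comment> \<open>The intermediate points lie at distance at most \<open>s + t\<close> from
    \<open>x\<close> with \<open>s\<close> and \<open>t\<close> below \<open>h\<close>, hence within
    \<open>d\<close>.\<close>
  define h where "h = d / 2"
  have h: "h > 0" using d by (simp add: h_def)
  have near: "dist (x + s *\<^sub>R axis k 1 + t *\<^sub>R axis l 1) x < d"
    if "0 < s" "s < h" "0 < t" "t < h" for s t and k l :: 3
  proof -
    have "dist (x + s *\<^sub>R axis k 1 + t *\<^sub>R axis l 1) x = norm (s *\<^sub>R axis k 1 + t *\<^sub>R axis l (1::real) :: vec3)"
      by (simp add: dist_norm add.assoc)
    also have "\<dots> \<le> s + t"
      by (rule norm_triangle_le) (use that in simp)
    finally show ?thesis using that by (simp add: h_def)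
  qed
  obtain \<xi> \<eta> where 1: "0 < \<xi>" "\<xi> < h" "0 < \<eta>" "\<eta> < h"
    "f (x + h *\<^sub>R axis i 1 + h *\<^sub>R axis j 1) - f (x + h *\<^sub>R axis i 1) - f (x + h *\<^sub>R axis j 1) + f x
     = h\<^sup>2 * ?B (x + \<xi> *\<^sub>R axis i 1 + \<eta> *\<^sub>R axis j 1)"
    using second_difference[OF f h] by blast
  obtain \<xi>' \<eta>' where 2: "0 < \<xi>'" "\<xi>' < h" "0 < \<eta>'" "\<eta>' < h"
    "f (x + h *\<^sub>R axis j 1 + h *\<^sub>R axis i 1) - f (x + h *\<^sub>R axis j 1) - f (x + h *\<^sub>R axis i 1) + f x
     = h\<^sup>2 * ?A (x + \<xi>' *\<^sub>R axis j 1 + \<eta>' *\<^sub>R axis i 1)"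
    using second_difference[OF f h] by blast
  have "h\<^sup>2 * ?A (x + \<xi>' *\<^sub>R axis j 1 + \<eta>' *\<^sub>R axis i 1) = h\<^sup>2 * ?B (x + \<xi> *\<^sub>R axis i 1 + \<eta> *\<^sub>R axis j 1)"
    using 1(5) 2(5) unfolding add.commute[of "x + h *\<^sub>R axis i 1"] add.assoc add.commute[of "h *\<^sub>R axis j 1"]
    by (smt (verit) add.assoc add.commute)
  then have "?A (x + \<xi>' *\<^sub>R axis j 1 + \<eta>' *\<^sub>R axis i 1) = ?B (x + \<xi> *\<^sub>R axis i 1 + \<eta> *\<^sub>R axis j 1)"
    using h by simp
  with d(2)[OF near[OF 2(1-4)], of j i] d(3)[OF near[OF 1(1-4)], of i j] show False
    by (simp add: \<epsilon>_def abs_if split: if_splits)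
qed

section \<open>Test functions and test fields\<close>

lemma compact_support_in_iff:
  "compact_support_in S f \<longleftrightarrow> (\<exists>K. compact K \<and> K \<subseteq> S \<and> (\<forall>x. x \<notin> K \<longrightarrow> f x = 0))"
proof
  assume "compact_support_in S f"
  then show "\<exists>K. compact K \<and> K \<subseteq> S \<and> (\<forall>x. x \<notin> K \<longrightarrow> f x = 0)"
    unfolding compact_support_in_def using closure_subset[of "{x. f x \<noteq> 0}"]
    by (intro exI[of _ "closure {x. f x \<noteq> 0}"]) blast
next
  assume "\<exists>K. compact K \<and> K \<subseteq> S \<and> (\<forall>x. x \<notin> K \<longrightarrow> f x = 0)"
  then obtain K where K: "compact K" "K \<subseteq> S" "\<And>x. x \<notin> K \<Longrightarrow> f x = 0" by blast
  then have "closure {x. f x \<noteq> 0} \<subseteq> K"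
    by (intro closure_minimal compact_imp_closed) auto
  with K show "compact_support_in S f"
    unfolding compact_support_in_def compact_eq_bounded_closed
    by (auto intro: bounded_subset)
qed

lemma partial_zero_outside:
  assumes "closed K" "\<And>x. x \<notin> K \<Longrightarrow> f x = 0" "x \<notin> K"
  shows "partial i f x = 0"
proof -
  have "((\<lambda>_. 0) has_derivative (\<lambda>_. 0)) (at x)" by simp
  then have "(f has_derivative (\<lambda>_. 0)) (at x)"
    by (rule has_derivative_transform_within_open[of _ _ _ _ "- K"])
       (use assms in auto)
  from partial_eqI[OF this] show ?thesis .
qed

lemma test_functionsI:
  assumes "smooth f" "compact K" "K \<subseteq> S" "\<And>x. x \<notin> K \<Longrightarrow> f x = 0"
  shows "f \<in> test_functions S"
  using assms by (auto simp: test_functions_def compact_support_in_iff)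

lemma test_functionsE:
  assumes "f \<in> test_functions S"
  obtains K where "smooth f" "compact K" "K \<subseteq> S" "\<And>x. x \<notin> K \<Longrightarrow> f x = 0"
proof -
  obtain K where "smooth f" "compact K" "K \<subseteq> S" "\<forall>x. x \<notin> K \<longrightarrow> f x = 0"
    using assms unfolding test_functions_def compact_support_in_iff by blast
  then show thesis by (intro that) auto
qed

lemma test_smooth: "f \<in> test_functions S \<Longrightarrow> smooth f"
  by (simp add: test_functions_def)

lemma test_mono: "f \<in> test_functions S \<Longrightarrow> S \<subseteq> T \<Longrightarrow> f \<in> test_functions T"
  by (auto simp: test_functions_def compact_support_in_def)

lemma test_zero_outside: "f \<in> test_functions S \<Longrightarrow> x \<notin> S \<Longrightarrow> f x = 0"
  by (erule test_functionsE) blast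

lemma test_partial: assumes "f \<in> test_functions S" shows "partial i f \<in> test_functions S"
  using assms
proof (rule test_functionsE)
  fix K assume K: "smooth f" "compact K" "K \<subseteq> S" "\<And>x. x \<notin> K \<Longrightarrow> f x = 0"
  show ?thesis
    by (rule test_functionsI[of _ K])
       (use K in \<open>auto intro: smooth_partial partial_zero_outside compact_imp_closed\<close>)
qed

lemma test_add:
  assumes "f \<in> test_functions S" "g \<in> test_functions S"
  shows "(\<lambda>x. f x + g x) \<in> test_functions S"
proof -
  obtain K where K: "smooth f" "compact K" "K \<subseteq> S" "\<And>x. x \<notin> K \<Longrightarrow> f x = 0"
    using assms(1) by (rule test_functionsE) (rule that; simp)
  obtain L where L: "smooth g" "compact L" "L \<subseteq> S" "\<And>x. x \<notin> L \<Longrightarrow> g x = 0"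
    using assms(2) by (rule test_functionsE) (rule that; simp)
  show ?thesis
    by (rule test_functionsI[of _ "K \<union> L"]) (use K L in \<open>auto intro: smooth_add\<close>)
qed

lemma test_mult:
  assumes "smooth f" "g \<in> test_functions S"
  shows "(\<lambda>x. f x * g x) \<in> test_functions S"
  using assms(2)
proof (rule test_functionsE)
  fix K assume K: "smooth g" "compact K" "K \<subseteq> S" "\<And>x. x \<notin> K \<Longrightarrow> g x = 0"
  show ?thesis
    by (rule test_functionsI[of _ K]) (use assms K in \<open>auto intro: smooth_mult\<close>)
qed

lemma test_cmult: "g \<in> test_functions S \<Longrightarrow> (\<lambda>x. c * g x) \<in> test_functions S"
  by (rule test_mult[OF smooth_const])

lemma test_diff:
  "f \<in> test_functions S \<Longrightarrow> g \<in> test_functions S \<Longrightarrow> (\<lambda>x. f x - g x) \<in> test_functions S"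
  using test_add[OF _ test_cmult[of g S "-1"]] by simp

lemma test_zero: "(\<lambda>x. 0) \<in> test_functions S"
  by (rule test_functionsI[of _ "{}"]) (auto intro: smooth_const)

lemma test_affine:
  assumes f: "f \<in> test_functions S" and c: "c \<noteq> 0" and T: "\<And>x. a + c *\<^sub>R x \<in> S \<Longrightarrow> x \<in> T"
  shows "(\<lambda>x. f (a + c *\<^sub>R x)) \<in> test_functions T"
  using f
proof (rule test_functionsE)
  fix K assume K: "smooth f" "compact K" "K \<subseteq> S" "\<And>x. x \<notin> K \<Longrightarrow> f x = 0"
  have inv: "a + c *\<^sub>R x = y \<longleftrightarrow> x = (1/c) *\<^sub>R (y - a)" for x y
  proof
    assume "a + c *\<^sub>R x = y"
    then have "y - a = c *\<^sub>R x" by auto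
    then show "x = (1/c) *\<^sub>R (y - a)" using c by simp
  qed (use c in simp)
  show ?thesis
  proof (rule test_functionsI[of _ "(\<lambda>y. (1/c) *\<^sub>R (y - a)) ` K"])
    show "compact ((\<lambda>y. (1/c) *\<^sub>R (y - a)) ` K)"
      by (intro compact_continuous_image K continuous_intros)
    show "(\<lambda>y. (1/c) *\<^sub>R (y - a)) ` K \<subseteq> T"
    proof safe
      fix y assume "y \<in> K"
      then have "a + c *\<^sub>R ((1/c) *\<^sub>R (y - a)) \<in> S" using K c by auto
      then show "(1/c) *\<^sub>R (y - a) \<in> T" by (rule T)
    qed
    show "f (a + c *\<^sub>R x) = 0" if "x \<notin> (\<lambda>y. (1/c) *\<^sub>R (y - a)) ` K" for x
      using that inv by (intro K(4)) (auto simp: image_iff)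
  qed (use K in \<open>auto intro: smooth_affine\<close>)
qed

lemma test_fields_iff: "\<psi> \<in> test_fields S \<longleftrightarrow> (\<forall>i. (\<lambda>x. \<psi> x $ i) \<in> test_functions S)"
proof
  assume "\<psi> \<in> test_fields S"
  then show "\<forall>i. (\<lambda>x. \<psi> x $ i) \<in> test_functions S"
    by (force simp: test_fields_def test_functions_def compact_support_in_iff)
next
  assume *: "\<forall>i. (\<lambda>x. \<psi> x $ i) \<in> test_functions S"
  then have "\<forall>i. \<exists>K. compact K \<and> K \<subseteq> S \<and> (\<forall>x. x \<notin> K \<longrightarrow> \<psi> x $ i = 0)"
    by (auto simp: test_functions_def compact_support_in_iff)
  then obtain K where "\<forall>i. compact (K i) \<and> K i \<subseteq> S \<and> (\<forall>x. x \<notin> K i \<longrightarrow> \<psi> x $ i = 0)"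
    by metis
  then have "compact (\<Union>i. K i) \<and> (\<Union>i. K i) \<subseteq> S \<and> (\<forall>x. x \<notin> (\<Union>i. K i) \<longrightarrow> \<psi> x = 0)"
    by (auto simp: vec_eq_iff)
  with * show "\<psi> \<in> test_fields S"
    unfolding test_fields_def compact_support_in_iff by (auto intro: test_smooth)
qed

lemma test_continuous: "f \<in> test_functions S \<Longrightarrow> continuous_on UNIV f"
  by (intro smooth_continuous test_smooth)

lemma test_measurable: "f \<in> test_functions S \<Longrightarrow> f \<in> borel_measurable borel"
  by (intro borel_measurable_continuous_onI test_continuous)

lemma test_integrable: assumes "f \<in> test_functions S" shows "integrable lborel f"
  using assms
proof (rule test_functionsE)
  fix K assume K: "smooth f" "compact K" "K \<subseteq> S" "\<And>x. x \<notin> K \<Longrightarrow> f x = 0"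
  have "integrable lborel (\<lambda>x. indicator K x *\<^sub>R f x)"
    by (intro borel_integrable_compact K continuous_on_subset[OF smooth_continuous]) auto
  also have "(\<lambda>x. indicator K x *\<^sub>R f x) = f"
    using K(4) by (force simp: indicator_def)
  finally show ?thesis .
qed

lemma test_bounded:
  assumes "f \<in> test_functions S" obtains B where "B \<ge> 0" "\<And>x. \<bar>f x\<bar> \<le> B"
  using assms
proof (rule test_functionsE)
  fix K assume K: "smooth f" "compact K" "K \<subseteq> S" "\<And>x. x \<notin> K \<Longrightarrow> f x = 0"
  have "bounded (f ` K)"
    by (intro compact_imp_bounded compact_continuous_image K continuous_on_subset[OF smooth_continuous]) auto
  then obtain B where B: "B > 0" "\<And>x. x \<in> K \<Longrightarrow> \<bar>f x\<bar> \<le> B"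
    by (auto simp: bounded_pos)
  show ?thesis
    by (rule that[of B]) (use B K in \<open>auto, metis abs_zero less_eq_real_def\<close>)
qed

lemma test_L2: assumes "f \<in> test_functions S" shows "L2_on UNIV f"
  unfolding L2_on_UNIV_iff
  using test_integrable[OF test_mult[OF test_smooth[OF assms] assms]] test_measurable[OF assms]
  by (simp add: power2_eq_square)

lemma L2_components:
  fixes u :: "vec3 \<Rightarrow> vec3"
  shows "L2_on UNIV u \<longleftrightarrow> (\<forall>i. L2_on UNIV (\<lambda>x. u x $ i))"
proof
  assume u: "L2_on UNIV u"
  show "\<forall>i. L2_on UNIV (\<lambda>x. u x $ i)"
    using borel_measurable_inner[OF L2_measurable[OF u] borel_measurable_const, of "axis _ 1"] component_le_norm_cart
    by (intro allI, rule_tac L2_dominated[OF u, of _ 1]) (auto simp: inner_axis)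
next
  assume c: "\<forall>i. L2_on UNIV (\<lambda>x. u x $ i)"
  have "L2_on UNIV (\<lambda>x. \<Sum>i\<in>UNIV. (u x $ i) *\<^sub>R axis i (1::real))"
  proof -
    have "L2_on UNIV (\<lambda>x. (u x $ i) *\<^sub>R (axis i 1 :: vec3))" for i
      by (rule L2_dominated[of "\<lambda>x. u x $ i" _ 1])
         (use c L2_measurable[of "\<lambda>x. u x $ i"] in auto)
    then show ?thesis unfolding sum_3 by (intro L2_add)
  qed
  then show "L2_on UNIV u"
    using basis_expansion[of "u _"] by (simp add: scalar_mult_eq_scaleR[symmetric])
qed

section \<open>Integration by parts and identities of vector calculus\<close>

lemma integrable_affine:
  fixes f :: "vec3 \<Rightarrow> 'b::{banach,second_countable_topology}"
  assumes c: "c \<noteq> 0" and f: "integrable lborel f"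
  shows "integrable lborel (\<lambda>x. f (t + c *\<^sub>R x))"
proof -
  have [measurable]: "f \<in> borel_measurable borel" using f by auto
  have "integrable (density (distr lborel borel (\<lambda>x::vec3. t + c *\<^sub>R x)) (\<lambda>_. \<bar>c\<bar>^DIM(vec3))) f"
    using f unfolding lborel_affine[OF c, of t, symmetric] .
  then have "integrable (distr lborel borel (\<lambda>x::vec3. t + c *\<^sub>R x)) (\<lambda>x. \<bar>c\<bar>^DIM(vec3) *\<^sub>R f x)"
    by (subst (asm) integrable_density) auto
  then have "integrable lborel (\<lambda>x. \<bar>c\<bar>^DIM(vec3) *\<^sub>R f (t + c *\<^sub>R x))"
    by (subst (asm) integrable_distr_eq) auto
  from integrable_scaleR_right[OF this, of "1 / \<bar>c\<bar>^3"] show ?thesis using c by simp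
qed

lemma integral_affine:
  fixes f :: "vec3 \<Rightarrow> 'b::{banach,second_countable_topology}"
  assumes c: "c \<noteq> 0" and f[measurable]: "f \<in> borel_measurable borel"
  shows "(LINT x|lborel. f (t + c *\<^sub>R x)) = (1 / \<bar>c\<bar>^3) *\<^sub>R (LINT x|lborel. f x)"
proof -
  have "(LINT x|lborel. f x)
      = (LINT x|density (distr lborel borel (\<lambda>x::vec3. t + c *\<^sub>R x)) (\<lambda>_. \<bar>c\<bar>^DIM(vec3)). f x)"
    unfolding lborel_affine[OF c, of t, symmetric] ..
  also have "\<dots> = (LINT x|distr lborel borel (\<lambda>x::vec3. t + c *\<^sub>R x). \<bar>c\<bar>^DIM(vec3) *\<^sub>R f x)"
    by (subst integral_density) auto
  also have "\<dots> = (LINT x|lborel. \<bar>c\<bar>^DIM(vec3) *\<^sub>R f (t + c *\<^sub>R x))"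
    by (subst integral_distr) auto
  finally show ?thesis using c by simp
qed

text \<open>An affine dilation pulls null sets back to null sets, because Lebesgue measure is a
  constant multiple of its own image. This carries almost everywhere statements on the domain over
  to the rescaled variable.\<close>

lemma AE_affine:
  fixes P :: "vec3 \<Rightarrow> bool"
  assumes c: "c \<noteq> 0" and P: "AE x in lborel. P x"
  shows "AE x in lborel. P (t + c *\<^sub>R x)"
proof -
  obtain N where N: "{x. \<not> P x} \<subseteq> N" "N \<in> null_sets (lborel :: vec3 measure)"
    using P by (auto elim!: AE_E simp: null_sets_def)
  have [measurable]: "N \<in> sets borel" using N(2) by auto
  have "AE x in lborel. x \<notin> N" using N(2) by (rule AE_not_in)
  then have "AE x in density (distr lborel borel (\<lambda>x::vec3. t + c *\<^sub>R x)) (\<lambda>_. \<bar>c\<bar>^DIM(vec3)). x \<notin> N"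
    unfolding lborel_affine[OF c, of t, symmetric] .
  then have "AE x in distr lborel borel (\<lambda>x::vec3. t + c *\<^sub>R x). x \<notin> N"
    using c by (subst (asm) AE_density) auto
  then have "AE x in lborel. t + c *\<^sub>R x \<notin> N"
    by (subst (asm) AE_distr_iff) auto
  then show ?thesis by eventually_elim (use N(1) in blast)
qed

text \<open>The integral of \<open>f (x + e) - f x\<close> vanishes by translation invariance; on the other hand the
  integrand is the integral of \<open>f' (x + s e)\<close> over \<open>0 \<le> s \<le> 1\<close>, and Fubini applies.\<close>

lemma integral_directional_derivative_eq_0:
  fixes f f' :: "vec3 \<Rightarrow> real"
  assumes df: "\<And>x s. ((\<lambda>s. f (x + s *\<^sub>R e)) has_vector_derivative f' (x + s *\<^sub>R e)) (at s)"
    and cont: "continuous_on UNIV f'"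
    and f: "integrable lborel f" and pf: "integrable lborel f'"
  shows "(LINT x|lborel. f' x) = 0"
proof -
  define g where "g s x = indicator {0..1} s *\<^sub>R f' (x + s *\<^sub>R e)" for s :: real and x
  have pf_meas [measurable]: "f' \<in> borel_measurable borel" using pf by auto
  have g_meas: "case_prod g \<in> borel_measurable (lborel \<Otimes>\<^sub>M lborel)"
    unfolding g_def by measurable
  have shift: "integrable lborel (\<lambda>x. h (x + a))" "(LINT x|lborel. h (x + a)) = (LINT x|lborel. h x)"
    if "integrable lborel h" for h :: "vec3 \<Rightarrow> real" and a
    using integrable_affine[of 1 h a] integral_affine[of 1 h a] that by (auto simp: add.commute)
  have "integrable (lborel \<Otimes>\<^sub>M lborel) (case_prod g)"
  proof (rule lborel_pair.Fubini_integrable[OF g_meas])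
    \<comment> \<open>By translation invariance the inner integral depends on \<open>s\<close> only
      through the cut-off to the unit interval, so the double integral is finite.\<close>
    have "(LINT x|lborel. norm (g s x)) = indicator {0..1} s * (LINT x|lborel. \<bar>f' x\<bar>)" for s
      using shift(2)[of "\<lambda>x. \<bar>f' x\<bar>" "s *\<^sub>R e"] pf by (simp add: g_def abs_mult)
    then show "integrable lborel (\<lambda>s. LINT x|lborel. norm (case_prod g (s, x)))" by simp
    show "AE s in lborel. integrable lborel (\<lambda>x. case_prod g (s, x))"
      using shift(1)[OF pf] by (simp add: g_def)
  qed
  then have "(LINT x|lborel. LINT s|lborel. g s x) = (LINT s|lborel. LINT x|lborel. g s x)"
    by (rule lborel_pair.Fubini_integral)
  also have "(LINT s|lborel. LINT x|lborel. g s x) = (LINT s|lborel. indicator {0..1::real} s * (LINT x|lborel. f' x))"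
    using shift(2)[OF pf] by (simp add: g_def)
  also have "\<dots> = (LINT x|lborel. f' x)" by simp
  finally have 1: "(LINT x|lborel. LINT s|lborel. g s x) = (LINT x|lborel. f' x)" .
  have 2: "(LINT s|lborel. g s x) = f (x + e) - f x" for x
  proof -
    have "(LINT s|lborel. g s x) = f (x + 1 *\<^sub>R e) - f (x + 0 *\<^sub>R e)"
      unfolding g_def
    proof (rule integral_FTC_atLeastAtMost)
      show "((\<lambda>s. f (x + s *\<^sub>R e)) has_vector_derivative f' (x + s *\<^sub>R e)) (at s within {0..1})" for s
        by (rule has_vector_derivative_at_within[OF df])
      show "continuous_on {0..1} (\<lambda>s. f' (x + s *\<^sub>R e))"
        by (intro continuous_on_compose2[OF cont] continuous_intros) auto
    qed simp
    then show ?thesis by simp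
  qed
  have "(LINT x|lborel. f (x + e) - f x) = 0"
    using shift[OF f] f by simp
  with 1 show ?thesis by (simp add: 2)
qed

lemma integral_partial_eq_0:
  assumes df: "\<And>x. f differentiable (at x)" and cont: "continuous_on UNIV (partial i f)"
    and f: "integrable lborel f" and pf: "integrable lborel (partial i f)"
  shows "(LINT x|lborel. partial i f x) = 0"
proof (rule integral_directional_derivative_eq_0[OF _ cont f pf])
  fix x and s :: real
  let ?e = "axis i 1 :: vec3"
  let ?f' = "frechet_derivative f (at (x + s *\<^sub>R ?e))"
  have f': "(f has_derivative ?f') (at (x + s *\<^sub>R ?e))"
    using df frechet_derivative_works by blast
  have "((\<lambda>s. f (x + s *\<^sub>R ?e)) has_derivative (\<lambda>h. ?f' (h *\<^sub>R ?e))) (at s)"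
    by (rule has_derivative_compose[of "\<lambda>s. x + s *\<^sub>R ?e" _ s UNIV f, OF _ f'])
       (auto intro!: derivative_eq_intros)
  then show "((\<lambda>s. f (x + s *\<^sub>R ?e)) has_vector_derivative partial i f (x + s *\<^sub>R ?e)) (at s)"
    using linear_cmul[OF has_derivative_linear[OF f']]
    by (simp add: has_vector_derivative_def partial_def)
qed

text \<open>Compact support of one factor already makes the product a test function, whose partial
  derivatives integrate to zero.\<close>

lemma integral_by_parts:
  assumes f: "smooth f" and g: "g \<in> test_functions S"
  shows "(LINT x|lborel. partial i f x * g x) = - (LINT x|lborel. f x * partial i g x)"
proof -
  have fg: "(\<lambda>x. f x * g x) \<in> test_functions S" by (rule test_mult[OF f g])
  have int: "integrable lborel (\<lambda>x. partial i f x * g x)" "integrable lborel (\<lambda>x. f x * partial i g x)"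
    using test_integrable test_mult smooth_partial f g test_partial by blast+
  have "0 = (LINT x|lborel. partial i (\<lambda>x. f x * g x) x)"
    by (rule integral_partial_eq_0[symmetric])
       (use fg test_partial[OF fg] in \<open>auto intro: smooth_differentiable test_smooth test_continuous test_integrable\<close>)
  also have "\<dots> = (LINT x|lborel. f x * partial i g x + partial i f x * g x)"
    by (simp add: partial_mult[OF f test_smooth[OF g]])
  finally show ?thesis using int by simp
qed

section \<open>Vector calculus for curl, divergence and gradient\<close>

definition smooth_field :: "(vec3 \<Rightarrow> vec3) \<Rightarrow> bool" where
  "smooth_field u \<longleftrightarrow> (\<forall>i. smooth (\<lambda>x. u x $ i))"

definition laplacian :: "(vec3 \<Rightarrow> real) \<Rightarrow> vec3 \<Rightarrow> real" where
  "laplacian f x = (\<Sum>i\<in>UNIV. partial i (partial i f) x)"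

lemma smooth_fieldD: "smooth_field u \<Longrightarrow> smooth (\<lambda>x. u x $ i)"
  by (simp add: smooth_field_def)

lemma test_smooth_field: "\<psi> \<in> test_fields S \<Longrightarrow> smooth_field \<psi>"
  unfolding test_fields_iff smooth_field_def using test_smooth by blast

lemma test_fields_component: "\<psi> \<in> test_fields S \<Longrightarrow> (\<lambda>x. \<psi> x $ i) \<in> test_functions S"
  by (simp add: test_fields_iff)

lemma test_fields_mono: "f \<in> test_fields S \<Longrightarrow> S \<subseteq> T \<Longrightarrow> f \<in> test_fields T"
  by (auto simp: test_fields_iff intro: test_mono)

lemma curl_nth:
  "curl f x $ 1 = partial 2 (\<lambda>y. f y $ 3) x - partial 3 (\<lambda>y. f y $ 2) x"
  "curl f x $ 2 = partial 3 (\<lambda>y. f y $ 1) x - partial 1 (\<lambda>y. f y $ 3) x"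
  "curl f x $ 3 = partial 1 (\<lambda>y. f y $ 2) x - partial 2 (\<lambda>y. f y $ 1) x"
  by (simp_all add: curl_def)

lemma inner_3: "(x::vec3) \<bullet> y = x $ 1 * y $ 1 + x $ 2 * y $ 2 + x $ 3 * y $ 3"
  by (simp add: inner_vec_def sum_3)

lemma norm_power2_3: "(norm (x::vec3))\<^sup>2 = (x $ 1)\<^sup>2 + (x $ 2)\<^sup>2 + (x $ 3)\<^sup>2"
  unfolding power2_norm_eq_inner inner_3 by (simp add: power2_eq_square)

lemma divergence_3: "divergence f x =
    partial 1 (\<lambda>y. f y $ 1) x + partial 2 (\<lambda>y. f y $ 2) x + partial 3 (\<lambda>y. f y $ 3) x"
  by (simp add: divergence_def sum_3)

lemma curl_test_field: assumes "\<psi> \<in> test_fields S" shows "curl \<psi> \<in> test_fields S"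
  unfolding test_fields_iff forall_3 curl_nth
  by (intro conjI test_diff test_partial test_fields_component assms)

lemma divergence_test: assumes "\<psi> \<in> test_fields S" shows "divergence \<psi> \<in> test_functions S"
  unfolding divergence_3[abs_def]
  by (intro test_add test_partial test_fields_component assms)

lemma grad_nth: "grad f x $ i = partial i f x"
  by (simp add: grad_def)

lemma grad_test_field: "f \<in> test_functions S \<Longrightarrow> grad f \<in> test_fields S"
  by (simp add: test_fields_iff grad_nth test_partial)

lemma smooth_grad: "smooth f \<Longrightarrow> smooth_field (grad f)"
  by (simp add: smooth_field_def grad_nth smooth_partial)

lemma curl_grad: "smooth f \<Longrightarrow> curl (grad f) x = 0"
  by (simp add: vec_eq_iff forall_3 curl_nth grad_nth partial_commute[of f])

lemma divergence_curl: assumes "smooth_field u" shows "divergence (curl u) x = 0"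
  using assms
  by (simp add: divergence_3 curl_nth partial_diff smooth_partial smooth_fieldD
      partial_commute[of "\<lambda>y. u y $ _" 2 1] partial_commute[of "\<lambda>y. u y $ _" 3 1]
      partial_commute[of "\<lambda>y. u y $ _" 3 2])

text \<open>The componentwise form of curl curl = grad div - Laplacian. Through it, orthogonality to
  gradients and to double curls becomes orthogonality to Laplacians.\<close>

lemma curl_curl:
  assumes "smooth_field u"
  shows "curl (curl u) x $ i = partial i (divergence u) x - laplacian (\<lambda>y. u y $ i) x"
proof -
  note s = smooth_fieldD[OF assms]
  have "\<forall>i. curl (curl u) x $ i = partial i (divergence u) x - laplacian (\<lambda>y. u y $ i) x"
    unfolding forall_3 divergence_3[abs_def] laplacian_def sum_3
    by (simp add: curl_nth partial_diff partial_add smooth_add smooth_partial s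
        partial_commute[OF s, of 2 1] partial_commute[OF s, of 3 1] partial_commute[OF s, of 3 2])
  then show ?thesis by blast
qed

lemma curl_diff:
  "smooth_field u \<Longrightarrow> smooth_field v \<Longrightarrow> curl (\<lambda>x. u x - v x) x = curl u x - curl v x"
  by (simp add: vec_eq_iff forall_3 curl_nth partial_diff smooth_fieldD)

lemma curl_scaleR: "smooth_field u \<Longrightarrow> curl (\<lambda>x. c *\<^sub>R u x) x = c *\<^sub>R curl u x"
  by (simp add: vec_eq_iff forall_3 curl_nth partial_cmult smooth_fieldD right_diff_distrib)

lemma curl_affine:
  "smooth_field u \<Longrightarrow> curl (\<lambda>x. u (a + c *\<^sub>R x)) x = c *\<^sub>R curl u (a + c *\<^sub>R x)"
  by (simp add: vec_eq_iff forall_3 curl_nth partial_affine[of "\<lambda>y. u y $ _"] smooth_differentiable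
      smooth_fieldD right_diff_distrib)

lemma curl_const: "curl (\<lambda>x. c) x = 0"
  by (simp add: vec_eq_iff forall_3 curl_nth partial_def)

lemma test_fields_diff:
  "u \<in> test_fields S \<Longrightarrow> v \<in> test_fields S \<Longrightarrow> (\<lambda>x. u x - v x) \<in> test_fields S"
  by (simp add: test_fields_iff test_diff)

lemma test_fields_scaleR: "u \<in> test_fields S \<Longrightarrow> (\<lambda>x. c *\<^sub>R u x) \<in> test_fields S"
  by (simp add: test_fields_iff test_cmult)

lemma test_fields_affine:
  assumes "u \<in> test_fields S" "c \<noteq> 0" "\<And>x. a + c *\<^sub>R x \<in> S \<Longrightarrow> x \<in> T"
  shows "(\<lambda>x. u (a + c *\<^sub>R x)) \<in> test_fields T"
  using assms test_affine[of "\<lambda>x. u x $ _" S c a T] by (auto simp: test_fields_iff)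

lemma test_field_L2: "\<psi> \<in> test_fields S \<Longrightarrow> L2_on UNIV \<psi>"
  unfolding test_fields_iff L2_components using test_L2 by blast

lemma test_field_zero_outside: "\<psi> \<in> test_fields S \<Longrightarrow> x \<notin> S \<Longrightarrow> \<psi> x = 0"
  using test_zero_outside[OF test_fields_component] by (simp add: vec_eq_iff)

lemma set_integral_eq_integral:
  fixes h :: "vec3 \<Rightarrow> real"
  assumes "\<And>x. x \<notin> S \<Longrightarrow> h x = 0"
  shows "(LINT x:S|lborel. h x) = (LINT x|lborel. h x)"
  unfolding set_lebesgue_integral_def
  by (rule Bochner_Integration.integral_cong) (use assms in \<open>auto simp: indicator_def\<close>)

lemma integral_curl_by_parts:
  assumes u: "smooth_field u" and \<psi>: "\<psi> \<in> test_fields S"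
  shows "(LINT x|lborel. u x \<bullet> curl \<psi> x) = (LINT x|lborel. curl u x \<bullet> \<psi> x)"
proof -
  let ?\<psi> = "\<lambda>i x. \<psi> x $ i" and ?u = "\<lambda>i x. u x $ i"
  have int: "integrable lborel (\<lambda>x. u x $ i * partial j (?\<psi> k) x)"
    "integrable lborel (\<lambda>x. partial j (?u i) x * \<psi> x $ k)" for i j k
    using test_integrable[OF test_mult[OF smooth_fieldD[OF u] test_partial[OF test_fields_component[OF \<psi>]]]]
      test_integrable[OF test_mult[OF smooth_partial[OF smooth_fieldD[OF u]] test_fields_component[OF \<psi>]]]
    by auto
  have ibp: "(LINT x|lborel. u x $ i * partial j (?\<psi> k) x) = - (LINT x|lborel. partial j (?u i) x * \<psi> x $ k)"
    for i j k
    using integral_by_parts[OF smooth_fieldD[OF u] test_fields_component[OF \<psi>], of j i k] by simp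
  show ?thesis
    by (simp add: inner_3 curl_nth right_diff_distrib left_diff_distrib int ibp)
qed

lemma integral_grad_by_parts:
  assumes f: "smooth f" and \<psi>: "\<psi> \<in> test_fields S"
  shows "(LINT x|lborel. f x * divergence \<psi> x) = - (LINT x|lborel. grad f x \<bullet> \<psi> x)"
proof -
  have int: "integrable lborel (\<lambda>x. f x * partial j (\<lambda>y. \<psi> y $ k) x)"
    "integrable lborel (\<lambda>x. partial j f x * \<psi> x $ k)" for j k
    using test_integrable[OF test_mult[OF f test_partial[OF test_fields_component[OF \<psi>]]]]
      test_integrable[OF test_mult[OF smooth_partial[OF f] test_fields_component[OF \<psi>]]] by auto
  show ?thesis
    by (simp add: inner_3 divergence_3 grad_nth distrib_left int integral_by_parts[OF f test_fields_component[OF \<psi>]])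
qed

text \<open>Two integrations by parts with a commutation of second derivatives in between; the two
  signs cancel. These are the mixed terms that must vanish in the curl-div identity.\<close>

lemma integral_partial_swap:
  assumes f: "f \<in> test_functions S" and g: "g \<in> test_functions S"
  shows "(LINT x|lborel. partial i f x * partial j g x) = (LINT x|lborel. partial j f x * partial i g x)"
proof -
  have "(LINT x|lborel. partial i f x * partial j g x) = - (LINT x|lborel. f x * partial i (partial j g) x)"
    by (rule integral_by_parts[OF test_smooth[OF f] test_partial[OF g]])
  also have "\<dots> = - (LINT x|lborel. f x * partial j (partial i g) x)"
    by (simp add: partial_commute[OF test_smooth[OF g], of i j])
  also have "\<dots> = (LINT x|lborel. partial j f x * partial i g x)"
    by (simp add: integral_by_parts[OF test_smooth[OF f] test_partial[OF g]])
  finally show ?thesis .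
qed

text \<open>Pointwise, the right integrand minus the left one is twice the sum of the principal
  2-by-2 minors of the Jacobian. Such minors are null Lagrangians: they integrate to zero for
  compactly supported fields.\<close>

lemma norm_curl_div_identity:
  assumes \<psi>: "\<psi> \<in> test_fields S"
  shows "(\<Sum>i\<in>UNIV. \<Sum>j\<in>UNIV. LINT x|lborel. (partial j (\<lambda>y. \<psi> y $ i) x)\<^sup>2)
    = (LINT x|lborel. (norm (curl \<psi> x))\<^sup>2) + (LINT x|lborel. (divergence \<psi> x)\<^sup>2)"
proof -
  let ?p = "\<lambda>j i x. partial j (\<lambda>y. \<psi> y $ i) x"
  note t = test_fields_component[OF \<psi>]
  have int: "integrable lborel (\<lambda>x. ?p j i x * ?p l k x)" for i j k l
    by (rule test_integrable[OF test_mult[OF test_smooth[OF test_partial[OF t]] test_partial[OF t]]])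
  have "(LINT x|lborel. (norm (curl \<psi> x))\<^sup>2) + (LINT x|lborel. (divergence \<psi> x)\<^sup>2)
     - (\<Sum>i\<in>UNIV. \<Sum>j\<in>UNIV. LINT x|lborel. (?p j i x)\<^sup>2)
    = 2 * ((LINT x|lborel. ?p 1 1 x * ?p 2 2 x) - (LINT x|lborel. ?p 2 1 x * ?p 1 2 x))
    + 2 * ((LINT x|lborel. ?p 1 1 x * ?p 3 3 x) - (LINT x|lborel. ?p 3 1 x * ?p 1 3 x))
    + 2 * ((LINT x|lborel. ?p 2 2 x * ?p 3 3 x) - (LINT x|lborel. ?p 3 2 x * ?p 2 3 x))"
    unfolding norm_power2_3 curl_nth divergence_3 sum_3
    by (simp add: power2_eq_square algebra_simps int)
  also have "\<dots> = 0"
    using integral_partial_swap[OF t t, of 1 1 2 2] integral_partial_swap[OF t t, of 1 1 3 3]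
      integral_partial_swap[OF t t, of 2 2 3 3] by simp
  finally show ?thesis by simp
qed

text \<open>Hardy's inequality, in a form without singularity at the origin, obtained from the field
  \<open>x / (1 + |x|\<^sup>2)\<close> of divergence at least \<open>1 / (1 + |x|\<^sup>2)\<close>.\<close>

lemma hardy_inequality:
  assumes f: "f \<in> test_functions S"
  shows "(LINT x|lborel. (f x)\<^sup>2 / (1 + (norm x)\<^sup>2)) \<le> 4 * (\<Sum>i\<in>UNIV. LINT x|lborel. (partial i f x)\<^sup>2)"
proof -
  obtain K where K: "smooth f" "compact K" "K \<subseteq> S" "\<And>x. x \<notin> K \<Longrightarrow> f x = 0"
    using f by (rule test_functionsE) (rule that; simp)
  define w where "w x = 1 + (norm x)\<^sup>2" for x :: vec3
  have w: "w x > 0" "w x \<noteq> 0" for x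
    unfolding w_def by (smt (verit) zero_le_power2)+
  \<comment> \<open>The \<open>h i\<close> are the components of the field \<open>f^2 x / w\<close>
    and \<open>d i\<close> is the i-th summand of its divergence. The brackets with the factor
    \<open>f^2\<close> add up to \<open>3 / w - 2 |x|^2 / w^2\<close>.\<close>
  define h where "h i x = (f x)\<^sup>2 * (x $ i / w x)" for i x
  define d where "d i x = (f x)\<^sup>2 * (1 / w x - 2 * (x $ i)\<^sup>2 / (w x)\<^sup>2) + 2 * f x * partial i f x * (x $ i / w x)" for i x
  have cont_w: "continuous_on A w" for A
    unfolding w_def by (intro continuous_intros)
  have contf: "continuous_on A f" "continuous_on A (partial i f)" for A i
    using test_continuous[OF f] test_continuous[OF test_partial[OF f]] continuous_on_subset by blast+
  have comp_int: "integrable lborel g" if "continuous_on UNIV g" "\<And>x. f x = 0 \<Longrightarrow> g x = 0"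
    for g :: "vec3 \<Rightarrow> real"
  proof -
    have "integrable lborel (\<lambda>x. indicator K x *\<^sub>R g x)"
      by (intro borel_integrable_compact K(2) continuous_on_subset[OF that(1)]) auto
    also have "(\<lambda>x. indicator K x *\<^sub>R g x) = g"
      using K(4) that(2) by (force simp: indicator_def)
    finally show ?thesis .
  qed
  have dh: "(h i has_derivative (\<lambda>v. (f x)\<^sup>2 * (v $ i / w x - x $ i * (2 * (x \<bullet> v)) / (w x)\<^sup>2)
      + 2 * f x * frechet_derivative f (at x) v * (x $ i / w x))) (at x)" for i x
  proof -
    have dw: "(w has_derivative (\<lambda>v. 2 * (x \<bullet> v))) (at x)"
      unfolding w_def power2_norm_eq_inner
      by (auto intro!: derivative_eq_intros simp: inner_commute)
    have dc: "((\<lambda>x::vec3. x $ i) has_derivative (\<lambda>v. v $ i)) (at x)"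
      by (rule bounded_linear_imp_has_derivative[OF bounded_linear_vec_nth])
    have "((\<lambda>x. (f x * f x) * (x $ i / w x)) has_derivative
      (\<lambda>v. (f x * f x) * (((v $ i) * w x - x $ i * (2 * (x \<bullet> v))) / (w x * w x))
        + (f x * frechet_derivative f (at x) v + frechet_derivative f (at x) v * f x) * (x $ i / w x))) (at x)"
      by (intro has_derivative_mult has_derivative_divide' dw dc smooth_has_derivative K(1) w)
    then show ?thesis
      unfolding h_def using w[of x]
      by (simp add: power2_eq_square diff_divide_distrib algebra_simps)
  qed
  have ph: "partial i (h i) = d i" for i
  proof
    fix x show "partial i (h i) x = d i x"
      using partial_eqI[OF dh[of i x], of i]
      by (simp add: d_def partial_def inner_axis power2_eq_square)
  qed
  have cont_d: "continuous_on UNIV (d i)" for i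
    unfolding d_def by (intro continuous_intros cont_w contf) (use w in auto)
  have cont_h: "continuous_on UNIV (h i)" for i
    unfolding h_def by (intro continuous_intros cont_w contf) (use w in auto)
  have int_d: "integrable lborel (d i)" for i
    by (rule comp_int[OF cont_d]) (simp add: d_def)
  have "(LINT x|lborel. d i x) = 0" for i
    unfolding ph[symmetric]
    by (rule integral_partial_eq_0)
       (use dh cont_d ph int_d comp_int[OF cont_h] in \<open>auto simp: differentiable_def h_def\<close>)
  then have sum_d: "(LINT x|lborel. (\<Sum>i\<in>UNIV. d i x)) = 0"
    using int_d by simp
  define q where "q x = (f x)\<^sup>2 / w x" for x
  have int_q: "integrable lborel q"
    unfolding q_def by (rule comp_int) (auto intro!: continuous_intros cont_w contf simp: w)
  have int_p: "integrable lborel (\<lambda>x. (partial i f x)\<^sup>2)" for i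
    using L2_integrable_norm[OF test_L2[OF test_partial[OF f]]] by simp
  \<comment> \<open>Young's inequality in \<open>am\<close> costs \<open>f^2 |x|^2 / (2 w^2)\<close>
    and twice the squared gradient. What remains of the divergence is
    \<open>f^2 (3 / w - 5/2 |x|^2 / w^2)\<close>, which equals \<open>q / 2\<close> plus
    \<open>5/2 f^2 / w^2\<close>. Absorbing half of \<open>q\<close> on the left turns the factor 2
    into the final constant 4.\<close>
  have pointwise: "q x \<le> (\<Sum>i\<in>UNIV. d i x) + (1 / 2 * q x + 2 * (\<Sum>i\<in>UNIV. (partial i f x)\<^sup>2))" for x
  proof -
    note nx = norm_power2_3[of x]
    have am: "0 \<le> (f x)\<^sup>2 * (x $ i)\<^sup>2 / (w x)\<^sup>2 / 2 + 2 * (partial i f x)\<^sup>2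
        + 2 * f x * partial i f x * (x $ i / w x)" for i
    proof -
      have "0 \<le> (f x * (x $ i / w x) / 2 + partial i f x)\<^sup>2 * 2" by simp
      then show ?thesis
        by (simp add: power2_sum power_mult_distrib power_divide algebra_simps)
    qed
    have "(\<Sum>i\<in>UNIV. d i x) + (1 / 2 * q x + 2 * (\<Sum>i\<in>UNIV. (partial i f x)\<^sup>2)) - q x
       = (\<Sum>i\<in>UNIV. (f x)\<^sup>2 * (x $ i)\<^sup>2 / (w x)\<^sup>2 / 2 + 2 * (partial i f x)\<^sup>2 + 2 * f x * partial i f x * (x $ i / w x))
        + (f x)\<^sup>2 * (5 / 2 * (1 / w x - (norm x)\<^sup>2 / (w x)\<^sup>2))"
      unfolding d_def q_def sum_3 nx using w[of x] by (simp add: field_simps)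
    also have "\<dots> \<ge> 0"
    proof (rule add_nonneg_nonneg)
      show "0 \<le> (\<Sum>i\<in>UNIV. (f x)\<^sup>2 * (x $ i)\<^sup>2 / (w x)\<^sup>2 / 2 + 2 * (partial i f x)\<^sup>2
          + 2 * f x * partial i f x * (x $ i / w x))"
        by (rule sum_nonneg) (rule am)
      have "1 / w x - (norm x)\<^sup>2 / (w x)\<^sup>2 = 1 / (w x)\<^sup>2"
        using w[of x] by (simp add: field_simps power2_eq_square) (simp add: w_def power2_eq_square algebra_simps)
      then show "0 \<le> (f x)\<^sup>2 * (5 / 2 * (1 / w x - (norm x)\<^sup>2 / (w x)\<^sup>2))" by simp
    qed
    finally show ?thesis by simp
  qed
  have "(LINT x|lborel. q x)
      \<le> (LINT x|lborel. (\<Sum>i\<in>UNIV. d i x) + (1 / 2 * q x + 2 * (\<Sum>i\<in>UNIV. (partial i f x)\<^sup>2)))"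
    by (intro integral_mono Bochner_Integration.integrable_add Bochner_Integration.integrable_sum
        integrable_mult_right int_q int_d int_p pointwise)
  also have "\<dots> = (LINT x|lborel. q x) / 2 + 2 * (\<Sum>i\<in>UNIV. LINT x|lborel. (partial i f x)\<^sup>2)"
    using int_q int_d int_p sum_d by simp
  finally show ?thesis by (simp add: q_def w_def)
qed

section \<open>Bump functions and uniqueness of weak derivatives\<close>

text \<open>The family \<open>exp (-1/t) / t ^ n\<close> is closed under differentiation up to linear combinations.\<close>

definition flat_exp :: "nat \<Rightarrow> real \<Rightarrow> real" where
  "flat_exp n t = (if t > 0 then exp (- 1 / t) / t ^ n else 0)"

lemma flat_exp_tendsto_0: "(flat_exp n \<longlongrightarrow> 0) (at 0)"
proof (subst filterlim_at_split, intro conjI)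
  have "((\<lambda>x::real. x ^ n / exp x) \<longlongrightarrow> 0) at_top" by (rule tendsto_power_div_exp_0)
  from filterlim_compose[OF this filterlim_inverse_at_top_right]
  have "((\<lambda>t::real. inverse t ^ n / exp (inverse t)) \<longlongrightarrow> 0) (at_right 0)" .
  then show "(flat_exp n \<longlongrightarrow> 0) (at_right 0)"
    by (rule Lim_transform_eventually)
       (auto simp: flat_exp_def eventually_at_filter exp_minus field_simps intro!: always_eventually)
  show "(flat_exp n \<longlongrightarrow> 0) (at_left 0)"
    by (rule Lim_transform_eventually[OF tendsto_const])
       (auto simp: flat_exp_def eventually_at_filter intro!: always_eventually)
qed

lemma DERIV_flat_exp:
  "(flat_exp n has_real_derivative flat_exp (n + 2) t - n * flat_exp (n + 1) t) (at t)"
proof -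
  consider "t > 0" | "t < 0" | "t = 0" by linarith
  then show ?thesis
  proof cases
    case 1
    have "((\<lambda>t. exp (- 1 / t) / t ^ n) has_real_derivative
        (exp (- 1 / t) * (1 / (t * t)) * t ^ n - exp (- 1 / t) * (n * t ^ (n - 1))) / (t ^ n * t ^ n)) (at t)"
      using 1 by (auto intro!: derivative_eq_intros)
    also have "(exp (- 1 / t) * (1 / (t * t)) * t ^ n - exp (- 1 / t) * (n * t ^ (n - 1))) / (t ^ n * t ^ n)
        = flat_exp (n + 2) t - n * flat_exp (n + 1) t"
      using 1 by (cases n) (simp_all add: flat_exp_def field_simps power_add)
    finally show ?thesis
      by (rule DERIV_cong_ev[THEN iffD1, rotated 3])
         (use 1 eventually_nhds_in_open[of "{0<..}" t] in \<open>auto simp: flat_exp_def elim!: eventually_mono\<close>)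
  next
    case 2
    have "((\<lambda>t. 0) has_real_derivative flat_exp (n + 2) t - n * flat_exp (n + 1) t) (at t)"
      using 2 by (simp add: flat_exp_def)
    then show ?thesis
      by (rule DERIV_cong_ev[THEN iffD1, rotated 3])
         (use 2 eventually_nhds_in_open[of "{..<0}" t] in \<open>auto simp: flat_exp_def elim!: eventually_mono\<close>)
  next
    case 3
    \<comment> \<open>At the origin the difference quotient is again a member of the family, so
      differentiability there reduces to continuity at 0 of the next member.\<close>
    have "(flat_exp n (0 + h) - flat_exp n 0) / h = flat_exp (n + 1) h" if "h \<noteq> 0" for h
      using that by (simp add: flat_exp_def)
    then have "((\<lambda>h. (flat_exp n (0 + h) - flat_exp n 0) / h) \<longlongrightarrow> 0) (at 0)"
      by (intro Lim_transform_eventually[OF flat_exp_tendsto_0[of "n + 1"]])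
         (simp add: eventually_at_filter)
    then show ?thesis
      using 3 unfolding DERIV_def by (simp add: flat_exp_def)
  qed
qed

lemma smooth_flat_exp: "smooth (\<lambda>x. flat_exp n (b + c * x $ i))"
proof -
  have der: "((\<lambda>x. flat_exp n (b + c * x $ i)) has_derivative
      (\<lambda>h. (flat_exp (n + 2) (b + c * x $ i) - n * flat_exp (n + 1) (b + c * x $ i)) * (c * h $ i))) (at x)"
    for n and x :: vec3
  proof -
    have "((\<lambda>x::vec3. b + c * x $ i) has_derivative (\<lambda>h. c * h $ i)) (at x)"
      by (auto intro!: derivative_eq_intros bounded_linear_imp_has_derivative bounded_linear_vec_nth)
    from has_derivative_compose[OF this DERIV_flat_exp[unfolded has_field_derivative_def]]
    show ?thesis .
  qed
  have "Ck k (\<lambda>x. flat_exp n (b + c * x $ i))" for k n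
  proof (induction k arbitrary: n)
    case 0
    show ?case
      using has_derivative_continuous[OF der] by (auto simp: continuous_on_eq_continuous_at)
  next
    case (Suc k)
    have "partial j (\<lambda>x. flat_exp n (b + c * x $ i)) =
        (\<lambda>x. (c * axis j 1 $ i) * flat_exp (n + 2) (b + c * x $ i)
          + (- (n * c * axis j 1 $ i)) * flat_exp (n + 1) (b + c * x $ i))" for j
    proof
      fix x :: vec3
      show "partial j (\<lambda>x. flat_exp n (b + c * x $ i)) x =
        (c * axis j 1 $ i) * flat_exp (n + 2) (b + c * x $ i)
          + (- (n * c * axis j 1 $ i)) * flat_exp (n + 1) (b + c * x $ i)"
        unfolding partial_eqI[OF der] by (simp add: algebra_simps)
    qed
    moreover have "(\<lambda>x. flat_exp n (b + c * x $ i)) differentiable (at x)" for x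
      using der[of n x] unfolding differentiable_def by blast
    moreover have "Ck k (\<lambda>x. (c * axis j 1 $ i) * flat_exp (n + 2) (b + c * x $ i)
          + (- (n * c * axis j 1 $ i)) * flat_exp (n + 1) (b + c * x $ i))" for j
      by (intro Ck_add Ck_cmult Suc)
    ultimately show ?case by (simp only: Ck.simps simp_thms)
  qed
  then show ?thesis by (simp add: smooth_def)
qed

text \<open>Products of factors \<open>exp (-1/t)\<close> in the six rescaled distances to the
  faces: inside the box every exponent tends to 0 as the scale \<open>Suc m\<close> grows, outside
  the open box some factor vanishes identically. The support may touch the faces, hence the closed
  box in the bound and the open one in the limit.\<close>

lemma ex_box_bumps:
  assumes "cbox a b \<subseteq> (S :: vec3 set)"
  shows "\<exists>\<psi> :: nat \<Rightarrow> vec3 \<Rightarrow> real. (\<forall>m. \<psi> m \<in> test_functions S) \<and> (\<forall>m x. \<bar>\<psi> m x\<bar> \<le> indicator (cbox a b) x)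
    \<and> (\<forall>x. (\<lambda>m. \<psi> m x) \<longlonglongrightarrow> indicator (box a b) x)"
proof -
  define f where "f m i x = flat_exp 0 (- real (Suc m) * a $ i + real (Suc m) * x $ i)
      * flat_exp 0 (real (Suc m) * b $ i + (- real (Suc m)) * x $ i)" for m i and x :: vec3
  define \<psi> where "\<psi> m x = f m 1 x * f m 2 x * f m 3 x" for m and x :: vec3
  have smooth: "smooth (\<psi> m)" for m
    unfolding \<psi>_def f_def by (intro smooth_mult smooth_flat_exp)
  have flat_bound: "0 \<le> flat_exp 0 t" "flat_exp 0 t \<le> 1" for t
    by (auto simp: flat_exp_def)
  have f_bound: "0 \<le> f m i x" "f m i x \<le> 1" for m i x
    unfolding f_def using flat_bound by (auto intro: mult_le_one)
  have f_zero: "f m i x = 0" if "\<not> (a $ i < x $ i \<and> x $ i < b $ i)" for m i x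
  proof -
    have "- real (Suc m) * a $ i + real (Suc m) * x $ i = real (Suc m) * (x $ i - a $ i)"
      "real (Suc m) * b $ i + (- real (Suc m)) * x $ i = real (Suc m) * (b $ i - x $ i)"
      by (simp_all add: algebra_simps)
    moreover have "real (Suc m) * (x $ i - a $ i) \<le> 0 \<or> real (Suc m) * (b $ i - x $ i) \<le> 0"
      using that by (auto simp: mult_le_0_iff)
    ultimately show ?thesis unfolding f_def flat_exp_def by auto
  qed
  have lim1: "(\<lambda>m. flat_exp 0 (real (Suc m) * t)) \<longlonglongrightarrow> 1" if "t > 0" for t
  proof -
    have "(\<lambda>m. exp (- (inverse (real (Suc m)) * inverse t))) \<longlonglongrightarrow> exp (- (0 * inverse t))"
      by (intro tendsto_intros LIMSEQ_inverse_real_of_nat)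
    moreover have "flat_exp 0 (real (Suc m) * t) = exp (- (inverse (real (Suc m)) * inverse t))" for m
      using that by (simp add: flat_exp_def divide_inverse)
    ultimately show ?thesis by simp
  qed
  have f_lim: "(\<lambda>m. f m i x) \<longlonglongrightarrow> 1" if "a $ i < x $ i" "x $ i < b $ i" for i x
  proof -
    have "(\<lambda>m. flat_exp 0 (real (Suc m) * (x $ i - a $ i)) * flat_exp 0 (real (Suc m) * (b $ i - x $ i))) \<longlonglongrightarrow> 1 * 1"
      by (intro tendsto_mult lim1) (use that in auto)
    then show ?thesis by (simp add: f_def algebra_simps)
  qed
  have zero: "\<psi> m x = 0" if "x \<notin> box a b" for m x
    using that f_zero[where m = m and x = x] unfolding \<psi>_def mem_box_cart forall_3 by auto
  have "\<psi> m \<in> test_functions S" for m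
  proof (rule test_functionsI[OF smooth compact_cbox assms])
    show "\<psi> m x = 0" if "x \<notin> cbox a b" for x
      using zero that box_subset_cbox by blast
  qed
  moreover have "\<bar>\<psi> m x\<bar> \<le> indicator (cbox a b) x" for m x
  proof (cases "x \<in> box a b")
    case True
    then have "x \<in> cbox a b" using box_subset_cbox by blast
    moreover have "\<bar>\<psi> m x\<bar> \<le> 1"
      unfolding \<psi>_def using f_bound by (simp add: abs_mult mult_le_one)
    ultimately show ?thesis by simp
  qed (simp add: zero)
  moreover have "(\<lambda>m. \<psi> m x) \<longlonglongrightarrow> indicator (box a b) x" for x
  proof (cases "x \<in> box a b")
    case True
    then have "(\<lambda>m. f m 1 x * f m 2 x * f m 3 x) \<longlonglongrightarrow> 1 * 1 * 1"
      by (intro tendsto_mult f_lim) (auto simp: mem_box_cart)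
    then show ?thesis using True by (simp add: \<psi>_def)
  qed (simp add: zero)
  ultimately show ?thesis by blast
qed

lemma cbox_minus_box_null: "cbox a b - box a b \<in> null_sets (lborel :: vec3 measure)"
proof -
  have "emeasure lborel (cbox a b - box a b) = emeasure lborel (cbox a b) - emeasure lborel (box a b)"
    by (rule emeasure_Diff) (auto simp: box_subset_cbox emeasure_lborel_box_eq)
  also have "\<dots> = 0"
    by (simp add: emeasure_lborel_box_eq emeasure_lborel_cbox_eq)
  finally show ?thesis by (intro null_setsI) auto
qed

text \<open>Open boxes are closed under intersection and generate the Borel sets, and the sets over
  which \<open>g\<close> integrates to zero form a Dynkin system; the vanishing total integral
  provides the complements.\<close>

lemma AE_zero_if_box_integrals_zero:
  fixes g :: "vec3 \<Rightarrow> real"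
  assumes g: "integrable lborel g"
    and box: "\<And>c d. (LINT x:box c d|lborel. g x) = 0"
    and all: "(LINT x|lborel. g x) = 0"
  shows "AE x in lborel. g x = 0"
proof (rule density_unique_real[OF g integrable_zero])
  fix A :: "vec3 set" assume "A \<in> sets lborel"
  then have A: "A \<in> sigma_sets UNIV (range (\<lambda>(a, b). box a b))"
    by (simp add: borel_eq_box sets_lborel)
  have meas: "A \<in> sets lborel" if "A \<in> sigma_sets UNIV (range (\<lambda>(a, b). box a b))" for A :: "vec3 set"
    using that by (simp add: borel_eq_box sets_lborel)
  have set_int: "set_integrable lborel A g" if "A \<in> sets lborel" for A
    unfolding set_integrable_def by (rule integrable_mult_indicator[OF that g])
  have "(LINT x:A|lborel. g x) = 0"
  proof (rule sigma_sets_induct_disjoint[OF _ _ A, where P = "\<lambda>A. (LINT x:A|lborel. g x) = 0"])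
    show "Int_stable (range (\<lambda>(a, b). box a b :: vec3 set))"
      by (auto simp: Int_stable_def box_Int_box)
    show "range (\<lambda>(a, b). box a b :: vec3 set) \<subseteq> Pow UNIV" by simp
    show "(LINT x:A|lborel. g x) = 0" if "A \<in> range (\<lambda>(a, b). box a b)" for A
      using that box by auto
    show "(LINT x:{}|lborel. g x) = 0" by (simp add: set_lebesgue_integral_def)
    show "(LINT x:(UNIV - A)|lborel. g x) = 0"
      if A: "A \<in> sigma_sets UNIV (range (\<lambda>(a, b). box a b))" and 0: "(LINT x:A|lborel. g x) = 0" for A
    proof -
      have "(LINT x:(A \<union> (UNIV - A))|lborel. g x) = (LINT x:A|lborel. g x) + (LINT x:(UNIV - A)|lborel. g x)"
        using meas[OF A] by (intro set_integral_Un set_int) auto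
      then show ?thesis using 0 all by (simp add: set_lebesgue_integral_def)
    qed
    show "(LINT x:(\<Union>i. A i)|lborel. g x) = 0"
      if A: "disjoint_family A" "range A \<subseteq> sigma_sets UNIV (range (\<lambda>(a, b). box a b))"
        and 0: "\<And>i. (LINT x:A i|lborel. g x) = 0" for A :: "nat \<Rightarrow> vec3 set"
    proof -
      have mA: "A i \<in> sets lborel" for i using A(2) meas by blast
      have "(LINT x:(\<Union>i. A i)|lborel. g x) = (\<Sum>i. LINT x:A i|lborel. g x)"
        by (rule lebesgue_integral_countable_add)
           (use A(1) mA in \<open>auto simp: disjoint_family_on_def intro!: set_int\<close>)
      with 0 show ?thesis by simp
    qed
  qed
  then show "(LINT x:A|lborel. g x) = (LINT x:A|lborel. 0)"
    by (simp add: set_lebesgue_integral_def)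
qed

lemma L1_loc_cbox: "L1_loc S f \<Longrightarrow> cbox a b \<subseteq> S \<Longrightarrow> integrable lborel (\<lambda>x. indicator (cbox a b) x *\<^sub>R f x)"
  by (simp add: L1_loc_def set_integrable_def)

text \<open>Dominated convergence along box bumps annihilates the integral over every box whose
  closure lies in \<open>S\<close>. As \<open>S\<close> is a countable union of closed boxes, it
  suffices to apply the uniqueness of densities on each of them.\<close>

theorem fundamental_lemma:
  fixes f :: "vec3 \<Rightarrow> real"
  assumes S: "open S" and f: "L1_loc S f"
    and zero: "\<And>\<psi>. \<psi> \<in> test_functions S \<Longrightarrow> (LINT x:S|lborel. f x * \<psi> x) = 0"
  shows "AE x in lborel. x \<in> S \<longrightarrow> f x = 0"
proof -
  have box0: "(LINT x:box a b|lborel. f x) = 0" if ab: "cbox a b \<subseteq> S" for a b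
  proof -
    obtain \<psi> :: "nat \<Rightarrow> vec3 \<Rightarrow> real" where \<psi>: "\<And>m. \<psi> m \<in> test_functions S"
      "\<And>m x. \<bar>\<psi> m x\<bar> \<le> indicator (cbox a b) x" "\<And>x. (\<lambda>m. \<psi> m x) \<longlonglongrightarrow> indicator (box a b) x"
      using ex_box_bumps[OF ab] by blast
    let ?g = "\<lambda>x. indicator (cbox a b) x *\<^sub>R f x"
    have g: "integrable lborel ?g" by (rule L1_loc_cbox[OF f ab])
    have [measurable]: "?g \<in> borel_measurable borel" using g by auto
    have [measurable]: "\<psi> m \<in> borel_measurable borel" for m by (rule test_measurable[OF \<psi>(1)])
    have "(\<lambda>m. LINT x|lborel. \<psi> m x * ?g x) \<longlonglongrightarrow> (LINT x|lborel. indicator (box a b) x * ?g x)"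
    proof (rule integral_dominated_convergence[where w = "\<lambda>x. \<bar>?g x\<bar>"])
      show "AE x in lborel. norm (\<psi> m x * ?g x) \<le> \<bar>?g x\<bar>" for m
      proof (rule AE_I2)
        fix x :: vec3
        have "\<bar>\<psi> m x\<bar> \<le> 1"
          using \<psi>(2)[of m x] indicator_le_1[of "cbox a b" x] by (rule order_trans)
        then show "norm (\<psi> m x * ?g x) \<le> \<bar>?g x\<bar>"
          by (simp add: abs_mult mult_left_le_one_le)
      qed
      show "AE x in lborel. (\<lambda>m. \<psi> m x * ?g x) \<longlonglongrightarrow> indicator (box a b) x * ?g x"
        by (intro AE_I2 tendsto_mult \<psi>(3) tendsto_const)
    qed (use g in auto)
    moreover have "(LINT x|lborel. \<psi> m x * ?g x) = 0" for m
    proof -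
      have eq: "\<psi> m x * ?g x = indicator S x *\<^sub>R (f x * \<psi> m x)" for x
        using \<psi>(2)[of m x] ab by (auto simp: indicator_def)
      show ?thesis using zero[OF \<psi>(1)[of m]] unfolding set_lebesgue_integral_def eq .
    qed
    ultimately have "(LINT x|lborel. indicator (box a b) x * ?g x) = 0"
      by (simp add: LIMSEQ_const_iff)
    moreover have "indicator (box a b) x * ?g x = indicator (box a b) x *\<^sub>R f x" for x
      using box_subset_cbox[of a b] by (auto simp: indicator_def)
    ultimately show ?thesis by (simp only: set_lebesgue_integral_def)
  qed
  obtain \<D> where \<D>: "countable \<D>" "\<D> \<subseteq> Pow S" "\<And>X. X \<in> \<D> \<Longrightarrow> \<exists>a b. X = cbox a b" "\<Union>\<D> = S"
    using open_countable_Union_open_cbox[OF S] by metis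
  have "AE x in lborel. x \<in> X \<longrightarrow> f x = 0" if X: "X \<in> \<D>" for X
  proof -
    obtain a b where ab: "X = cbox a b" using \<D>(3)[OF X] by blast
    then have sub: "cbox a b \<subseteq> S" using \<D>(2) X by blast
    \<comment> \<open>Cutting \<open>f\<close> off to the open box makes it integrable on the whole
      space; the faces lost by this form a null set.\<close>
    let ?h = "\<lambda>x. indicator (box a b) x *\<^sub>R f x"
    have "integrable lborel (\<lambda>x. indicator (box a b) x *\<^sub>R (indicator (cbox a b) x *\<^sub>R f x))"
      by (intro integrable_mult_indicator L1_loc_cbox[OF f sub]) auto
    moreover have "indicator (box a b) x *\<^sub>R (indicator (cbox a b) x *\<^sub>R f x) = ?h x" for x
      using box_subset_cbox[of a b] by (auto simp: indicator_def)
    ultimately have h: "integrable lborel ?h" by (simp only:)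
    have "AE x in lborel. ?h x = 0"
    proof (rule AE_zero_if_box_integrals_zero[OF h])
      show "(LINT x|lborel. ?h x) = 0"
        using box0[OF sub] by (simp add: set_lebesgue_integral_def)
      fix c d
      obtain a' b' where int: "box a b \<inter> box c d = box a' b'"
        by (rule that) (rule box_Int_box)
      have "(LINT x:box c d|lborel. ?h x) = (LINT x:box a' b'|lborel. f x)"
        unfolding set_lebesgue_integral_def int[symmetric]
        by (rule Bochner_Integration.integral_cong) (auto simp: indicator_def)
      also have "\<dots> = 0"
      proof (cases "box a' b' = {}")
        case False
        then have "box a b \<noteq> {}" using int by auto
        \<comment> \<open>Inclusion of the open boxes is known, but \<open>box0\<close> asks for the
          closed one. Taking closures works only for nonempty boxes, whence the case
          distinction.\<close>
        have "closure (box a' b') \<subseteq> closure (box a b)"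
          using int by (intro closure_mono) blast
        then have "cbox a' b' \<subseteq> cbox a b"
          using False \<open>box a b \<noteq> {}\<close> by (simp add: closure_box)
        then show ?thesis using box0 sub by blast
      qed (simp add: set_lebesgue_integral_def)
      finally show "(LINT x:box c d|lborel. ?h x) = 0" .
    qed
    moreover have "AE x in lborel. x \<notin> cbox a b - box a b"
      by (rule AE_not_in[OF cbox_minus_box_null])
    ultimately show ?thesis
      by eventually_elim (auto simp: ab indicator_def split: if_splits)
  qed
  then have "AE x in lborel. \<forall>X\<in>\<D>. x \<in> X \<longrightarrow> f x = 0"
    using \<D>(1) by (subst AE_ball_countable) auto
  then show ?thesis by eventually_elim (use \<D>(4) in blast)
qed

text \<open>Local integrability gives measurability only on compact pieces; countably many boxes and
  the complement of \<open>S\<close> glue them together. It serves the representative selected by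
  \<open>weak_curl\<close>, of which nothing but local integrability is known at first.\<close>

lemma L1_loc_indicator_measurable:
  fixes w :: "vec3 \<Rightarrow> 'b::euclidean_space"
  assumes S: "open S" and w: "L1_loc S w"
  shows "(\<lambda>x. indicator S x *\<^sub>R w x) \<in> borel_measurable borel"
proof -
  obtain \<D> where \<D>: "countable \<D>" "\<D> \<subseteq> Pow S" "\<And>X. X \<in> \<D> \<Longrightarrow> \<exists>a b. X = cbox a b" "\<Union>\<D> = S"
    using open_countable_Union_open_cbox[OF S] by metis
  show ?thesis
  proof (rule measurable_piecewise_restrict[of "insert (- S) \<D>"])
    show "countable (insert (- S) \<D>)" using \<D>(1) by simp
    show "space borel \<subseteq> \<Union> (insert (- S) \<D>)" using \<D>(4) by auto
    fix X assume X: "X \<in> insert (- S) \<D>"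
    then have "X \<in> sets borel" using \<D>(3)[of X] S by (cases "X = - S") (auto simp: borel_open)
    then show "X \<inter> space borel \<in> sets borel" by simp
    show "(\<lambda>x. indicator S x *\<^sub>R w x) \<in> borel_measurable (restrict_space borel X)"
    proof (cases "X = - S")
      case True
      have "(\<lambda>x. indicator X x *\<^sub>R (indicator S x *\<^sub>R w x)) = (\<lambda>x. 0)"
        using True by (auto simp: indicator_def)
      then show ?thesis
        using \<open>X \<in> sets borel\<close> by (subst borel_measurable_restrict_space_iff) auto
    next
      case False
      then have "X \<in> \<D>" using X by simp
      then obtain a b where ab: "X = cbox a b" "cbox a b \<subseteq> S" using \<D>(2,3) by blast
      have "(\<lambda>x. indicator X x *\<^sub>R w x) \<in> borel_measurable borel"
        using L1_loc_cbox[OF w ab(2)] unfolding ab(1) by auto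
      moreover have "(\<lambda>x. indicator X x *\<^sub>R (indicator S x *\<^sub>R w x)) = (\<lambda>x. indicator X x *\<^sub>R w x)"
        using ab by (auto simp: indicator_def fun_eq_iff)
      ultimately show ?thesis
        using \<open>X \<in> sets borel\<close> by (subst borel_measurable_restrict_space_iff) auto
    qed
  qed
qed

lemma has_weak_curlD:
  "has_weak_curl S u w \<Longrightarrow> \<psi> \<in> test_fields S \<Longrightarrow>
    (LINT x:S|lborel. u x \<bullet> curl \<psi> x) = (LINT x:S|lborel. w x \<bullet> \<psi> x)"
  unfolding has_weak_curl_def by blast

text \<open>Test fields with a single nonzero component reduce the claim to the scalar fundamental
  lemma. Splitting the integral of the difference requires integrability over all of
  \<open>S\<close>, which comes from the compact support and boundedness of the test
  function.\<close>

lemma has_weak_curl_unique: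
  assumes S: "open S" and w: "has_weak_curl S u w" "has_weak_curl S u w'"
  shows "AE x in lborel. x \<in> S \<longrightarrow> w x = w' x"
proof -
  have L1: "L1_loc S w" "L1_loc S w'" using w by (auto simp: has_weak_curl_def)
  have comp: "AE x in lborel. x \<in> S \<longrightarrow> w x $ i - w' x $ i = 0" for i
  proof (rule fundamental_lemma[OF S])
    have "set_integrable lborel C (\<lambda>x. w x $ i - w' x $ i)" if "compact C" "C \<subseteq> S" for C
    proof -
      have "integrable lborel (\<lambda>x. (indicator C x *\<^sub>R w x - indicator C x *\<^sub>R w' x) $ i)"
        by (intro integrable_bounded_linear[OF bounded_linear_vec_nth] Bochner_Integration.integrable_diff)
           (use L1 that in \<open>auto simp: L1_loc_def set_integrable_def\<close>)
      then show ?thesis by (simp add: set_integrable_def right_diff_distrib)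
    qed
    then show "L1_loc S (\<lambda>x. w x $ i - w' x $ i)" by (simp add: L1_loc_def)
  next
    fix \<psi> assume \<psi>: "\<psi> \<in> test_functions S"
    have t: "(\<lambda>x. axis i (\<psi> x)) \<in> test_fields S"
    proof (unfold test_fields_iff, intro allI)
      show "(\<lambda>x. axis i (\<psi> x) $ j) \<in> test_functions S" for j
        using \<psi> test_zero by (cases "j = i") (simp_all add: axis_def)
    qed
    obtain K B where K: "compact K" "K \<subseteq> S" "\<And>x. x \<notin> K \<Longrightarrow> \<psi> x = 0" and B: "\<And>x. \<bar>\<psi> x\<bar> \<le> B"
      using test_functionsE[OF \<psi>] test_bounded[OF \<psi>] by metis
    have int: "set_integrable lborel S (\<lambda>x. v x \<bullet> axis i (\<psi> x))" if v: "L1_loc S v" for v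
    proof -
      have "integrable lborel (\<lambda>x. indicator K x *\<^sub>R v x)"
        using v K by (simp add: L1_loc_def set_integrable_def)
      note v_int = integrable_mult_left[OF integrable_norm[OF this], of B] and [measurable] = borel_measurable_integrable[OF this]
      have [measurable]: "(\<lambda>x. axis i (\<psi> x)) \<in> borel_measurable borel"
        by (rule L2_measurable[OF test_field_L2[OF t]])
      have "integrable lborel (\<lambda>x. (indicator K x *\<^sub>R v x) \<bullet> axis i (\<psi> x))"
      proof (rule Bochner_Integration.integrable_bound[OF v_int])
        show "(\<lambda>x. (indicator K x *\<^sub>R v x) \<bullet> axis i (\<psi> x)) \<in> borel_measurable lborel"
          by (rule borel_measurable_inner) simp_all
        show "AE x in lborel. norm ((indicator K x *\<^sub>R v x) \<bullet> axis i (\<psi> x)) \<le> norm (norm (indicator K x *\<^sub>R v x) * B)"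
        proof (rule AE_I2)
          fix x :: vec3
          have "\<bar>(indicator K x *\<^sub>R v x) \<bullet> axis i (\<psi> x)\<bar> \<le> norm (indicator K x *\<^sub>R v x) * norm (axis i (\<psi> x) :: vec3)"
            by (rule Cauchy_Schwarz_ineq2)
          also have "\<dots> \<le> norm (indicator K x *\<^sub>R v x) * B"
          proof (rule mult_left_mono)
            have "axis i (\<psi> x) = \<psi> x *\<^sub>R (axis i 1 :: vec3)" by (simp add: axis_def vec_eq_iff)
            then show "norm (axis i (\<psi> x) :: vec3) \<le> B" using B[of x] by simp
          qed simp
          finally show "norm ((indicator K x *\<^sub>R v x) \<bullet> axis i (\<psi> x)) \<le> norm (norm (indicator K x *\<^sub>R v x) * B)"
            by simp
        qed
      qed
      moreover have "(indicator K x *\<^sub>R v x) \<bullet> axis i (\<psi> x) = indicator S x *\<^sub>R (v x \<bullet> axis i (\<psi> x))" for x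
        using K(2,3) by (cases "x \<in> K") (auto simp: inner_axis indicator_def)
      ultimately show ?thesis by (simp only: set_integrable_def)
    qed
    have "(LINT x:S|lborel. w x \<bullet> axis i (\<psi> x)) = (LINT x:S|lborel. w' x \<bullet> axis i (\<psi> x))"
      using has_weak_curlD[OF w(1) t] has_weak_curlD[OF w(2) t] by simp
    then have "(LINT x:S|lborel. w x \<bullet> axis i (\<psi> x) - w' x \<bullet> axis i (\<psi> x)) = 0"
      using int L1 by simp
    then show "(LINT x:S|lborel. (w x $ i - w' x $ i) * \<psi> x) = 0"
      by (simp add: inner_axis left_diff_distrib)
  qed
  have "AE x in lborel. \<forall>i. x \<in> S \<longrightarrow> w x $ i - w' x $ i = 0"
    using comp[of 1] comp[of 2] comp[of 3] by eventually_elim (auto simp: forall_3)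
  then show ?thesis by eventually_elim (simp add: vec_eq_iff)
qed

lemma has_weak_curl_weak_curl: "has_weak_curl S u w \<Longrightarrow> has_weak_curl S u (weak_curl S u)"
  unfolding weak_curl_def by (rule someI[of "has_weak_curl S u"])

lemma weak_curl_AE:
  "open S \<Longrightarrow> has_weak_curl S u w \<Longrightarrow> AE x in lborel. x \<in> S \<longrightarrow> weak_curl S u x = w x"
  by (blast intro: has_weak_curl_unique has_weak_curl_weak_curl)

section \<open>Convergence in $L_2$ and the Beppo Levi space\<close>

lemma L2_on_add: "L2_on S f \<Longrightarrow> L2_on S g \<Longrightarrow> L2_on S (\<lambda>x. f x + g x)"
  unfolding L2_on_iff_indicator[of S] scaleR_add_right by (rule L2_add)

lemma L2_on_diff: "L2_on S f \<Longrightarrow> L2_on S g \<Longrightarrow> L2_on S (\<lambda>x. f x - g x)"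
  unfolding L2_on_iff_indicator[of S] scaleR_diff_right by (rule L2_diff)

lemma L2_on_subset:
  assumes f: "L2_on S f" and T: "T \<subseteq> S" "T \<in> sets borel"
  shows "L2_on T f"
  unfolding L2_on_iff_indicator[of T]
proof (rule L2_dominated)
  show "L2_on UNIV (\<lambda>x. indicator S x *\<^sub>R f x)" using f by (simp add: L2_on_iff_indicator[of S])
  have eq: "indicator T x *\<^sub>R f x = indicator T x *\<^sub>R (indicator S x *\<^sub>R f x)" for x
    using T(1) by (auto simp: indicator_def)
  show "(\<lambda>x. indicator T x *\<^sub>R f x) \<in> borel_measurable borel"
    unfolding eq
    by (rule borel_measurable_scaleR[OF borel_measurable_indicator[OF T(2)]
          L2_measurable[OF \<open>L2_on UNIV (\<lambda>x. indicator S x *\<^sub>R f x)\<close>]])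
  show "norm (indicator T x *\<^sub>R f x) \<le> 1 * norm (indicator S x *\<^sub>R f x)" for x
    using T(1) by (auto simp: indicator_def)
qed

lemma L2_imp_L2_on: "L2_on UNIV f \<Longrightarrow> T \<in> sets borel \<Longrightarrow> L2_on T f"
  by (rule L2_on_subset) auto

lemma L2_on_integrable: "L2_on S f \<Longrightarrow> set_integrable lborel S (\<lambda>x. (norm (f x))\<^sup>2)"
  by (simp add: L2_on_def)

lemma L2_on_const:
  fixes C :: "vec3 set"
  assumes "compact C" shows "L2_on C (\<lambda>x. c)"
  unfolding L2_on_def set_borel_measurable_def set_integrable_def
  using emeasure_compact_finite[OF assms] borel_compact[OF assms]
  by (auto intro!: integrable_real_indicator)

text \<open>On a set of finite measure \<open>t \<le> 1 + t^2\<close> supplies an integrable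
  majorant.\<close>

lemma L2_on_compact_imp_integrable:
  assumes f: "L2_on C f" and C: "compact C"
  shows "set_integrable lborel C f"
  unfolding set_integrable_def
proof (rule Bochner_Integration.integrable_bound)
  show "integrable lborel (\<lambda>x. indicator C x + (norm (indicator C x *\<^sub>R f x))\<^sup>2 :: real)"
    using f emeasure_compact_finite[OF C] borel_compact[OF C]
    by (intro Bochner_Integration.integrable_add L2_integrable_norm)
       (auto simp: L2_on_iff_indicator[of C] intro!: integrable_real_indicator)
  show "(\<lambda>x. indicator C x *\<^sub>R f x) \<in> borel_measurable lborel"
    using f by (simp add: L2_on_def set_borel_measurable_def)
  have "norm (indicator C x *\<^sub>R f x) \<le> indicator C x + (norm (indicator C x *\<^sub>R f x))\<^sup>2" for x
  proof (cases "x \<in> C")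
    case True
    have "norm (f x) \<le> 1 + (norm (f x))\<^sup>2"
      using zero_le_power2[of "norm (f x) - 1"] by (simp add: power2_diff, smt (verit) norm_ge_zero)
    with True show ?thesis by simp
  qed simp
  then show "AE x in lborel. norm (indicator C x *\<^sub>R f x)
      \<le> norm (indicator C x + (norm (indicator C x *\<^sub>R f x))\<^sup>2)"
    by (intro AE_I2) (simp add: order_trans[OF _ abs_ge_self])
qed

lemma L2_loc_imp_L1_loc: "L2_loc S f \<Longrightarrow> L1_loc S f"
  by (simp add: L2_loc_def L1_loc_def L2_on_compact_imp_integrable)

lemma L2_on_imp_L1_loc: "L2_on S f \<Longrightarrow> L1_loc S f"
  unfolding L1_loc_def using L2_on_subset L2_on_compact_imp_integrable borel_compact by blast

definition sq_int :: "vec3 set \<Rightarrow> (vec3 \<Rightarrow> 'b::euclidean_space) \<Rightarrow> real" where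
  "sq_int S f = (LINT x:S|lborel. (norm (f x))\<^sup>2)"

lemma sq_int_nonneg [simp]: "0 \<le> sq_int S f"
  by (simp add: sq_int_def set_lebesgue_integral_def)

text \<open>The pointwise bound is a premise, rather than \<open>h\<close> being a fixed sum, so
  that every rearrangement of a difference into two terms can be treated by the same rule.\<close>

lemma sq_int_triangle:
  assumes "L2_on S f" "L2_on S g" "L2_on S h"
    and le: "\<And>x. (norm (h x))\<^sup>2 \<le> 2 * (norm (f x))\<^sup>2 + 2 * (norm (g x))\<^sup>2"
  shows "sq_int S h \<le> 2 * sq_int S f + 2 * sq_int S g"
proof -
  have int: "integrable lborel (\<lambda>x. indicator S x * (norm (f x))\<^sup>2)"
    "integrable lborel (\<lambda>x. indicator S x * (norm (g x))\<^sup>2)"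
    "integrable lborel (\<lambda>x. indicator S x * (norm (h x))\<^sup>2)"
    using assms(1-3)[THEN L2_on_integrable] by (simp_all add: set_integrable_def)
  have "(LINT x|lborel. indicator S x * (norm (h x))\<^sup>2)
      \<le> (LINT x|lborel. 2 * (indicator S x * (norm (f x))\<^sup>2) + 2 * (indicator S x * (norm (g x))\<^sup>2))"
    using int le by (intro integral_mono) (auto simp: indicator_def)
  then show ?thesis using int by (simp add: sq_int_def set_lebesgue_integral_def)
qed

lemma norm_add_sq_le: "(norm (a + b))\<^sup>2 \<le> 2 * (norm a)\<^sup>2 + 2 * (norm (b::'b::real_inner))\<^sup>2"
proof -
  have "0 \<le> (norm (a - b))\<^sup>2" by simp
  then show ?thesis unfolding power2_norm_eq_inner
    by (simp add: inner_add_left inner_add_right inner_diff_left inner_diff_right inner_commute)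
qed

lemma norm_diff_sq_le: "(norm (a - b))\<^sup>2 \<le> 2 * (norm a)\<^sup>2 + 2 * (norm (b::'b::real_inner))\<^sup>2"
  using norm_add_sq_le[of a "- b"] by simp

lemma tendsto_L2_iff:
  "tendsto_L2 S f g F \<longleftrightarrow> (\<forall>\<^sub>F i in F. L2_on S (f i)) \<and> L2_on S g \<and>
    ((\<lambda>i. sq_int S (\<lambda>x. f i x - g x)) \<longlongrightarrow> 0) F"
proof -
  have "((\<lambda>i. sqrt (sq_int S (\<lambda>x. f i x - g x))) \<longlongrightarrow> 0) F \<longleftrightarrow> ((\<lambda>i. sq_int S (\<lambda>x. f i x - g x)) \<longlongrightarrow> 0) F"
  proof
    assume "((\<lambda>i. sqrt (sq_int S (\<lambda>x. f i x - g x))) \<longlongrightarrow> 0) F"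
    from tendsto_power[OF this, of 2] show "((\<lambda>i. sq_int S (\<lambda>x. f i x - g x)) \<longlongrightarrow> 0) F" by simp
  next
    assume "((\<lambda>i. sq_int S (\<lambda>x. f i x - g x)) \<longlongrightarrow> 0) F"
    from tendsto_real_sqrt[OF this] show "((\<lambda>i. sqrt (sq_int S (\<lambda>x. f i x - g x))) \<longlongrightarrow> 0) F" by simp
  qed
  then show ?thesis by (simp add: tendsto_L2_def sq_int_def)
qed

lemma sq_int_UNIV: "L2_on UNIV f \<Longrightarrow> sq_int UNIV f = (norm (toL2 f))\<^sup>2"
  by (simp add: sq_int_def set_lebesgue_integral_def toL2_norm_power2)

lemma L2_cauchy_schwarz:
  fixes f g :: "vec3 \<Rightarrow> vec3"
  assumes "L2_on UNIV f" "L2_on UNIV g"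
  shows "\<bar>LINT x|lborel. f x \<bullet> g x\<bar> \<le> sqrt (sq_int UNIV f) * sqrt (sq_int UNIV g)"
  using Cauchy_Schwarz_ineq2[of "toL2 f" "toL2 g"] assms by (simp add: toL2_inner sq_int_UNIV)

lemma tendsto_L2_inner:
  fixes f :: "nat \<Rightarrow> vec3 \<Rightarrow> vec3"
  assumes lim: "tendsto_L2 S f g sequentially" and \<psi>: "L2_on UNIV \<psi>"
  shows "(\<lambda>n. LINT x:S|lborel. f n x \<bullet> \<psi> x) \<longlonglongrightarrow> (LINT x:S|lborel. g x \<bullet> \<psi> x)"
proof -
  have g: "L2_on UNIV (\<lambda>x. indicator S x *\<^sub>R g x)"
    using lim by (simp add: tendsto_L2_iff L2_on_iff_indicator[of S])
  have "(\<lambda>n. sqrt (sq_int S (\<lambda>x. f n x - g x)) * sqrt (sq_int UNIV \<psi>)) \<longlonglongrightarrow> sqrt 0 * sqrt (sq_int UNIV \<psi>)"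
    using lim by (intro tendsto_mult tendsto_real_sqrt tendsto_const) (simp add: tendsto_L2_iff)
  then have "(\<lambda>n. sqrt (sq_int S (\<lambda>x. f n x - g x)) * sqrt (sq_int UNIV \<psi>)) \<longlonglongrightarrow> 0" by simp
  moreover have "\<forall>\<^sub>F n in sequentially. norm ((LINT x:S|lborel. f n x \<bullet> \<psi> x) - (LINT x:S|lborel. g x \<bullet> \<psi> x))
      \<le> sqrt (sq_int S (\<lambda>x. f n x - g x)) * sqrt (sq_int UNIV \<psi>)"
    using lim[unfolded tendsto_L2_iff, THEN conjunct1]
  proof eventually_elim
    fix n assume "L2_on S (f n)"
    then have f: "L2_on UNIV (\<lambda>x. indicator S x *\<^sub>R f n x)" by (simp add: L2_on_iff_indicator[of S])
    have d: "L2_on UNIV (\<lambda>x. indicator S x *\<^sub>R (f n x - g x))"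
      using L2_diff[OF f g] by (simp add: scaleR_diff_right)
    have "(LINT x:S|lborel. f n x \<bullet> \<psi> x) - (LINT x:S|lborel. g x \<bullet> \<psi> x)
        = (LINT x|lborel. (indicator S x *\<^sub>R f n x) \<bullet> \<psi> x) - (LINT x|lborel. (indicator S x *\<^sub>R g x) \<bullet> \<psi> x)"
      by (simp add: set_lebesgue_integral_def)
    also have "\<dots> = (LINT x|lborel. (indicator S x *\<^sub>R f n x) \<bullet> \<psi> x - (indicator S x *\<^sub>R g x) \<bullet> \<psi> x)"
      by (rule Bochner_Integration.integral_diff[symmetric]; rule L2_inner_integrable; fact)
    also have "\<dots> = (LINT x|lborel. (indicator S x *\<^sub>R (f n x - g x)) \<bullet> \<psi> x)"
      by (simp add: inner_diff_left right_diff_distrib)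
    finally have eq: "(LINT x:S|lborel. f n x \<bullet> \<psi> x) - (LINT x:S|lborel. g x \<bullet> \<psi> x)
        = (LINT x|lborel. (indicator S x *\<^sub>R (f n x - g x)) \<bullet> \<psi> x)" .
    have "sq_int UNIV (\<lambda>x. indicator S x *\<^sub>R (f n x - g x)) = sq_int S (\<lambda>x. f n x - g x)"
      unfolding sq_int_def set_lebesgue_integral_def
      by (rule Bochner_Integration.integral_cong) (auto simp: indicator_def)
    with L2_cauchy_schwarz[OF d \<psi>]
    show "norm ((LINT x:S|lborel. f n x \<bullet> \<psi> x) - (LINT x:S|lborel. g x \<bullet> \<psi> x))
      \<le> sqrt (sq_int S (\<lambda>x. f n x - g x)) * sqrt (sq_int UNIV \<psi>)"
      unfolding eq by simp
  qed
  ultimately have "(\<lambda>n. (LINT x:S|lborel. f n x \<bullet> \<psi> x) - (LINT x:S|lborel. g x \<bullet> \<psi> x)) \<longlonglongrightarrow> 0"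
    by (rule Lim_null_comparison[rotated])
  then show ?thesis by (simp add: LIM_zero_iff)
qed

lemma tendsto_L2_bound:
  assumes "\<And>n. L2_on S (f n)" "L2_on S g" "\<And>n. sq_int S (\<lambda>x. f n x - g x) \<le> b n" "b \<longlonglongrightarrow> 0"
  shows "tendsto_L2 S f g sequentially"
  unfolding tendsto_L2_iff
proof (intro conjI)
  show "(\<lambda>n. sq_int S (\<lambda>x. f n x - g x)) \<longlonglongrightarrow> 0"
    by (rule real_tendsto_sandwich[OF _ _ tendsto_const assms(4)]) (auto intro!: always_eventually assms(3))
qed (use assms in auto)

section \<open>The closed subspace of curls\<close>

lemma subspace_closure:
  fixes S :: "'a::real_normed_vector set"
  assumes "subspace S" shows "subspace (closure S)"
  unfolding subspace_def
proof (intro conjI ballI allI)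
  show "0 \<in> closure S" using assms closure_subset subspace_0 by blast
  show "x + y \<in> closure S" if xy: "x \<in> closure S" "y \<in> closure S" for x y
  proof -
    obtain a b where "\<forall>n. a n \<in> S" "a \<longlonglongrightarrow> x" "\<forall>n. b n \<in> S" "b \<longlonglongrightarrow> y"
      using xy unfolding closure_sequential by blast
    then show ?thesis unfolding closure_sequential
      by (intro exI[of _ "\<lambda>n. a n + b n"]) (auto intro: tendsto_add subspace_add[OF assms])
  qed
  show "c *\<^sub>R x \<in> closure S" if x: "x \<in> closure S" for c x
  proof -
    obtain a where "\<forall>n. a n \<in> S" "a \<longlonglongrightarrow> x"
      using x unfolding closure_sequential by blast
    then show ?thesis unfolding closure_sequential
      by (intro exI[of _ "\<lambda>n. c *\<^sub>R a n"]) (auto intro: tendsto_scaleR subspace_scale[OF assms])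
  qed
qed

definition curl_class :: "(vec3 \<Rightarrow> vec3) \<Rightarrow> L2field" where
  "curl_class f = toL2 (curl f)"

text \<open>The space \<open>W\<close> of the introduction. The curls form a linear subspace already
  before the closure is taken.\<close>

definition curl_space :: "L2field set" where
  "curl_space = closure (curl_class ` div_free_test_fields)"

lemma div_freeD: "f \<in> div_free_test_fields \<Longrightarrow> f \<in> test_fields UNIV"
  and div_free_divergence: "f \<in> div_free_test_fields \<Longrightarrow> divergence f x = 0"
  by (auto simp: div_free_test_fields_def)

lemma curl_L2: "f \<in> test_fields S \<Longrightarrow> L2_on UNIV (curl f)"
  by (rule test_field_L2[OF curl_test_field])

lemma curl_class_diff:
  assumes "f \<in> test_fields S" "g \<in> test_fields S"
  shows "curl_class (\<lambda>x. f x - g x) = curl_class f - curl_class g"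
proof -
  have "curl (\<lambda>x. f x - g x) = (\<lambda>x. curl f x - curl g x)"
    using curl_diff[OF test_smooth_field[OF assms(1)] test_smooth_field[OF assms(2)]] by blast
  then show ?thesis using assms by (simp add: curl_class_def toL2_diff curl_L2)
qed

lemma curl_class_scaleR:
  assumes "f \<in> test_fields S"
  shows "curl_class (\<lambda>x. c *\<^sub>R f x) = c *\<^sub>R curl_class f"
proof -
  have "curl (\<lambda>x. c *\<^sub>R f x) = (\<lambda>x. c *\<^sub>R curl f x)"
    using curl_scaleR[OF test_smooth_field[OF assms]] by blast
  then show ?thesis using assms by (simp add: curl_class_def toL2_scaleR curl_L2)
qed

lemma divergence_diff:
  "smooth_field f \<Longrightarrow> smooth_field g \<Longrightarrow> divergence (\<lambda>x. f x - g x) x = divergence f x - divergence g x"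
  by (simp add: divergence_3 partial_diff smooth_fieldD)

lemma divergence_scaleR:
  "smooth_field f \<Longrightarrow> divergence (\<lambda>x. c *\<^sub>R f x) x = c * divergence f x"
  by (simp add: divergence_3 partial_cmult smooth_fieldD distrib_left)

lemma div_free_diff:
  "f \<in> div_free_test_fields \<Longrightarrow> g \<in> div_free_test_fields \<Longrightarrow> (\<lambda>x. f x - g x) \<in> div_free_test_fields"
  by (auto simp: div_free_test_fields_def test_fields_diff divergence_diff test_smooth_field)

lemma div_free_scaleR: "f \<in> div_free_test_fields \<Longrightarrow> (\<lambda>x. c *\<^sub>R f x) \<in> div_free_test_fields"
  by (auto simp: div_free_test_fields_def test_fields_scaleR divergence_scaleR test_smooth_field)

lemma div_free_zero: "(\<lambda>x. 0) \<in> div_free_test_fields"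
  by (simp add: div_free_test_fields_def test_fields_iff test_zero divergence_3 partial_def)

lemma subspace_curls: "subspace (curl_class ` div_free_test_fields)"
  unfolding subspace_def
proof (intro conjI ballI allI)
  have sc: "c *\<^sub>R curl_class f = curl_class (\<lambda>x. c *\<^sub>R f x)" if "f \<in> div_free_test_fields" for c f
    using curl_class_scaleR[OF div_freeD[OF that]] by simp
  show *: "c *\<^sub>R v \<in> curl_class ` div_free_test_fields" if "v \<in> curl_class ` div_free_test_fields" for c v
    using that sc div_free_scaleR by auto
  show "0 \<in> curl_class ` div_free_test_fields"
    using *[of "curl_class (\<lambda>x. 0)" 0] div_free_zero by auto
  show "v + w \<in> curl_class ` div_free_test_fields"
    if v: "v \<in> curl_class ` div_free_test_fields" and w: "w \<in> curl_class ` div_free_test_fields" for v w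
  proof -
    obtain f where f: "f \<in> div_free_test_fields" "v = curl_class f" using v by blast
    obtain g where g: "g \<in> div_free_test_fields" "(-1) *\<^sub>R w = curl_class g" using *[OF w, of "-1"] by blast
    have "v + w = curl_class f - curl_class g" using f(2) g(2)[symmetric] by simp
    also have "\<dots> = curl_class (\<lambda>x. f x - g x)"
      by (rule curl_class_diff[symmetric]) (use f g div_freeD in blast)+
    finally show ?thesis using div_free_diff[OF f(1) g(1)] by (simp only: imageI)
  qed
qed

lemma subspace_curl_space: "subspace curl_space"
  unfolding curl_space_def by (rule subspace_closure[OF subspace_curls])

lemma closed_curl_space: "closed curl_space"
  by (simp add: curl_space_def)

lemma curl_seminorm_eq: "f \<in> test_fields S \<Longrightarrow> curl_seminorm f = norm (curl_class f)"
  by (simp add: curl_seminorm_def curl_class_def toL2_norm curl_L2)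

text \<open>Hardy's inequality summed over the components involves the full gradient; without
  divergence the curl-div identity replaces it by the curl. The weight
  \<open>1 / (1 + |x|^2)\<close> is what allows fields that are not square integrable to arise as
  limits.\<close>

lemma hardy_curl:
  assumes f: "f \<in> div_free_test_fields"
  shows "sq_int UNIV (\<lambda>x. (1 / sqrt (1 + (norm x)\<^sup>2)) *\<^sub>R f x) \<le> 4 * (norm (curl_class f))\<^sup>2"
    and "L2_on UNIV (\<lambda>x. (1 / sqrt (1 + (norm x)\<^sup>2)) *\<^sub>R f x)"
proof -
  note t = div_freeD[OF f]
  have w: "1 + (norm x)\<^sup>2 > 0" for x :: vec3
    by (smt (verit) zero_le_power2)
  have bound: "\<bar>1 / sqrt (1 + (norm x)\<^sup>2)\<bar> \<le> 1" for x :: vec3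
    using real_sqrt_ge_1_iff[of "1 + (norm x)\<^sup>2"] w[of x] by (simp add: divide_le_eq_1)
  have meas [measurable]: "(\<lambda>x::vec3. 1 / sqrt (1 + (norm x)\<^sup>2)) \<in> borel_measurable borel"
    by measurable
  show L2: "L2_on UNIV (\<lambda>x. (1 / sqrt (1 + (norm x)\<^sup>2)) *\<^sub>R f x)"
    by (rule L2_dominated[OF test_field_L2[OF t], of _ 1])
       (use L2_measurable[OF test_field_L2[OF t]] mult_right_mono[OF bound norm_ge_zero] in auto)
  have L2i: "L2_on UNIV (\<lambda>x. ((1 / sqrt (1 + (norm x)\<^sup>2)) *\<^sub>R f x) $ i)" for i
    using L2 unfolding L2_components by blast
  have sq: "((1 / sqrt (1 + (norm x)\<^sup>2)) * a)\<^sup>2 = a\<^sup>2 / (1 + (norm x)\<^sup>2)" for x :: vec3 and a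
    using w[of x] by (simp add: power_mult_distrib power_divide)
  have int: "integrable lborel (\<lambda>x. (f x $ i)\<^sup>2 / (1 + (norm x)\<^sup>2))" for i
    using L2_integrable_norm[OF L2i[of i]] by (simp add: sq[simplified] power_divide)
  have "sq_int UNIV (\<lambda>x. (1 / sqrt (1 + (norm x)\<^sup>2)) *\<^sub>R f x)
      = (LINT x|lborel. (\<Sum>i\<in>UNIV. (f x $ i)\<^sup>2 / (1 + (norm x)\<^sup>2)))"
    unfolding sq_int_def set_lebesgue_integral_def norm_power2_3 sum_3
    by (rule Bochner_Integration.integral_cong)
       (use w in \<open>simp_all add: power_divide norm_power2_3[symmetric] sum_3\<close>)
  also have "\<dots> = (\<Sum>i\<in>UNIV. LINT x|lborel. (f x $ i)\<^sup>2 / (1 + (norm x)\<^sup>2))"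
    using int by simp
  also have "\<dots> \<le> (\<Sum>i\<in>UNIV. 4 * (\<Sum>j\<in>UNIV. LINT x|lborel. (partial j (\<lambda>y. f y $ i) x)\<^sup>2))"
    by (intro sum_mono hardy_inequality[OF test_fields_component[OF t]])
  also have "\<dots> = 4 * ((LINT x|lborel. (norm (curl f x))\<^sup>2) + (LINT x|lborel. (divergence f x)\<^sup>2))"
    unfolding norm_curl_div_identity[OF t, symmetric] by (simp add: sum_distrib_left)
  also have "\<dots> = 4 * (norm (curl_class f))\<^sup>2"
    using div_free_divergence[OF f] by (simp add: curl_class_def toL2_norm_power2 curl_L2[OF t])
  finally show "sq_int UNIV (\<lambda>x. (1 / sqrt (1 + (norm x)\<^sup>2)) *\<^sub>R f x) \<le> 4 * (norm (curl_class f))\<^sup>2" .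
qed

lemma compact_weight_bound:
  fixes C :: "vec3 set"
  assumes "compact C"
  obtains B where "B > 0" "\<And>x. x \<in> C \<Longrightarrow> 1 + (norm x)\<^sup>2 \<le> B"
proof -
  obtain R where R: "\<And>x. x \<in> C \<Longrightarrow> norm x \<le> R"
    using compact_imp_bounded[OF assms] unfolding bounded_iff by blast
  have "1 + (norm x)\<^sup>2 \<le> 1 + R\<^sup>2" if "x \<in> C" for x using R[OF that] by (simp add: power_mono)
  moreover have "1 + R\<^sup>2 > 0" by (smt (verit) zero_le_power2)
  ultimately show ?thesis using that by blast
qed

text \<open>The Hardy weight is bounded below on compact sets, so weighted convergence on the whole
  space implies local convergence.\<close>

lemma sq_int_weighted:
  fixes g :: "vec3 \<Rightarrow> vec3"
  assumes B: "B > 0" "\<And>x. x \<in> C \<Longrightarrow> 1 + (norm x)\<^sup>2 \<le> B" and C: "C \<in> sets borel"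
    and L2: "L2_on UNIV (\<lambda>x. (1 / sqrt (1 + (norm x)\<^sup>2)) *\<^sub>R g x)"
  shows "sq_int C g \<le> B * sq_int UNIV (\<lambda>x. (1 / sqrt (1 + (norm x)\<^sup>2)) *\<^sub>R g x)"
    and "L2_on C g"
proof -
  let ?g = "\<lambda>x. (1 / sqrt (1 + (norm x)\<^sup>2)) *\<^sub>R g x"
  have w: "1 + (norm x)\<^sup>2 > 0" "sqrt (1 + (norm x)\<^sup>2) \<noteq> 0" for x :: vec3
    by (smt (verit) zero_le_power2 real_sqrt_eq_zero_cancel_iff)+
  have g_eq: "g x = sqrt (1 + (norm x)\<^sup>2) *\<^sub>R ?g x" for x
    using w(2)[of x] by simp
  have "(\<lambda>x. sqrt (1 + (norm x)\<^sup>2) *\<^sub>R ?g x) \<in> borel_measurable borel"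
    by (rule borel_measurable_scaleR[OF _ L2_measurable[OF L2]]) measurable
  moreover have "(\<lambda>x. sqrt (1 + (norm x)\<^sup>2) *\<^sub>R ?g x) = g"
    by (intro ext g_eq[symmetric])
  ultimately have meas: "g \<in> borel_measurable borel" by (simp only:)
  have sq: "(norm (g x))\<^sup>2 = (1 + (norm x)\<^sup>2) * (norm (?g x))\<^sup>2" for x
    using w(1)[of x] by (simp add: power_divide)
  have le: "(norm (indicator C x *\<^sub>R g x))\<^sup>2 \<le> (sqrt B * norm (?g x))\<^sup>2" for x
  proof (cases "x \<in> C")
    case True
    have "(norm (g x))\<^sup>2 \<le> B * (norm (?g x))\<^sup>2"
      unfolding sq by (rule mult_right_mono[OF B(2)[OF True]]) simp
    also have "\<dots> = (sqrt B * norm (?g x))\<^sup>2"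
      unfolding power_mult_distrib using B(1) by simp
    finally show ?thesis using True by simp
  qed (use B(1) in simp)
  have "norm (indicator C x *\<^sub>R g x) \<le> sqrt B * norm (?g x)" for x
    using le[of x] by (rule power2_le_imp_le) (use B(1) in simp)
  then show L2C: "L2_on C g"
    unfolding L2_on_iff_indicator[of C]
    by (rule L2_dominated[OF L2, rotated]) (use meas C in measurable)
  have "sq_int C g = (LINT x|lborel. (norm (indicator C x *\<^sub>R g x))\<^sup>2)"
    unfolding sq_int_def set_lebesgue_integral_def
    by (rule Bochner_Integration.integral_cong) (auto simp: indicator_def)
  also have "\<dots> \<le> (LINT x|lborel. B * (norm (?g x))\<^sup>2)"
  proof (rule integral_mono)
    show "integrable lborel (\<lambda>x. (norm (indicator C x *\<^sub>R g x))\<^sup>2)"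
      using L2C by (intro L2_integrable_norm) (simp add: L2_on_iff_indicator[of C])
    show "integrable lborel (\<lambda>x. B * (norm (?g x))\<^sup>2)"
      by (rule integrable_mult_right[OF L2_integrable_norm[OF L2]])
    show "(norm (indicator C x *\<^sub>R g x))\<^sup>2 \<le> B * (norm (?g x))\<^sup>2" for x
      using le[of x] B(1) unfolding power_mult_distrib by simp
  qed
  also have "\<dots> = B * sq_int UNIV ?g"
    by (simp add: sq_int_def set_lebesgue_integral_def)
  finally show "sq_int C g \<le> B * sq_int UNIV ?g" .
qed

section \<open>Beppo Levi fields and their weak curls\<close>

lemma L2field_rep: "\<exists>v. L2_on UNIV v \<and> w = toL2 v"
  by (rule L2field_cases[of w]) blast

lemma tendsto_L2_curl_class:
  assumes "\<And>n. f n \<in> test_fields UNIV" "L2_on UNIV v" "(\<lambda>n. curl_class (f n)) \<longlonglongrightarrow> toL2 v"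
  shows "tendsto_L2 UNIV (\<lambda>n. curl (f n)) v sequentially"
  using assms curl_L2[OF assms(1)] tendsto_toL2_iff[of "\<lambda>n. curl (f n)" v sequentially]
  by (simp add: tendsto_L2_def curl_class_def set_lebesgue_integral_def)

lemma set_integral_test_field:
  fixes u \<psi> :: "vec3 \<Rightarrow> vec3"
  assumes "\<And>x. x \<notin> C \<Longrightarrow> \<psi> x = 0"
  shows "(LINT x:C|lborel. u x \<bullet> \<psi> x) = (LINT x|lborel. u x \<bullet> \<psi> x)"
  by (rule set_integral_eq_integral) (simp add: assms)

lemma test_fields_support:
  assumes "\<psi> \<in> test_fields S"
  obtains C where "compact C" "C \<subseteq> S" "\<And>x. x \<notin> C \<Longrightarrow> \<psi> x = 0" "\<And>x. x \<notin> C \<Longrightarrow> curl \<psi> x = 0"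
proof -
  obtain C where C: "compact C" "C \<subseteq> S" "\<And>x. x \<notin> C \<Longrightarrow> \<psi> x = 0"
    using assms by (auto simp: test_fields_def compact_support_in_iff)
  have "curl \<psi> x = 0" if "x \<notin> C" for x
  proof -
    have "partial j (\<lambda>y. \<psi> y $ i) x = 0" for i j
      by (rule partial_zero_outside[OF compact_imp_closed[OF C(1)] _ that]) (simp add: C(3))
    then show ?thesis by (simp add: vec_eq_iff forall_3 curl_nth)
  qed
  with C show ?thesis by (rule that)
qed

lemma integral_const_curl:
  assumes "\<psi> \<in> test_fields S" shows "(LINT x|lborel. c \<bullet> curl \<psi> x) = 0"
  using integral_curl_by_parts[of "\<lambda>x. c" \<psi> S] assms
  by (simp add: smooth_field_def smooth_const curl_const)

text \<open>Test fields have compact support, so local convergence of the fields suffices on one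
  side. The constants drop out because the curl of a test field has mean zero.\<close>

lemma weak_curl_of_limit:
  assumes f: "\<And>n. f n \<in> test_fields UNIV" and u: "L1_loc UNIV u"
    and lim: "\<And>C. compact C \<Longrightarrow> tendsto_L2 C (\<lambda>n x. f n x + c n) u sequentially"
    and v: "L2_on UNIV v" "(\<lambda>n. curl_class (f n)) \<longlonglongrightarrow> toL2 v"
  shows "has_weak_curl UNIV u v"
  unfolding has_weak_curl_def
proof (intro conjI ballI u)
  show "L1_loc UNIV v" by (rule L2_on_imp_L1_loc[OF v(1)])
  fix \<psi> assume \<psi>: "\<psi> \<in> test_fields UNIV"
  obtain C where C: "compact C" "\<And>x. x \<notin> C \<Longrightarrow> \<psi> x = 0" "\<And>x. x \<notin> C \<Longrightarrow> curl \<psi> x = 0"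
    using test_fields_support[OF \<psi>] by metis
  have "(\<lambda>n. LINT x:C|lborel. (f n x + c n) \<bullet> curl \<psi> x) \<longlonglongrightarrow> (LINT x:C|lborel. u x \<bullet> curl \<psi> x)"
    by (rule tendsto_L2_inner[OF lim[OF C(1)] curl_L2[OF \<psi>]])
  moreover have "(LINT x:C|lborel. (f n x + c n) \<bullet> curl \<psi> x) = (LINT x:UNIV|lborel. curl (f n) x \<bullet> \<psi> x)" for n
  proof -
    have "integrable lborel (\<lambda>x. f n x \<bullet> curl \<psi> x)"
      by (rule L2_inner_integrable[OF test_field_L2[OF f] curl_L2[OF \<psi>]])
    moreover have "integrable lborel (\<lambda>x. c n \<bullet> curl \<psi> x)"
    proof -
      have "integrable lborel (\<lambda>x. curl \<psi> x $ i)" for i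
        by (rule test_integrable[OF test_fields_component[OF curl_test_field[OF \<psi>]]])
      then show ?thesis unfolding inner_3 by simp
    qed
    ultimately have "(LINT x|lborel. (f n x + c n) \<bullet> curl \<psi> x)
        = (LINT x|lborel. f n x \<bullet> curl \<psi> x) + (LINT x|lborel. c n \<bullet> curl \<psi> x)"
      by (simp add: inner_add_left)
    then show ?thesis
      using integral_curl_by_parts[OF test_smooth_field[OF f] \<psi>, of n] integral_const_curl[OF \<psi>, of "c n"]
        set_integral_test_field[OF C(3), where u = "\<lambda>x. f n x + c n"]
      by (simp add: set_lebesgue_integral_def)
  qed
  moreover have "(\<lambda>n. LINT x:UNIV|lborel. curl (f n) x \<bullet> \<psi> x) \<longlonglongrightarrow> (LINT x:UNIV|lborel. v x \<bullet> \<psi> x)"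
    by (rule tendsto_L2_inner[OF tendsto_L2_curl_class[OF f v] test_field_L2[OF \<psi>]])
  ultimately have "(LINT x:C|lborel. u x \<bullet> curl \<psi> x) = (LINT x:UNIV|lborel. v x \<bullet> \<psi> x)"
    using LIMSEQ_unique by simp
  then show "(LINT x:UNIV|lborel. u x \<bullet> curl \<psi> x) = (LINT x:UNIV|lborel. v x \<bullet> \<psi> x)"
    using set_integral_test_field[OF C(3), where u = u] by (simp add: set_lebesgue_integral_def)
qed

text \<open>The Cauchy condition makes the curls converge in \<open>L2field\<close>, and the limit
  is forced to be the weak curl. The approximating fields and constants are exported as well, since
  uniqueness up to constants depends on them.\<close>

lemma BLC_curl:
  assumes u: "u \<in> BLC"
  shows "\<exists>v f c. L2_on UNIV v \<and> has_weak_curl UNIV u v \<and> (\<forall>n::nat. f n \<in> div_free_test_fields) \<and>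
    (\<lambda>n. curl_class (f n)) \<longlonglongrightarrow> toL2 v \<and>
    (\<forall>C. compact C \<longrightarrow> tendsto_L2 C (\<lambda>n x. f n x + c n) u sequentially)"
proof -
  from u obtain f :: "nat \<Rightarrow> vec3 \<Rightarrow> vec3" and c where uf: "L2_loc UNIV u" "\<And>n. f n \<in> div_free_test_fields"
    "\<And>e. e > 0 \<Longrightarrow> \<exists>N. \<forall>m\<ge>N. \<forall>n\<ge>N. curl_seminorm (\<lambda>x. f m x - f n x) < e"
    "\<And>C. compact C \<Longrightarrow> tendsto_L2 C (\<lambda>n x. f n x + c n) u sequentially"
    unfolding BLC_def by blast
  have "Cauchy (\<lambda>n. curl_class (f n))"
    unfolding Cauchy_def dist_norm
  proof (intro allI impI)
    fix e :: real assume "e > 0"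
    then show "\<exists>N. \<forall>m\<ge>N. \<forall>n\<ge>N. norm (curl_class (f m) - curl_class (f n)) < e"
      using uf(3)[of e] curl_seminorm_eq[OF test_fields_diff[OF div_freeD[OF uf(2)] div_freeD[OF uf(2)]]]
      by (simp add: curl_class_diff[OF div_freeD[OF uf(2)] div_freeD[OF uf(2)]])
  qed
  then obtain w where "(\<lambda>n. curl_class (f n)) \<longlonglongrightarrow> w" by (auto simp: Cauchy_convergent_iff convergent_def)
  moreover obtain v where v: "L2_on UNIV v" "w = toL2 v" using L2field_rep by blast
  ultimately have "has_weak_curl UNIV u v"
    by (intro weak_curl_of_limit[OF div_freeD[OF uf(2)] L2_loc_imp_L1_loc[OF uf(1)] uf(4)]) auto
  with v uf \<open>(\<lambda>n. curl_class (f n)) \<longlonglongrightarrow> w\<close> show ?thesis by blast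
qed

lemma curl_space_limit:
  assumes "\<And>n::nat. f n \<in> div_free_test_fields" "(\<lambda>n. curl_class (f n)) \<longlonglongrightarrow> w"
  shows "w \<in> curl_space"
  unfolding curl_space_def closure_sequential
  by (rule exI[of _ "\<lambda>n. curl_class (f n)"]) (use assms in auto)

lemma BLC_curl_space:
  assumes "u \<in> BLC"
  shows "\<exists>v. L2_on UNIV v \<and> has_weak_curl UNIV u v \<and> toL2 v \<in> curl_space"
proof -
  obtain v and f :: "nat \<Rightarrow> vec3 \<Rightarrow> vec3" where "L2_on UNIV v" "has_weak_curl UNIV u v"
    "\<forall>n. f n \<in> div_free_test_fields" "(\<lambda>n. curl_class (f n)) \<longlonglongrightarrow> toL2 v"
    using BLC_curl[OF assms] by blast
  then show ?thesis using curl_space_limit[of f] by blast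
qed

text \<open>A limit of curls is only an element of \<open>L2field\<close>; a field having it as curl
  must be constructed. By Hardy's inequality the approximating fields are Cauchy in the weighted
  space, and their limit, freed from the weight, is that field.\<close>

lemma BLC_surj:
  assumes w: "w \<in> curl_space"
  shows "\<exists>u v. u \<in> BLC \<and> L2_on UNIV v \<and> toL2 v = w \<and> has_weak_curl UNIV u v"
proof -
  obtain v where v: "L2_on UNIV v" "w = toL2 v" using L2field_rep by blast
  obtain F where F: "\<forall>n. F n \<in> curl_class ` div_free_test_fields" "F \<longlonglongrightarrow> w"
    using w unfolding curl_space_def closure_sequential by blast
  from F(1) have "\<forall>n. \<exists>f. f \<in> div_free_test_fields \<and> F n = curl_class f" by blast
  from choice[OF this] obtain f where "\<forall>n. f n \<in> div_free_test_fields \<and> F n = curl_class (f n)"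
    by blast
  then have f: "\<And>n. f n \<in> div_free_test_fields" and "F = (\<lambda>n. curl_class (f n))" by auto
  with F(2) have lim: "(\<lambda>n. curl_class (f n)) \<longlonglongrightarrow> w" by simp
  note tf = div_freeD[OF f]
  have Cauchy: "Cauchy (\<lambda>n. curl_class (f n))" using lim by (rule LIMSEQ_imp_Cauchy)
  let ?r = "\<lambda>x::vec3. 1 / sqrt (1 + (norm x)\<^sup>2)"
  have diff: "(LINT x|lborel. (norm (?r x *\<^sub>R f m x - ?r x *\<^sub>R f n x))\<^sup>2) \<le> 4 * (norm (curl_class (f m) - curl_class (f n)))\<^sup>2" for m n
    using hardy_curl(1)[OF div_free_diff[OF f f], of m n]
    by (simp add: curl_class_diff[OF tf tf] sq_int_def set_lebesgue_integral_def scaleR_diff_right)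
  have "\<exists>g. L2_on UNIV g \<and> (\<lambda>n. LINT x|lborel. (norm (?r x *\<^sub>R f n x - g x))\<^sup>2) \<longlonglongrightarrow> 0"
  proof (rule L2_complete[OF hardy_curl(2)[OF f]])
    fix e :: real assume "e > 0"
    then obtain N where N: "\<And>m n. m \<ge> N \<Longrightarrow> n \<ge> N \<Longrightarrow> norm (curl_class (f m) - curl_class (f n)) < sqrt (e / 4)"
      using CauchyD[OF Cauchy, of "sqrt (e / 4)"] by auto
    have "(LINT x|lborel. (norm (?r x *\<^sub>R f m x - ?r x *\<^sub>R f n x))\<^sup>2) < e" if "m \<ge> N" "n \<ge> N" for m n
    proof -
      have "(norm (curl_class (f m) - curl_class (f n)))\<^sup>2 < (sqrt (e / 4))\<^sup>2"
        using N[OF that] by (intro power_strict_mono) auto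
      then show ?thesis using diff[of m n] \<open>e > 0\<close> by simp
    qed
    then show "\<exists>N. \<forall>m\<ge>N. \<forall>n\<ge>N. (LINT x|lborel. (norm (?r x *\<^sub>R f m x - ?r x *\<^sub>R f n x))\<^sup>2) < e" by blast
  qed
  then obtain g where g: "L2_on UNIV g" and g_lim: "(\<lambda>n. LINT x|lborel. (norm (?r x *\<^sub>R f n x - g x))\<^sup>2) \<longlonglongrightarrow> 0"
    by blast
  have w: "sqrt (1 + (norm x)\<^sup>2) \<noteq> 0" for x :: vec3
    by (smt (verit) zero_le_power2 real_sqrt_eq_zero_cancel_iff)
  \<comment> \<open>The weighted fields converge to \<open>g\<close>; division by the weight
    recovers the limit of the fields themselves.\<close>
  define u where "u x = sqrt (1 + (norm x)\<^sup>2) *\<^sub>R g x" for x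
  have gu: "?r x *\<^sub>R u x = g x" for x using w[of x] by (simp add: u_def)
  have L2u: "L2_on UNIV (\<lambda>x. ?r x *\<^sub>R u x)" unfolding gu by (rule g)
  \<comment> \<open>The additive constants in \<open>BLC\<close> can be taken to be zero here:
    Hardy's inequality already fixes the normalisation.\<close>
  have lim_C: "tendsto_L2 C (\<lambda>n x. f n x + 0) u sequentially" if C: "compact C" for C
  proof -
    obtain B where B: "B > 0" "\<And>x. x \<in> C \<Longrightarrow> 1 + (norm x)\<^sup>2 \<le> B"
      by (rule compact_weight_bound[OF C]) (rule that; blast)
    have L2d: "L2_on UNIV (\<lambda>x. ?r x *\<^sub>R (f n x + 0 - u x))" for n
      using L2_diff[OF hardy_curl(2)[OF f[of n]] g] by (simp only: scaleR_diff_right gu add_0_right)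
    have "(\<lambda>n. B * (LINT x|lborel. (norm (?r x *\<^sub>R f n x - g x))\<^sup>2)) \<longlonglongrightarrow> B * 0"
      by (intro tendsto_mult g_lim tendsto_const)
    then show ?thesis
    proof (intro tendsto_L2_bound)
      show "L2_on C (\<lambda>x. f n x + 0)" for n
        using L2_imp_L2_on[OF test_field_L2[OF tf] borel_compact[OF C]] by simp
      show "L2_on C u"
        by (rule sq_int_weighted(2)[OF B borel_compact[OF C] L2u])
      show "sq_int C (\<lambda>x. f n x + 0 - u x) \<le> B * (LINT x|lborel. (norm (?r x *\<^sub>R f n x - g x))\<^sup>2)" for n
        using sq_int_weighted(1)[OF B borel_compact[OF C] L2d[of n]]
        by (simp only: scaleR_diff_right gu add_0_right) (simp add: sq_int_def set_lebesgue_integral_def)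
    qed simp_all
  qed
  have "L2_loc UNIV u"
    unfolding L2_loc_def using lim_C by (auto simp: tendsto_L2_def)
  moreover have "\<exists>N. \<forall>m\<ge>N. \<forall>n\<ge>N. curl_seminorm (\<lambda>x. f m x - f n x) < e" if "e > 0" for e
    using Cauchy that unfolding Cauchy_def dist_norm
    by (simp add: curl_seminorm_eq[OF test_fields_diff[OF tf tf]] curl_class_diff[OF tf tf])
  ultimately have "u \<in> BLC"
    unfolding BLC_def using f lim_C by (intro CollectI conjI exI[of _ f] exI[of _ "\<lambda>_. 0"]) auto
  moreover have "has_weak_curl UNIV u v"
    using weak_curl_of_limit[OF tf L2_loc_imp_L1_loc[OF \<open>L2_loc UNIV u\<close>] lim_C v(1)] lim v(2) by simp
  ultimately show ?thesis using v by blast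
qed

section \<open>Uniqueness up to constants\<close>

lemma sq_int_const: "compact C \<Longrightarrow> sq_int C (\<lambda>x. a) = measure lborel C * (norm a)\<^sup>2"
  by (simp add: sq_int_def set_lebesgue_integral_def borel_compact)

lemma sq_int_zero_imp_AE:
  assumes h: "L2_on S h" and 0: "sq_int S h = 0"
  shows "AE x in lborel. x \<in> S \<longrightarrow> h x = 0"
proof -
  have "integrable lborel (\<lambda>x. indicator S x *\<^sub>R (norm (h x))\<^sup>2)"
    using L2_on_integrable[OF h] by (simp add: set_integrable_def)
  moreover have "(LINT x|lborel. indicator S x *\<^sub>R (norm (h x))\<^sup>2) = 0"
    using 0 by (simp add: sq_int_def set_lebesgue_integral_def)
  ultimately have "AE x in lborel. indicator S x *\<^sub>R (norm (h x))\<^sup>2 = 0"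
    by (subst (asm) integral_nonneg_eq_0_iff_AE) auto
  then show ?thesis by eventually_elim auto
qed

text \<open>On the unit ball, which has positive volume, the distance of two constant fields is
  proportional to the distance of their values. So the values converge, and their limit is the value
  of \<open>q\<close> on every ball.\<close>

lemma constant_of_local_limits:
  fixes q :: "vec3 \<Rightarrow> vec3" and e :: "nat \<Rightarrow> vec3"
  assumes q: "\<And>C. compact C \<Longrightarrow> L2_on C q"
    and lim: "\<And>C. compact C \<Longrightarrow> (\<lambda>n. sq_int C (\<lambda>x. e n - q x)) \<longlonglongrightarrow> 0"
  shows "\<exists>a. AE x in lborel. q x = a"
proof -
  let ?C = "cball (0::vec3) 1"
  define m where "m = measure lborel ?C"
  have m: "m > 0" unfolding m_def by (rule content_cball_pos) simp
  have L2e: "L2_on C (\<lambda>x. e n - q x)" if "compact C" for C n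
    by (intro L2_on_diff L2_on_const q that)
  have "Cauchy e"
  proof (rule metric_CauchyI)
    fix \<epsilon> :: real assume \<epsilon>: "\<epsilon> > 0"
    \<comment> \<open>The two terms of the triangle inequality carry a factor 2 each, so quarters of
      \<open>m * \<epsilon>^2\<close> add up to \<open>m * \<epsilon>^2\<close>.\<close>
    then obtain N where N: "\<And>n. n \<ge> N \<Longrightarrow> sq_int ?C (\<lambda>x. e n - q x) < m * \<epsilon>\<^sup>2 / 4"
      using order_tendstoD(2)[OF lim[of ?C], of "m * \<epsilon>\<^sup>2 / 4"] m
      by (auto simp: eventually_sequentially)
    have "dist (e k) (e n) < \<epsilon>" if "k \<ge> N" "n \<ge> N" for k n
    proof -
      have "m * (norm (e k - e n))\<^sup>2 = sq_int ?C (\<lambda>x. e k - e n)"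
        by (simp add: sq_int_const m_def)
      also have "\<dots> \<le> 2 * sq_int ?C (\<lambda>x. e k - q x) + 2 * sq_int ?C (\<lambda>x. e n - q x)"
      proof (rule sq_int_triangle)
        show "(norm (e k - e n))\<^sup>2 \<le> 2 * (norm (e k - q x))\<^sup>2 + 2 * (norm (e n - q x))\<^sup>2" for x
          using norm_diff_sq_le[of "e k - q x" "e n - q x"] by simp
      qed (auto intro: L2e L2_on_const)
      also have "\<dots> < m * \<epsilon>\<^sup>2" using N[OF that(1)] N[OF that(2)] by simp
      finally have "(norm (e k - e n))\<^sup>2 < \<epsilon>\<^sup>2" using m by simp
      then show ?thesis using \<epsilon> by (simp add: dist_norm power_less_imp_less_base)
    qed
    then show "\<exists>M. \<forall>k\<ge>M. \<forall>n\<ge>M. dist (e k) (e n) < \<epsilon>" by blast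
  qed
  then obtain a where a: "e \<longlonglongrightarrow> a" by (auto simp: Cauchy_convergent_iff convergent_def)
  have "sq_int C (\<lambda>x. a - q x) = 0" if C: "compact C" for C
  proof -
    have le: "sq_int C (\<lambda>x. a - q x) \<le> 2 * sq_int C (\<lambda>x. a - e n) + 2 * sq_int C (\<lambda>x. e n - q x)" for n
    proof (rule sq_int_triangle)
      show "(norm (a - q x))\<^sup>2 \<le> 2 * (norm (a - e n))\<^sup>2 + 2 * (norm (e n - q x))\<^sup>2" for x
        using norm_add_sq_le[of "a - e n" "e n - q x"] by simp
    qed (intro L2_on_diff L2_on_const q C)+
    have "(\<lambda>n. 2 * (measure lborel C * (norm (a - e n))\<^sup>2) + 2 * sq_int C (\<lambda>x. e n - q x))
        \<longlonglongrightarrow> 2 * (measure lborel C * (norm (a - a))\<^sup>2) + 2 * 0"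
      by (intro tendsto_intros a lim C)
    then have "sq_int C (\<lambda>x. a - q x) \<le> 0"
      using le by (intro LIMSEQ_le_const[of _ _ "sq_int C (\<lambda>x. a - q x)"]) (auto simp: sq_int_const[OF C])
    then show ?thesis using sq_int_nonneg[of C "\<lambda>x. a - q x"] by simp
  qed
  then have "AE x in lborel. x \<in> cball 0 (real n) \<longrightarrow> a - q x = 0" for n
    by (intro sq_int_zero_imp_AE L2_on_diff L2_on_const q) auto
  then have "AE x in lborel. \<forall>n. x \<in> cball 0 (real n) \<longrightarrow> a - q x = 0"
    unfolding AE_all_countable by blast
  then have "AE x in lborel. q x = a"
  proof eventually_elim
    fix x assume *: "\<forall>n. x \<in> cball 0 (real n) \<longrightarrow> a - q x = 0"
    obtain n where "norm x \<le> real n" using real_arch_simple by blast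
    then have "a - q x = 0" using *[rule_format, of n] by simp
    then show "q x = a" by simp
  qed
  then show ?thesis by blast
qed

lemma BLC_L2_on_compact: "u \<in> BLC \<Longrightarrow> compact C \<Longrightarrow> L2_on C u"
  by (auto simp: BLC_def L2_loc_def)

text \<open>If the curls of both approximating sequences have the same limit, then the difference of
  the sequences tends to zero locally by Hardy's inequality, without any constant. Hence the
  differences \<open>c n - d n\<close> alone must converge to \<open>u - u'\<close>.\<close>

lemma BLC_eq_curl_imp_const:
  assumes u: "u \<in> BLC" and u': "u' \<in> BLC"
    and v: "has_weak_curl UNIV u v" "has_weak_curl UNIV u' v"
  shows "\<exists>a. AE x in lborel. u x - u' x = a"
proof -
  obtain w c and f :: "nat \<Rightarrow> vec3 \<Rightarrow> vec3" where f: "L2_on UNIV w" "has_weak_curl UNIV u w" "\<forall>n. f n \<in> div_free_test_fields"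
    "(\<lambda>n. curl_class (f n)) \<longlonglongrightarrow> toL2 w" "\<forall>C. compact C \<longrightarrow> tendsto_L2 C (\<lambda>n x. f n x + c n) u sequentially"
    using BLC_curl[OF u] by blast
  obtain w' d and g :: "nat \<Rightarrow> vec3 \<Rightarrow> vec3" where g: "L2_on UNIV w'" "has_weak_curl UNIV u' w'" "\<forall>n. g n \<in> div_free_test_fields"
    "(\<lambda>n. curl_class (g n)) \<longlonglongrightarrow> toL2 w'" "\<forall>C. compact C \<longrightarrow> tendsto_L2 C (\<lambda>n x. g n x + d n) u' sequentially"
    using BLC_curl[OF u'] by blast
  have "AE x in lborel. w x = v x" "AE x in lborel. w' x = v x"
    using has_weak_curl_unique[OF open_UNIV f(2) v(1)] has_weak_curl_unique[OF open_UNIV g(2) v(2)] by auto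
  then have "AE x in lborel. w x = w' x" by eventually_elim simp
  then have ww: "toL2 w = toL2 w'" using f(1) g(1) by (simp add: toL2_eq_iff)
  have tf: "f n \<in> test_fields UNIV" and tg: "g n \<in> test_fields UNIV" for n using f(3) g(3) div_freeD by blast+
  have fg: "(\<lambda>x. f n x - g n x) \<in> div_free_test_fields" for n using f(3) g(3) div_free_diff by blast
  have "(\<lambda>n. curl_class (f n) - curl_class (g n)) \<longlonglongrightarrow> toL2 w - toL2 w'"
    by (intro tendsto_diff f(4) g(4))
  then have curl0: "(\<lambda>n. norm (curl_class (f n) - curl_class (g n))) \<longlonglongrightarrow> 0"
    using ww by (simp add: tendsto_norm_zero)
  show ?thesis
  proof (rule constant_of_local_limits[where e = "\<lambda>n. c n - d n" and q = "\<lambda>x. u x - u' x"])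
    fix C :: "vec3 set" assume C: "compact C"
    show "L2_on C (\<lambda>x. u x - u' x)"
      by (rule L2_on_diff[OF BLC_L2_on_compact[OF u C] BLC_L2_on_compact[OF u' C]])
    obtain B where B: "B > 0" "\<And>x. x \<in> C \<Longrightarrow> 1 + (norm x)\<^sup>2 \<le> B"
      by (rule compact_weight_bound[OF C]) (rule that; blast)
    have L2s: "L2_on C (\<lambda>x. f n x + c n - u x)" "L2_on C (\<lambda>x. g n x + d n - u' x)" "L2_on C (\<lambda>x. f n x - g n x)" for n
      by (intro L2_on_diff L2_on_add L2_on_const C BLC_L2_on_compact[OF u C] BLC_L2_on_compact[OF u' C]
          L2_imp_L2_on[OF test_field_L2[OF tf] borel_compact[OF C]]
          L2_imp_L2_on[OF test_field_L2[OF tg] borel_compact[OF C]])+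
    \<comment> \<open>The left-hand field is \<open>(f n + c n - u) - (g n + d n - u')\<close> minus
      \<open>f n - g n\<close>: two approximation errors and one term controlled by Hardy's
      inequality.\<close>
    have le: "sq_int C (\<lambda>x. (c n - d n) - (u x - u' x))
      \<le> 2 * (2 * sq_int C (\<lambda>x. f n x + c n - u x) + 2 * sq_int C (\<lambda>x. g n x + d n - u' x))
        + 2 * (B * (4 * (norm (curl_class (f n) - curl_class (g n)))\<^sup>2))" for n
    proof -
      have "sq_int C (\<lambda>x. (c n - d n) - (u x - u' x))
        \<le> 2 * sq_int C (\<lambda>x. (f n x + c n - u x) - (g n x + d n - u' x)) + 2 * sq_int C (\<lambda>x. f n x - g n x)"
      proof (rule sq_int_triangle)
        show "L2_on C (\<lambda>x. (f n x + c n - u x) - (g n x + d n - u' x))" by (intro L2_on_diff L2s)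
        show "L2_on C (\<lambda>x. (c n - d n) - (u x - u' x))"
          by (intro L2_on_diff L2_on_const C BLC_L2_on_compact[OF u C] BLC_L2_on_compact[OF u' C])
        show "(norm ((c n - d n) - (u x - u' x)))\<^sup>2
          \<le> 2 * (norm ((f n x + c n - u x) - (g n x + d n - u' x)))\<^sup>2 + 2 * (norm (f n x - g n x))\<^sup>2" for x
          using norm_diff_sq_le[of "(f n x + c n - u x) - (g n x + d n - u' x)" "f n x - g n x"]
          by (simp add: algebra_simps)
      qed (rule L2s)
      also have "sq_int C (\<lambda>x. (f n x + c n - u x) - (g n x + d n - u' x))
        \<le> 2 * sq_int C (\<lambda>x. f n x + c n - u x) + 2 * sq_int C (\<lambda>x. g n x + d n - u' x)"
        by (rule sq_int_triangle[OF L2s(1,2) L2_on_diff[OF L2s(1,2)] norm_diff_sq_le])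
      also have "sq_int C (\<lambda>x. f n x - g n x) \<le> B * sq_int UNIV (\<lambda>x. (1 / sqrt (1 + (norm x)\<^sup>2)) *\<^sub>R (f n x - g n x))"
        by (rule sq_int_weighted(1)[OF B borel_compact[OF C] hardy_curl(2)[OF fg]])
      also have "\<dots> \<le> B * (4 * (norm (curl_class (f n) - curl_class (g n)))\<^sup>2)"
        using hardy_curl(1)[OF fg] B(1) by (simp add: curl_class_diff[OF tf tg])
      finally show ?thesis by simp
    qed
    have "(\<lambda>n. 2 * (2 * sq_int C (\<lambda>x. f n x + c n - u x) + 2 * sq_int C (\<lambda>x. g n x + d n - u' x))
        + 2 * (B * (4 * (norm (curl_class (f n) - curl_class (g n)))\<^sup>2)))
        \<longlonglongrightarrow> 2 * (2 * 0 + 2 * 0) + 2 * (B * (4 * 0\<^sup>2))"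
      using f(5) g(5) C by (intro tendsto_intros curl0) (auto simp: tendsto_L2_iff)
    then have "(\<lambda>n. 2 * (2 * sq_int C (\<lambda>x. f n x + c n - u x) + 2 * sq_int C (\<lambda>x. g n x + d n - u' x))
        + 2 * (B * (4 * (norm (curl_class (f n) - curl_class (g n)))\<^sup>2))) \<longlonglongrightarrow> 0"
      by simp
    then show "(\<lambda>n. sq_int C (\<lambda>x. (c n - d n) - (u x - u' x))) \<longlonglongrightarrow> 0"
      by (rule real_tendsto_sandwich[OF _ _ tendsto_const, rotated 2])
         (intro always_eventually allI sq_int_nonneg le)+
  qed
qed

lemma has_weak_curl_cong:
  assumes w: "has_weak_curl UNIV u w" "L2_on UNIV w" "L2_on UNIV w'" "AE x in lborel. w x = w' x"
  shows "has_weak_curl UNIV u w'"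
  unfolding has_weak_curl_def
proof (intro conjI ballI)
  show "L1_loc UNIV u" using w(1) by (simp add: has_weak_curl_def)
  show "L1_loc UNIV w'" by (rule L2_on_imp_L1_loc[OF w(3)])
  fix \<psi> assume \<psi>: "\<psi> \<in> test_fields UNIV"
  have "(LINT x|lborel. w x \<bullet> \<psi> x) = (LINT x|lborel. w' x \<bullet> \<psi> x)"
    by (rule integral_inner_cong_AE[OF w(2,3) test_field_L2[OF \<psi>] test_field_L2[OF \<psi>] w(4)]) simp
  then show "(LINT x:UNIV|lborel. u x \<bullet> curl \<psi> x) = (LINT x:UNIV|lborel. w' x \<bullet> \<psi> x)"
    using has_weak_curlD[OF w(1) \<psi>] by (simp add: set_lebesgue_integral_def)
qed

text \<open>Passes from the limit of the curls to the representative that \<open>weak_curl\<close>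
  selects, whose measurability has to be recovered before it can count as square integrable.\<close>

lemma BLC_weak_curl:
  assumes "K \<in> BLC"
  shows "L2_on UNIV (weak_curl UNIV K)" "has_weak_curl UNIV K (weak_curl UNIV K)"
    "toL2 (weak_curl UNIV K) \<in> curl_space"
proof -
  obtain v where v: "L2_on UNIV v" "has_weak_curl UNIV K v" "toL2 v \<in> curl_space"
    using BLC_curl_space[OF assms] by blast
  show w: "has_weak_curl UNIV K (weak_curl UNIV K)" by (rule has_weak_curl_weak_curl[OF v(2)])
  have "L1_loc UNIV (weak_curl UNIV K)" using w by (simp add: has_weak_curl_def)
  from L1_loc_indicator_measurable[OF open_UNIV this]
  have meas: "weak_curl UNIV K \<in> borel_measurable borel" by simp
  have AE: "AE x in lborel. v x = weak_curl UNIV K x"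
    using has_weak_curl_unique[OF open_UNIV v(2) w] by simp
  show L2: "L2_on UNIV (weak_curl UNIV K)" by (rule L2_cong_AE[OF v(1) meas AE])
  show "toL2 (weak_curl UNIV K) \<in> curl_space"
    using v AE L2 toL2_eq_iff[OF v(1) L2] by simp
qed

lemma has_weak_curl_toL2_eq:
  assumes "K \<in> BLC" "has_weak_curl UNIV K v" "L2_on UNIV v"
  shows "toL2 (weak_curl UNIV K) = toL2 v"
  using has_weak_curl_unique[OF open_UNIV BLC_weak_curl(2)[OF assms(1)] assms(2)]
    toL2_eq_iff[OF BLC_weak_curl(1)[OF assms(1)] assms(3)] by simp

text \<open>A constant is invisible against \<open>curl \<psi>\<close>, so one field is a weak curl
  for the whole class; uniqueness does the rest.\<close>

lemma BLC_rel_weak_curl: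
  assumes "(K, K') \<in> BLC_rel"
  shows "toL2 (weak_curl UNIV K) = toL2 (weak_curl UNIV K')"
proof -
  obtain c where K: "K \<in> BLC" "K' \<in> BLC" "AE x in lborel. K x - K' x = c"
    using assms by (auto simp: BLC_rel_def)
  have "has_weak_curl UNIV K' (weak_curl UNIV K)"
    unfolding has_weak_curl_def
  proof (intro conjI ballI)
    show L1: "L1_loc UNIV K'" "L1_loc UNIV (weak_curl UNIV K)"
      using BLC_weak_curl(2)[OF K(1)] BLC_weak_curl(2)[OF K(2)] by (auto simp: has_weak_curl_def)
    fix \<psi> assume \<psi>: "\<psi> \<in> test_fields UNIV"
    have [measurable]: "K \<in> borel_measurable borel" "K' \<in> borel_measurable borel" "curl \<psi> \<in> borel_measurable borel"
      using BLC_weak_curl(2)[OF K(1)] L1 L1_loc_indicator_measurable[OF open_UNIV, of K] L1_loc_indicator_measurable[OF open_UNIV, of K']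
        L2_measurable[OF curl_L2[OF \<psi>]] by (auto simp: has_weak_curl_def)
    obtain C where C: "compact C" "\<And>x. x \<notin> C \<Longrightarrow> curl \<psi> x = 0"
      using test_fields_support[OF \<psi>] by metis
    \<comment> \<open>The fields are square integrable only locally; multiplication by
      \<open>curl \<psi>\<close> confines the integral to a compact set.\<close>
    have int: "integrable lborel (\<lambda>x. u x \<bullet> curl \<psi> x)" if u: "u \<in> BLC" for u
    proof -
      have "integrable lborel (\<lambda>x. (indicator C x *\<^sub>R u x) \<bullet> curl \<psi> x)"
        using BLC_L2_on_compact[OF u C(1)] by (intro L2_inner_integrable curl_L2[OF \<psi>]) (simp add: L2_on_iff_indicator[of C])
      also have "(\<lambda>x. (indicator C x *\<^sub>R u x) \<bullet> curl \<psi> x) = (\<lambda>x. u x \<bullet> curl \<psi> x)"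
        using C(2) by (force simp: indicator_def)
      finally show ?thesis .
    qed
    have "(LINT x|lborel. K x \<bullet> curl \<psi> x) - (LINT x|lborel. K' x \<bullet> curl \<psi> x)
        = (LINT x|lborel. K x \<bullet> curl \<psi> x - K' x \<bullet> curl \<psi> x)"
      using int K by simp
    also have "\<dots> = (LINT x|lborel. c \<bullet> curl \<psi> x)"
    proof (rule integral_cong_AE)
      show "AE x in lborel. K x \<bullet> curl \<psi> x - K' x \<bullet> curl \<psi> x = c \<bullet> curl \<psi> x"
        using K(3) by eventually_elim (simp add: inner_diff_left[symmetric])
    qed simp_all
    also have "\<dots> = 0" by (rule integral_const_curl[OF \<psi>])
    finally show "(LINT x:UNIV|lborel. K' x \<bullet> curl \<psi> x) = (LINT x:UNIV|lborel. weak_curl UNIV K x \<bullet> \<psi> x)"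
      using has_weak_curlD[OF BLC_weak_curl(2)[OF K(1)] \<psi>] by (simp add: set_lebesgue_integral_def)
  qed
  from has_weak_curl_toL2_eq[OF K(2) this BLC_weak_curl(1)[OF K(1)]] show ?thesis by simp
qed

section \<open>The corrector equation\<close>

locale two_phase_law =
  fixes a1 a2 :: "vec3 \<Rightarrow> vec3" and c1 c2 :: real
  assumes c1: "c1 > 0" and c2: "c2 > 0"
    and a1_mono: "\<And>x y. (a1 x - a1 y) \<bullet> (x - y) \<ge> c1 * (norm (x - y))\<^sup>2"
    and a2_mono: "\<And>x y. (a2 x - a2 y) \<bullet> (x - y) \<ge> c1 * (norm (x - y))\<^sup>2"
    and a1_lip: "\<And>x y. norm (a1 x - a1 y) \<le> c2 * norm (x - y)"
    and a2_lip: "\<And>x y. norm (a2 x - a2 y) \<le> c2 * norm (x - y)"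
begin

abbreviation A :: "vec3 set \<Rightarrow> vec3 \<Rightarrow> vec3 \<Rightarrow> vec3" where "A \<equiv> two_phase a1 a2"

lemma A_mono: "(A S x y - A S x y') \<bullet> (y - y') \<ge> c1 * (norm (y - y'))\<^sup>2"
  by (simp add: two_phase_def a1_mono a2_mono)

lemma A_lip: "norm (A S x y - A S x y') \<le> c2 * norm (y - y')"
  by (simp add: two_phase_def a1_lip a2_lip)

lemma continuous_law: "continuous_on UNIV a1" "continuous_on UNIV a2"
  using lipschitz_on_continuous_on[of c2 UNIV a1] lipschitz_on_continuous_on[of c2 UNIV a2] c2
  by (auto simp: lipschitz_on_def dist_norm a1_lip a2_lip)

lemma A_measurable:
  assumes [measurable]: "S \<in> sets borel" "w \<in> borel_measurable borel"
  shows "(\<lambda>x. A S x (w x)) \<in> borel_measurable borel"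
proof -
  have [measurable]: "a1 \<in> borel_measurable borel" "a2 \<in> borel_measurable borel"
    by (intro borel_measurable_continuous_onI continuous_law)+
  show ?thesis unfolding two_phase_def by measurable
qed

text \<open>Both sides of the corrector equation gathered into one field; it equals
  \<open>A \<omega> x (w x + U) - a2 U\<close>. It is written through
  \<open>A \<omega> x (w x + U) - A \<omega> x U\<close> because this difference is square
  integrable by the Lipschitz bound, and the remaining jump lives on the bounded set
  \<omega>.\<close>

definition flux :: "vec3 set \<Rightarrow> vec3 \<Rightarrow> (vec3 \<Rightarrow> vec3) \<Rightarrow> vec3 \<Rightarrow> vec3" where
  "flux \<omega> U w x = A \<omega> x (w x + U) - A \<omega> x U + indicator \<omega> x *\<^sub>R (a1 U - a2 U)"

lemma A_diff_L2:
  assumes S: "S \<in> sets borel" and w: "L2_on UNIV w"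
  shows "L2_on UNIV (\<lambda>x. A S x (w x + U) - A S x U)"
proof (rule L2_dominated[OF w])
  show "(\<lambda>x. A S x (w x + U) - A S x U) \<in> borel_measurable borel"
    using L2_measurable[OF w]
    by (intro borel_measurable_diff A_measurable S borel_measurable_add) auto
  show "norm (A S x (w x + U) - A S x U) \<le> c2 * norm (w x)" for x
    using A_lip[of S x "w x + U" U] by simp
qed

lemma L2_indicator_const:
  fixes \<omega> :: "vec3 set"
  assumes \<omega>: "open \<omega>" "bounded \<omega>"
  shows "L2_on UNIV (\<lambda>x. indicator \<omega> x *\<^sub>R (c::vec3))"
proof -
  have \<omega>_borel: "\<omega> \<in> sets borel" using \<omega>(1) by simp
  have "L2_on (closure \<omega>) (\<lambda>x. c)"
    using \<omega>(2) by (intro L2_on_const) (simp add: compact_closure)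
  then have "L2_on \<omega> (\<lambda>x. c)"
    by (rule L2_on_subset) (use \<omega>_borel closure_subset in auto)
  then show "L2_on UNIV (\<lambda>x. indicator \<omega> x *\<^sub>R (c::vec3))"
    by (simp add: L2_on_iff_indicator[of \<omega>])
qed

lemmas flux_parts_L2 = A_diff_L2[OF borel_open] L2_indicator_const

lemma flux_L2:
  assumes "open \<omega>" "bounded \<omega>" "L2_on UNIV w"
  shows "L2_on UNIV (flux \<omega> U w)"
  unfolding flux_def[abs_def] by (intro L2_add flux_parts_L2 assms)

lemma flux_inner:
  assumes \<omega>: "open \<omega>" "bounded \<omega>" and w: "L2_on UNIV w" and v: "L2_on UNIV v"
  shows "toL2 (flux \<omega> U w) \<bullet> toL2 v = (LINT x|lborel. (A \<omega> x (w x + U) - A \<omega> x U) \<bullet> v x)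
    + (LINT x:\<omega>|lborel. (a1 U - a2 U) \<bullet> v x)"
proof -
  have "toL2 (flux \<omega> U w) \<bullet> toL2 v
      = (LINT x|lborel. (A \<omega> x (w x + U) - A \<omega> x U) \<bullet> v x + (indicator \<omega> x *\<^sub>R (a1 U - a2 U)) \<bullet> v x)"
    using toL2_inner[OF flux_L2[OF \<omega> w] v] by (simp add: flux_def inner_add_left)
  also have "\<dots> = (LINT x|lborel. (A \<omega> x (w x + U) - A \<omega> x U) \<bullet> v x)
      + (LINT x|lborel. (indicator \<omega> x *\<^sub>R (a1 U - a2 U)) \<bullet> v x)"
    by (intro Bochner_Integration.integral_add L2_inner_integrable flux_parts_L2 \<omega> w v)
  finally show ?thesis by (simp add: set_lebesgue_integral_def)
qed

lemma flux_cong: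
  assumes \<omega>: "open \<omega>" "bounded \<omega>" and w: "L2_on UNIV w" "L2_on UNIV w'" and eq: "toL2 w = toL2 w'"
  shows "toL2 (flux \<omega> U w) = toL2 (flux \<omega> U w')"
proof -
  have "AE x in lborel. w x = w' x" using eq w by (simp add: toL2_eq_iff)
  then have "AE x in lborel. flux \<omega> U w x = flux \<omega> U w' x"
    by eventually_elim (simp add: flux_def)
  then show ?thesis using flux_L2[OF \<omega>] w by (simp add: toL2_eq_iff)
qed

lemma flux_mono:
  assumes \<omega>: "open \<omega>" "bounded \<omega>" and w: "L2_on UNIV w" and w': "L2_on UNIV w'"
  shows "(toL2 (flux \<omega> U w) - toL2 (flux \<omega> U w')) \<bullet> (toL2 w - toL2 w') \<ge> c1 * (norm (toL2 w - toL2 w'))\<^sup>2"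
proof -
  have eq: "flux \<omega> U w x - flux \<omega> U w' x = A \<omega> x (w x + U) - A \<omega> x (w' x + U)" for x
    by (simp add: flux_def)
  have "c1 * (norm (toL2 w - toL2 w'))\<^sup>2 = (LINT x|lborel. c1 * (norm (w x - w' x))\<^sup>2)"
    using w w' by (simp add: toL2_diff[symmetric] toL2_norm_power2 L2_diff)
  also have "\<dots> \<le> (LINT x|lborel. (flux \<omega> U w x - flux \<omega> U w' x) \<bullet> (w x - w' x))"
  proof (rule integral_mono)
    show "integrable lborel (\<lambda>x. c1 * (norm (w x - w' x))\<^sup>2)"
      by (intro integrable_mult_right L2_integrable_norm L2_diff w w')
    show "integrable lborel (\<lambda>x. (flux \<omega> U w x - flux \<omega> U w' x) \<bullet> (w x - w' x))"
      by (intro L2_inner_integrable L2_diff flux_L2 \<omega> w w')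
    show "c1 * (norm (w x - w' x))\<^sup>2 \<le> (flux \<omega> U w x - flux \<omega> U w' x) \<bullet> (w x - w' x)" for x
      unfolding eq using A_mono[of "w x + U" "w' x + U" \<omega> x] by simp
  qed
  also have "\<dots> = (toL2 (flux \<omega> U w) - toL2 (flux \<omega> U w')) \<bullet> (toL2 w - toL2 w')"
    using w w' flux_L2[OF \<omega>] by (simp add: toL2_diff[symmetric] toL2_inner L2_diff)
  finally show ?thesis .
qed

lemma flux_lip:
  assumes \<omega>: "open \<omega>" "bounded \<omega>" and w: "L2_on UNIV w" and w': "L2_on UNIV w'"
  shows "norm (toL2 (flux \<omega> U w) - toL2 (flux \<omega> U w')) \<le> c2 * norm (toL2 w - toL2 w')"
proof (rule power2_le_imp_le)
  have eq: "flux \<omega> U w x - flux \<omega> U w' x = A \<omega> x (w x + U) - A \<omega> x (w' x + U)" for x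
    by (simp add: flux_def)
  have "(norm (toL2 (flux \<omega> U w) - toL2 (flux \<omega> U w')))\<^sup>2
      = (LINT x|lborel. (norm (flux \<omega> U w x - flux \<omega> U w' x))\<^sup>2)"
    using w w' flux_L2[OF \<omega>] by (simp add: toL2_diff[symmetric] toL2_norm_power2 L2_diff)
  also have "\<dots> \<le> (LINT x|lborel. c2\<^sup>2 * (norm (w x - w' x))\<^sup>2)"
  proof (rule integral_mono)
    show "integrable lborel (\<lambda>x. (norm (flux \<omega> U w x - flux \<omega> U w' x))\<^sup>2)"
      by (intro L2_integrable_norm L2_diff flux_L2 \<omega> w w')
    show "integrable lborel (\<lambda>x. c2\<^sup>2 * (norm (w x - w' x))\<^sup>2)"
      by (intro integrable_mult_right L2_integrable_norm L2_diff w w')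
    show "(norm (flux \<omega> U w x - flux \<omega> U w' x))\<^sup>2 \<le> c2\<^sup>2 * (norm (w x - w' x))\<^sup>2" for x
      unfolding eq power_mult_distrib[symmetric]
      using A_lip[of \<omega> x "w x + U" "w' x + U"] by (intro power_mono) auto
  qed
  also have "\<dots> = (c2 * norm (toL2 w - toL2 w'))\<^sup>2"
    using w w' by (simp add: toL2_diff[symmetric] toL2_norm_power2 L2_diff power_mult_distrib)
  finally show "(norm (toL2 (flux \<omega> U w) - toL2 (flux \<omega> U w')))\<^sup>2 \<le> (c2 * norm (toL2 w - toL2 w'))\<^sup>2" .
qed (use c2 in simp)

text \<open>Surjectivity of the curl from \<open>BLC\<close> onto \<open>curl_space\<close>
  exchanges the two families of test objects. Afterwards the equation depends on \<open>K\<close>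
  only through the class of its weak curl.\<close>

lemma corrector_equation_iff:
  assumes \<omega>: "open \<omega>" "bounded \<omega>" and K: "K \<in> BLC"
  shows "corrector_equation a1 a2 \<omega> U K \<longleftrightarrow>
    (\<forall>v\<in>curl_space. toL2 (flux \<omega> U (weak_curl UNIV K)) \<bullet> v = 0)"
proof -
  have "corrector_equation a1 a2 \<omega> U K \<longleftrightarrow>
      (\<forall>\<psi>\<in>BLC. toL2 (flux \<omega> U (weak_curl UNIV K)) \<bullet> toL2 (weak_curl UNIV \<psi>) = 0)"
    unfolding corrector_equation_def
    by (intro ball_cong refl)
       (simp add: flux_inner[OF \<omega> BLC_weak_curl(1)[OF K] BLC_weak_curl(1)] eq_neg_iff_add_eq_0)
  also have "\<dots> \<longleftrightarrow> (\<forall>v\<in>curl_space. toL2 (flux \<omega> U (weak_curl UNIV K)) \<bullet> v = 0)"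
  proof (intro iffI ballI)
    fix v assume *: "\<forall>\<psi>\<in>BLC. toL2 (flux \<omega> U (weak_curl UNIV K)) \<bullet> toL2 (weak_curl UNIV \<psi>) = 0"
      and "v \<in> curl_space"
    then obtain \<psi> p where "\<psi> \<in> BLC" "L2_on UNIV p" "toL2 p = v" "has_weak_curl UNIV \<psi> p"
      using BLC_surj by blast
    then show "toL2 (flux \<omega> U (weak_curl UNIV K)) \<bullet> v = 0"
      using * has_weak_curl_toL2_eq by metis
  qed (use BLC_weak_curl(3) in blast)
  finally show ?thesis .
qed

lemma ex_corrector:
  assumes \<omega>: "open \<omega>" "bounded \<omega>"
  shows "\<exists>K\<in>BLC. corrector_equation a1 a2 \<omega> U K"
proof -
  \<comment> \<open>The nonlinearity acts on functions, not on classes; a choice of representatives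
    makes it a map on \<open>L2field\<close>.\<close>
  have "\<exists>r. \<forall>w. L2_on UNIV (r w) \<and> w = toL2 (r w)" by (rule choice) (use L2field_rep in blast)
  then obtain r where r: "\<And>w. L2_on UNIV (r w)" "\<And>w. toL2 (r w) = w" by metis
  have "\<exists>w\<in>curl_space. \<forall>v\<in>curl_space. toL2 (flux \<omega> U (r w)) \<bullet> v = 0"
  proof (rule strongly_monotone_equation[OF subspace_curl_space closed_curl_space c1])
    show "c1 * (norm (x - y))\<^sup>2 \<le> (toL2 (flux \<omega> U (r x)) - toL2 (flux \<omega> U (r y))) \<bullet> (x - y)" for x y
      using flux_mono[OF \<omega> r(1) r(1), where U = U, of x y] by (simp add: r(2))
    show "norm (toL2 (flux \<omega> U (r x)) - toL2 (flux \<omega> U (r y))) \<le> c2 * norm (x - y)" for x y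
      using flux_lip[OF \<omega> r(1) r(1), where U = U, of x y] by (simp add: r(2))
  qed
  then obtain w where w: "w \<in> curl_space" "\<forall>v\<in>curl_space. toL2 (flux \<omega> U (r w)) \<bullet> v = 0" by blast
  obtain K v where K: "K \<in> BLC" "L2_on UNIV v" "toL2 v = w" "has_weak_curl UNIV K v"
    using BLC_surj[OF w(1)] by blast
  have "toL2 (weak_curl UNIV K) = toL2 (r w)"
    using has_weak_curl_toL2_eq[OF K(1,4,2)] K(3) r(2) by simp
  then have "toL2 (flux \<omega> U (weak_curl UNIV K)) = toL2 (flux \<omega> U (r w))"
    by (rule flux_cong[OF \<omega> BLC_weak_curl(1)[OF K(1)] r(1)])
  then show ?thesis using corrector_equation_iff[OF \<omega> K(1), of U] w(2) K(1) by auto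
qed

text \<open>The difference of the two curls lies in \<open>curl_space\<close> and is therefore an
  admissible test object. Monotonicity makes it vanish, and equal curls mean equality up to a
  constant.\<close>

lemma corrector_unique:
  assumes \<omega>: "open \<omega>" "bounded \<omega>" and K: "K \<in> BLC" "K' \<in> BLC"
    and eqs: "corrector_equation a1 a2 \<omega> U K" "corrector_equation a1 a2 \<omega> U K'"
  shows "(K, K') \<in> BLC_rel"
proof -
  let ?w = "weak_curl UNIV K" and ?w' = "weak_curl UNIV K'"
  have d: "toL2 ?w - toL2 ?w' \<in> curl_space"
    by (rule subspace_diff[OF subspace_curl_space BLC_weak_curl(3)[OF K(1)] BLC_weak_curl(3)[OF K(2)]])
  have "(toL2 (flux \<omega> U ?w) - toL2 (flux \<omega> U ?w')) \<bullet> (toL2 ?w - toL2 ?w') = 0"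
    using eqs d corrector_equation_iff[OF \<omega>] K by (simp add: inner_diff_left)
  then have "c1 * (norm (toL2 ?w - toL2 ?w'))\<^sup>2 \<le> 0"
    using flux_mono[OF \<omega> BLC_weak_curl(1)[OF K(1)] BLC_weak_curl(1)[OF K(2)], of U] by simp
  then have "toL2 ?w = toL2 ?w'" using c1 by (simp add: mult_le_0_iff)
  then have "AE x in lborel. ?w x = ?w' x"
    using BLC_weak_curl(1) K by (simp add: toL2_eq_iff)
  then have "has_weak_curl UNIV K ?w'"
    using has_weak_curl_cong[OF BLC_weak_curl(2)[OF K(1)]] BLC_weak_curl(1) K by blast
  from BLC_eq_curl_imp_const[OF K this BLC_weak_curl(2)[OF K(2)]] show ?thesis
    using K by (auto simp: BLC_rel_def)
qed

text \<open>The equation is demanded of every member of a class, so existence includes its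
  independence of the representative.\<close>

lemma corrector_class:
  assumes \<omega>: "open \<omega>" "bounded \<omega>"
  shows "\<exists>!X. X \<in> BLC_dot \<and> (\<forall>K\<in>X. corrector_equation a1 a2 \<omega> U K)"
proof (rule ex_ex1I)
  obtain K where K: "K \<in> BLC" "corrector_equation a1 a2 \<omega> U K" using ex_corrector[OF \<omega>] by blast
  have "corrector_equation a1 a2 \<omega> U K'" if "(K, K') \<in> BLC_rel" for K'
  proof -
    have K': "K' \<in> BLC" using that by (simp add: BLC_rel_def)
    have "toL2 (flux \<omega> U (weak_curl UNIV K)) = toL2 (flux \<omega> U (weak_curl UNIV K'))"
      by (intro flux_cong \<omega> BLC_weak_curl K K' BLC_rel_weak_curl that)
    then show ?thesis using K(2) corrector_equation_iff[OF \<omega>] K(1) K' by simp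
  qed
  then show "\<exists>X. X \<in> BLC_dot \<and> (\<forall>K\<in>X. corrector_equation a1 a2 \<omega> U K)"
    unfolding BLC_dot_def using K(1) by (intro exI[of _ "BLC_rel `` {K}"]) (auto intro: quotientI)
next
  fix X Y
  assume X: "X \<in> BLC_dot \<and> (\<forall>K\<in>X. corrector_equation a1 a2 \<omega> U K)"
    and Y: "Y \<in> BLC_dot \<and> (\<forall>K\<in>Y. corrector_equation a1 a2 \<omega> U K)"
  obtain K where K: "K \<in> BLC" "X = BLC_rel `` {K}" using X by (auto simp: BLC_dot_def elim: quotientE)
  obtain K' where K': "K' \<in> BLC" "Y = BLC_rel `` {K'}" using Y by (auto simp: BLC_dot_def elim: quotientE)
  \<comment> \<open>Classes are nonempty, hence the statement about all members is not vacuous and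
    may be evaluated at these representatives.\<close>
  have "K \<in> X" "K' \<in> Y" using K K' equiv_class_self[OF equiv_BLC_rel] by auto
  then have "(K, K') \<in> BLC_rel"
    using corrector_unique[OF \<omega> K(1) K'(1)] X Y by blast
  then show "X = Y" using K K' equiv_class_eq[OF equiv_BLC_rel] by simp
qed

end

section \<open>A Liouville theorem and the density of divergence-free fields\<close>

definition conv :: "(vec3 \<Rightarrow> real) \<Rightarrow> (vec3 \<Rightarrow> real) \<Rightarrow> vec3 \<Rightarrow> real" where
  "conv f \<rho> x = (LINT y|lborel. f y * \<rho> (x - y))"

lemma test_reflect: "\<rho> \<in> test_functions UNIV \<Longrightarrow> (\<lambda>y. \<rho> (x - y)) \<in> test_functions UNIV"
  using test_affine[of \<rho> UNIV "-1" x UNIV] by simp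

lemma test_support_ball:
  assumes "\<rho> \<in> test_functions S"
  obtains r where "r > 0" "\<And>z. norm z > r \<Longrightarrow> \<rho> z = 0"
proof -
  obtain K where K: "compact K" "\<forall>x. x \<notin> K \<longrightarrow> \<rho> x = 0"
    using assms unfolding test_functions_def compact_support_in_iff by blast
  obtain b where "b > 0" "\<forall>x\<in>K. norm x \<le> b"
    using compact_imp_bounded[OF K(1)] unfolding bounded_pos by blast
  with K(2) show ?thesis by (intro that[of b]) (auto simp: not_le[symmetric])
qed

lemma L2_indicator_cball: "L2_on UNIV (indicator (cball (x::vec3) r) :: vec3 \<Rightarrow> real)"
proof -
  have "L2_on (cball x r) (\<lambda>_. 1::real)" by (rule L2_on_const[OF compact_cball])
  then show ?thesis by (simp add: L2_on_iff_indicator[of "cball x r"])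
qed

lemma L2_times_indicator_cball_integrable:
  fixes f :: "vec3 \<Rightarrow> real"
  assumes "L2_on UNIV f"
  shows "integrable lborel (\<lambda>y. \<bar>f y\<bar> * indicator (cball x r) y)"
proof -
  have "L2_on UNIV (\<lambda>y. \<bar>f y\<bar>)"
    by (rule L2_dominated[OF assms, of _ 1]) (use L2_measurable[OF assms] in auto)
  from L2_inner_integrable[OF this L2_indicator_cball[of x r]] show ?thesis by simp
qed

lemma conv_integrable:
  assumes "L2_on UNIV f" "\<rho> \<in> test_functions UNIV"
  shows "integrable lborel (\<lambda>y. f y * \<rho> (x - y))"
  using L2_inner_integrable[OF assms(1) test_L2[OF test_reflect[OF assms(2)]], of x] by simp

text \<open>Taylor's estimate from two uses of the mean value inequality, with a bound uniform in
  the base point \<open>z\<close>. As \<open>t\<close> may be negative, the interval is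
  symmetric.\<close>

lemma second_order_remainder:
  assumes \<rho>: "smooth \<rho>" and M: "\<And>z. \<bar>partial i (partial i \<rho>) z\<bar> \<le> M"
  shows "\<bar>\<rho> (z + t *\<^sub>R axis i 1) - \<rho> z - t * partial i \<rho> z\<bar> \<le> M * t\<^sup>2"
proof -
  let ?e = "axis i 1 :: vec3" and ?S = "{-\<bar>t\<bar>..\<bar>t\<bar>}"
  have first: "\<bar>partial i \<rho> (z + s *\<^sub>R ?e) - partial i \<rho> z\<bar> \<le> M * \<bar>t\<bar>" if "s \<in> ?S" for s
  proof -
    have "norm (partial i \<rho> (z + s *\<^sub>R ?e) - partial i \<rho> (z + 0 *\<^sub>R ?e)) \<le> M * norm (s - 0)"
      by (rule field_differentiable_bound[of UNIV "\<lambda>s. partial i \<rho> (z + s *\<^sub>R ?e)"])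
         (auto intro!: DERIV_line smooth_partial \<rho> M)
    also have "\<dots> \<le> M * \<bar>t\<bar>"
      using that order_trans[OF abs_ge_zero M] by (intro mult_left_mono) auto
    finally show ?thesis by simp
  qed
  have "norm ((\<rho> (z + t *\<^sub>R ?e) - t * partial i \<rho> z) - (\<rho> (z + 0 *\<^sub>R ?e) - 0 * partial i \<rho> z))
      \<le> (M * \<bar>t\<bar>) * norm (t - 0)"
  proof (rule field_differentiable_bound[of ?S "\<lambda>s. \<rho> (z + s *\<^sub>R ?e) - s * partial i \<rho> z"
        "\<lambda>s. partial i \<rho> (z + s *\<^sub>R ?e) - partial i \<rho> z"])
    show "((\<lambda>s. \<rho> (z + s *\<^sub>R ?e) - s * partial i \<rho> z) has_field_derivative
        partial i \<rho> (z + s *\<^sub>R ?e) - partial i \<rho> z) (at s within ?S)" for s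
      using DERIV_diff[OF DERIV_line[OF \<rho>, of z i s] DERIV_cmult_right[OF DERIV_ident, of "partial i \<rho> z"]]
      by (simp add: has_field_derivative_at_within)
  qed (use first in auto)
  then show ?thesis by (simp add: power2_eq_square algebra_simps)
qed

text \<open>Differentiation under the integral with an explicit remainder: the uniform Taylor bound,
  restricted to a fixed ball, makes the error in the difference quotient linear in
  \<open>t\<close>.\<close>

lemma DERIV_conv:
  assumes f: "L2_on UNIV f" and \<rho>: "\<rho> \<in> test_functions UNIV"
  shows "((\<lambda>s. conv f \<rho> (x + s *\<^sub>R axis i 1)) has_real_derivative
    conv f (partial i \<rho>) (x + s *\<^sub>R axis i 1)) (at s)"
proof -
  let ?e = "axis i 1 :: vec3"
  define X where "X = x + s *\<^sub>R ?e"
  obtain r where r: "r > 0" "\<And>z. norm z > r \<Longrightarrow> \<rho> z = 0"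
    by (rule test_support_ball[OF \<rho>]) (rule that; blast)
  obtain r' where r': "r' > 0" "\<And>z. norm z > r' \<Longrightarrow> partial i \<rho> z = 0"
    by (rule test_support_ball[OF test_partial[OF \<rho>]]) (rule that; blast)
  obtain M where M: "M \<ge> 0" "\<And>z. \<bar>partial i (partial i \<rho>) z\<bar> \<le> M"
    by (rule test_bounded[OF test_partial[OF test_partial[OF \<rho>]]]) (rule that; blast)
  \<comment> \<open>For \<open>\<bar>t\<bar> \<le> 1\<close> and \<open>norm (X - y) > R\<close> the
    function \<open>\<rho>\<close> vanishes at \<open>X - y\<close> and at the shifted point, and so
    does its derivative at \<open>X - y\<close>; the summand 1 absorbs the shift.\<close>
  define R where "R = r + r' + 1"
  define C where "C = (LINT y|lborel. \<bar>f y\<bar> * indicator (cball X R) y)"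
  have int0: "integrable lborel (\<lambda>y. \<bar>f y\<bar> * indicator (cball X R) y)"
    by (rule L2_times_indicator_cball_integrable[OF f])
  have bound: "norm ((conv f \<rho> (x + (s + t) *\<^sub>R ?e) - conv f \<rho> (x + s *\<^sub>R ?e)) / t - conv f (partial i \<rho>) X) \<le> \<bar>t\<bar> * (M * C)"
    if t: "t \<noteq> 0" "\<bar>t\<bar> \<le> 1" for t
  proof -
    let ?R = "\<lambda>y. \<rho> (X - y + t *\<^sub>R ?e) - \<rho> (X - y) - t * partial i \<rho> (X - y)"
    have eq: "x + (s + t) *\<^sub>R ?e - y = X - y + t *\<^sub>R ?e" for y
      by (simp add: X_def algebra_simps)
    have int: "integrable lborel (\<lambda>y. f y * \<rho> (X - y + t *\<^sub>R ?e))" "integrable lborel (\<lambda>y. f y * \<rho> (X - y))"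
      "integrable lborel (\<lambda>y. f y * partial i \<rho> (X - y))"
      using conv_integrable[OF f \<rho>, where x = "x + (s + t) *\<^sub>R ?e"] conv_integrable[OF f \<rho>, where x = X]
        conv_integrable[OF f test_partial[OF \<rho>], where x = X] by (simp_all only: eq)
    have intt: "integrable lborel (\<lambda>y. t * (f y * partial i \<rho> (X - y)))"
      by (rule integrable_mult_right[OF int(3)])
    have sum_eq: "f y * ?R y = f y * \<rho> (X - y + t *\<^sub>R ?e) - f y * \<rho> (X - y) - t * (f y * partial i \<rho> (X - y))" for y
      by (simp add: algebra_simps)
    have int_sum: "integrable lborel (\<lambda>y. f y * ?R y)"
      unfolding sum_eq using int intt by simp
    have conv_eq: "conv f \<rho> (x + (s + t) *\<^sub>R ?e) - conv f \<rho> (x + s *\<^sub>R ?e) - t * conv f (partial i \<rho>) X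
       = (LINT y|lborel. f y * ?R y)"
      unfolding sum_eq using int intt by (simp add: conv_def eq X_def[symmetric])
    have R_bound: "\<bar>f y * ?R y\<bar> \<le> (M * t\<^sup>2) * (\<bar>f y\<bar> * indicator (cball X R) y)" for y
    proof (cases "y \<in> cball X R")
      case True
      have "\<bar>f y * ?R y\<bar> \<le> \<bar>f y\<bar> * (M * t\<^sup>2)"
        unfolding abs_mult using second_order_remainder[OF test_smooth[OF \<rho>] M(2)] by (rule mult_left_mono) simp
      then show ?thesis using True by (simp add: mult.commute)
    next
      case False
      then have far: "norm (X - y) > R" by (simp add: dist_norm)
      have "norm (X - y) \<le> norm (X - y + t *\<^sub>R ?e) + norm (t *\<^sub>R ?e)"
        using norm_triangle_ineq4[of "X - y + t *\<^sub>R ?e" "t *\<^sub>R ?e"] by simp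
      then have "norm (X - y + t *\<^sub>R ?e) > r" using far t(2) r'(1) by (simp add: R_def)
      then have "?R y = 0" using r r' far by (simp add: R_def)
      then show ?thesis using False by simp
    qed
    have "\<bar>LINT y|lborel. f y * ?R y\<bar> \<le> (LINT y|lborel. \<bar>f y * ?R y\<bar>)"
      by (rule integral_abs_bound)
    also have "\<dots> \<le> (LINT y|lborel. (M * t\<^sup>2) * (\<bar>f y\<bar> * indicator (cball X R) y))"
      by (rule integral_mono[OF integrable_abs[OF int_sum] integrable_mult_right[OF int0] R_bound])
    also have "\<dots> = M * t\<^sup>2 * C" by (simp add: C_def)
    finally have "\<bar>conv f \<rho> (x + (s + t) *\<^sub>R ?e) - conv f \<rho> (x + s *\<^sub>R ?e) - t * conv f (partial i \<rho>) X\<bar> \<le> M * t\<^sup>2 * C"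
      by (simp only: conv_eq)
    then have "\<bar>conv f \<rho> (x + (s + t) *\<^sub>R ?e) - conv f \<rho> (x + s *\<^sub>R ?e) - t * conv f (partial i \<rho>) X\<bar> / \<bar>t\<bar> \<le> M * t\<^sup>2 * C / \<bar>t\<bar>"
      by (rule divide_right_mono) simp
    moreover have "\<bar>conv f \<rho> (x + (s + t) *\<^sub>R ?e) - conv f \<rho> (x + s *\<^sub>R ?e) - t * conv f (partial i \<rho>) X\<bar> / \<bar>t\<bar>
      = \<bar>(conv f \<rho> (x + (s + t) *\<^sub>R ?e) - conv f \<rho> (x + s *\<^sub>R ?e)) / t - conv f (partial i \<rho>) X\<bar>"
      using t(1) by (simp add: abs_divide[symmetric] diff_divide_distrib)
    moreover have "M * t\<^sup>2 * C / \<bar>t\<bar> = \<bar>t\<bar> * (M * C)"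
      using t(1) by (simp add: power2_eq_square abs_if)
    ultimately show ?thesis by simp
  qed
  have "((\<lambda>t. \<bar>t\<bar> * (M * C)) \<longlongrightarrow> \<bar>0\<bar> * (M * C)) (at 0)" by (intro tendsto_intros)
  then have lim0: "((\<lambda>t. \<bar>t\<bar> * (M * C)) \<longlongrightarrow> 0) (at 0)" by simp
  have "((\<lambda>t. (conv f \<rho> (x + (s + t) *\<^sub>R ?e) - conv f \<rho> (x + s *\<^sub>R ?e)) / t - conv f (partial i \<rho>) X) \<longlongrightarrow> 0) (at 0)"
  proof (rule Lim_null_comparison[OF _ lim0])
    show "\<forall>\<^sub>F t in at 0. norm ((conv f \<rho> (x + (s + t) *\<^sub>R ?e) - conv f \<rho> (x + s *\<^sub>R ?e)) / t - conv f (partial i \<rho>) X) \<le> \<bar>t\<bar> * (M * C)"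
      unfolding eventually_at by (rule exI[of _ 1]) (use bound in \<open>auto simp: dist_norm\<close>)
  qed
  then show ?thesis unfolding DERIV_def X_def by (simp add: LIM_zero_iff)
qed

lemma continuous_conv:
  assumes f: "L2_on UNIV f" and \<rho>: "\<rho> \<in> test_functions UNIV"
  shows "continuous_on UNIV (conv f \<rho>)"
  unfolding continuous_on_sequentially
proof (intro allI ballI impI, elim conjE)
  fix X :: "nat \<Rightarrow> vec3" and x assume X: "X \<longlonglongrightarrow> x"
  obtain r where r: "r > 0" "\<And>z. norm z > r \<Longrightarrow> \<rho> z = 0"
    by (rule test_support_ball[OF \<rho>]) (rule that; blast)
  obtain B where B: "B \<ge> 0" "\<And>z. \<bar>\<rho> z\<bar> \<le> B"
    by (rule test_bounded[OF \<rho>]) (rule that; blast)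
  obtain R where R: "\<And>n. norm (X n - x) \<le> R"
    using convergent_imp_Bseq[of "\<lambda>n. X n - x"] tendsto_diff[OF X tendsto_const, of x]
    unfolding Bseq_def convergent_def by blast
  have [measurable]: "f \<in> borel_measurable borel" "\<rho> \<in> borel_measurable borel"
    using L2_measurable[OF f] test_measurable[OF \<rho>] by auto
  have "(\<lambda>n. LINT y|lborel. f y * \<rho> (X n - y)) \<longlonglongrightarrow> (LINT y|lborel. f y * \<rho> (x - y))"
  \<comment> \<open>All points \<open>X n\<close> stay within \<open>R\<close> of \<open>x\<close>,
    so one ball of radius \<open>r + R\<close> contains the supports of all integrands. A square
    integrable function is integrable on it.\<close>
  proof (rule integral_dominated_convergence[where w = "\<lambda>y. B * (\<bar>f y\<bar> * indicator (cball x (r + R)) y)"])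
    show "integrable lborel (\<lambda>y. B * (\<bar>f y\<bar> * indicator (cball x (r + R)) y))"
      by (rule integrable_mult_right[OF L2_times_indicator_cball_integrable[OF f]])
    show "AE y in lborel. (\<lambda>n. f y * \<rho> (X n - y)) \<longlonglongrightarrow> f y * \<rho> (x - y)"
    proof (rule AE_I2)
      fix y :: vec3
      have "isCont \<rho> (x - y)"
        using test_continuous[OF \<rho>] by (simp add: continuous_on_eq_continuous_at)
      from isCont_tendsto_compose[OF this tendsto_diff[OF X tendsto_const]]
      show "(\<lambda>n. f y * \<rho> (X n - y)) \<longlonglongrightarrow> f y * \<rho> (x - y)" by (intro tendsto_mult tendsto_const)
    qed
    show "AE y in lborel. norm (f y * \<rho> (X n - y)) \<le> B * (\<bar>f y\<bar> * indicator (cball x (r + R)) y)" for n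
    proof (rule AE_I2)
      fix y :: vec3
      show "norm (f y * \<rho> (X n - y)) \<le> B * (\<bar>f y\<bar> * indicator (cball x (r + R)) y)"
      proof (cases "y \<in> cball x (r + R)")
        case True
        have "\<bar>f y\<bar> * \<bar>\<rho> (X n - y)\<bar> \<le> \<bar>f y\<bar> * B" by (rule mult_left_mono[OF B(2)]) simp
        then show ?thesis using True by (simp add: abs_mult mult.commute)
      next
        case False
        have "norm (x - y) \<le> norm (X n - y) + norm (X n - x)"
          using norm_triangle_ineq4[of "X n - y" "X n - x"] by simp
        then have "norm (X n - y) > r" using False R[of n] by (simp add: dist_norm)
        then show ?thesis using r(2) False by simp
      qed
    qed
  qed simp_all
  then show "(conv f \<rho> \<circ> X) \<longlonglongrightarrow> conv f \<rho> x" by (simp add: conv_def[abs_def] o_def)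
qed

lemma L2_cauchy_schwarz_real:
  fixes f g :: "vec3 \<Rightarrow> real"
  assumes f: "L2_on UNIV f" and g: "L2_on UNIV g"
  shows "(LINT x|lborel. f x * g x)\<^sup>2 \<le> (LINT x|lborel. (f x)\<^sup>2) * (LINT x|lborel. (g x)\<^sup>2)"
proof -
  let ?v = "\<lambda>h x. h x *\<^sub>R (axis 1 1 :: vec3)"
  have L2: "L2_on UNIV (?v h)" if "L2_on UNIV h" for h :: "vec3 \<Rightarrow> real"
    by (rule L2_dominated[OF that, of _ 1]) (use L2_measurable[OF that] in auto)
  have "(toL2 (?v f) \<bullet> toL2 (?v g))\<^sup>2 \<le> (toL2 (?v f) \<bullet> toL2 (?v f)) * (toL2 (?v g) \<bullet> toL2 (?v g))"
    by (rule Cauchy_Schwarz_ineq)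
  then show ?thesis
    by (simp add: toL2_inner L2 f g inner_axis_axis power2_eq_square mult.commute)
qed

text \<open>A case of Young's inequality. Cauchy-Schwarz over the support ball bounds the squared
  convolution by its volume times the integral of \<open>(f y)^2 * (\<rho> (x - y))^2\<close>, which
  Fubini's theorem shows to be integrable in \<open>x\<close>.\<close>

lemma conv_L2:
  assumes f: "L2_on UNIV f" and \<rho>: "\<rho> \<in> test_functions UNIV"
  shows "L2_on UNIV (conv f \<rho>)"
proof -
  obtain r where r: "r > 0" "\<And>z. norm z > r \<Longrightarrow> \<rho> z = 0"
    by (rule test_support_ball[OF \<rho>]) (rule that; blast)
  obtain B where B: "B \<ge> 0" "\<And>z. \<bar>\<rho> z\<bar> \<le> B"
    by (rule test_bounded[OF \<rho>]) (rule that; blast)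
  have [measurable]: "f \<in> borel_measurable borel" "\<rho> \<in> borel_measurable borel"
    using L2_measurable[OF f] test_measurable[OF \<rho>] by auto
  have meas: "conv f \<rho> \<in> borel_measurable borel"
    by (rule borel_measurable_continuous_onI[OF continuous_conv[OF f \<rho>]])
  define k where "k y x = (f y)\<^sup>2 * (\<rho> (x - y))\<^sup>2" for x y
  define V where "V = measure lborel (cball (0::vec3) r)"
  have L2p: "L2_on UNIV (\<lambda>y. f y * \<rho> (x - y))" for x
  proof (rule L2_dominated[OF f])
    show "norm (f y * \<rho> (x - y)) \<le> B * norm (f y)" for y
      using mult_right_mono[OF B(2) abs_ge_zero] by (simp add: abs_mult mult.commute)
  qed simp
  have le: "(conv f \<rho> x)\<^sup>2 \<le> V * (LINT y|lborel. k y x)" for x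
  proof -
    \<comment> \<open>The indicator is the second factor for Cauchy-Schwarz; its squared norm is the
      volume \<open>V\<close>, independent of \<open>x\<close>.\<close>
    have "f y * \<rho> (x - y) = (f y * \<rho> (x - y)) * indicator (cball x r) y" for y
      using r(2)[of "x - y"] by (auto simp: indicator_def dist_norm not_le)
    then have "conv f \<rho> x = (LINT y|lborel. (f y * \<rho> (x - y)) * indicator (cball x r) y)"
      unfolding conv_def by (rule Bochner_Integration.integral_cong[OF refl])
    then have "(conv f \<rho> x)\<^sup>2 \<le> (LINT y|lborel. (f y * \<rho> (x - y))\<^sup>2) * (LINT y|lborel. (indicator (cball x r) y)\<^sup>2)"
      using L2_cauchy_schwarz_real[OF L2p L2_indicator_cball] by simp
    also have "(LINT y|lborel. (indicator (cball x r) y)\<^sup>2) = V"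
    proof -
      have "(indicator (cball x r) y)\<^sup>2 = (indicator (cball x r) y :: real)" for y
        by (simp add: indicator_def)
      then show ?thesis using r(1) by (simp add: V_def content_cball)
    qed
    finally show ?thesis by (simp add: k_def power_mult_distrib mult.commute)
  qed
  have "integrable (lborel \<Otimes>\<^sub>M lborel) (case_prod k)"
  proof (rule lborel_pair.Fubini_integrable)
    show "case_prod k \<in> borel_measurable (lborel \<Otimes>\<^sub>M lborel)"
      unfolding k_def by measurable
    have \<rho>2: "integrable lborel (\<lambda>x. (\<rho> x)\<^sup>2)"
      using L2_integrable_norm[OF test_L2[OF \<rho>]] by simp
    have shift: "integrable lborel (\<lambda>x. (\<rho> (x - y))\<^sup>2)" "(LINT x|lborel. (\<rho> (x - y))\<^sup>2) = (LINT x|lborel. (\<rho> x)\<^sup>2)" for y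
      using integrable_affine[OF _ \<rho>2, of 1 "-y"] integral_affine[of 1 "\<lambda>x. (\<rho> x)\<^sup>2" "-y"] by auto
    show "integrable lborel (\<lambda>y. LINT x|lborel. norm (case_prod k (y, x)))"
      using L2_integrable_norm[OF f] shift by (simp add: k_def abs_mult)
    show "AE y in lborel. integrable lborel (\<lambda>x. case_prod k (y, x))"
      using shift(1) by (simp add: k_def)
  qed
  then have int_k: "integrable lborel (\<lambda>x. LINT y|lborel. k y x)"
    by (rule lborel_pair.integrable_snd)
  show ?thesis
    unfolding L2_on_UNIV_iff
  proof (intro conjI meas)
    show "integrable lborel (\<lambda>x. (norm (conv f \<rho> x))\<^sup>2)"
      by (rule Bochner_Integration.integrable_bound[OF integrable_mult_right[OF int_k, of V]])
         (use meas le in \<open>auto intro!: AE_I2 order_trans[OF le abs_ge_self]\<close>)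
  qed
qed

lemma continuous_AE_zero:
  fixes g :: "vec3 \<Rightarrow> real"
  assumes g: "continuous_on UNIV g" and 0: "AE x in lborel. g x = 0"
  shows "g x = 0"
proof (rule ccontr)
  assume "g x \<noteq> 0"
  have "open {x. g x \<noteq> 0}"
    using open_Collect_neq[OF g continuous_on_const, of 0] .
  then obtain e where e: "e > 0" "ball x e \<subseteq> {x. g x \<noteq> 0}"
    using \<open>g x \<noteq> 0\<close> by (metis mem_Collect_eq openE)
  have "AE x' in lborel. x' \<notin> ball x e" using 0 by eventually_elim (use e(2) in auto)
  then have "ball x e \<in> null_sets lborel"
    by (subst AE_iff_null_sets) auto
  then have "measure lborel (ball x e) = 0"
    by (simp add: null_sets_def measure_def)
  then show False using content_ball_pos[OF e(1), of x] by simp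
qed

text \<open>The mollification \<open>F\<close> of \<open>f\<close> is differentiable, square
  integrable and harmonic. Energy integration over the whole space kills its gradient, a constant in
  \<open>L_2\<close> is zero, and since the mollifier is arbitrary, \<open>f\<close> itself
  vanishes.\<close>

theorem weakly_harmonic_L2_imp_zero:
  fixes f :: "vec3 \<Rightarrow> real"
  assumes f: "L2_on UNIV f"
    and harm: "\<And>q. q \<in> test_functions UNIV \<Longrightarrow> (LINT x|lborel. f x * laplacian q x) = 0"
  shows "AE x in lborel. f x = 0"
proof -
  have conv0: "conv f \<rho> x = 0" if \<rho>: "\<rho> \<in> test_functions UNIV" for \<rho> x
  proof -
    let ?F = "\<lambda>i. conv f (partial i \<rho>)" and ?FF = "\<lambda>i. conv f (partial i (partial i \<rho>))"
    have t1: "partial i \<rho> \<in> test_functions UNIV" and t2: "partial i (partial i \<rho>) \<in> test_functions UNIV" for i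
      using test_partial \<rho> by blast+
    have int1: "integrable lborel (\<lambda>x. (?F i x)\<^sup>2)" for i
      using L2_integrable_norm[OF conv_L2[OF f t1[of i]]] by simp
    have int2: "integrable lborel (\<lambda>x. conv f \<rho> x * ?FF i x)" for i
      using L2_inner_integrable[OF conv_L2[OF f \<rho>] conv_L2[OF f t2[of i]]] by simp
    \<comment> \<open>The integrand is the i-th derivative of \<open>F\<close> times its i-th
      partial derivative. Products of two square integrable functions are integrable, which replaces
      compact support.\<close>
    have div0: "(LINT x|lborel. (?F i x)\<^sup>2 + conv f \<rho> x * ?FF i x) = 0" for i
    proof (rule integral_directional_derivative_eq_0[where f = "\<lambda>x. conv f \<rho> x * ?F i x" and e = "axis i 1"])
      show "((\<lambda>s. conv f \<rho> (x + s *\<^sub>R axis i 1) * ?F i (x + s *\<^sub>R axis i 1)) has_vector_derivative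
        (?F i (x + s *\<^sub>R axis i 1))\<^sup>2 + conv f \<rho> (x + s *\<^sub>R axis i 1) * ?FF i (x + s *\<^sub>R axis i 1)) (at s)" for x s
        using DERIV_mult[OF DERIV_conv[OF f \<rho>, where x = x and i = i and s = s]
            DERIV_conv[OF f t1, where x = x and i = i and s = s]]
        by (simp add: has_real_derivative_iff_has_vector_derivative power2_eq_square algebra_simps)
      show "continuous_on UNIV (\<lambda>x. (?F i x)\<^sup>2 + conv f \<rho> x * ?FF i x)"
        by (intro continuous_intros continuous_conv f \<rho> t1 t2)
      show "integrable lborel (\<lambda>x. conv f \<rho> x * ?F i x)"
        using L2_inner_integrable[OF conv_L2[OF f \<rho>] conv_L2[OF f t1[of i]]] by simp
      show "integrable lborel (\<lambda>x. (?F i x)\<^sup>2 + conv f \<rho> x * ?FF i x)"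
        by (intro Bochner_Integration.integrable_add int1 int2)
    qed
    \<comment> \<open>The Laplacian falls on the mollifier. As a function of \<open>y\<close> the
      mollifier is reflected, and the two sign changes of a second derivative cancel.\<close>
    have lap0: "(\<Sum>i\<in>UNIV. ?FF i x) = 0" for x
    proof -
      let ?q = "\<lambda>y. \<rho> (x + (-1) *\<^sub>R y)"
      have p1: "partial i ?q y = - partial i \<rho> (x + (-1) *\<^sub>R y)" for i y
        using partial_affine[OF smooth_differentiable[OF test_smooth[OF \<rho>]],
            where a = x and c = "-1" and x = y] by simp
      have p2: "partial i (partial i ?q) y = partial i (partial i \<rho>) (x - y)" for i y
      proof -
        have "partial i (partial i ?q) y = partial i (\<lambda>y. - partial i \<rho> (x + (-1) *\<^sub>R y)) y"
          by (simp only: p1[abs_def])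
        also have "\<dots> = - partial i (\<lambda>y. partial i \<rho> (x + (-1) *\<^sub>R y)) y"
          by (rule partial_minus[OF smooth_affine[OF test_smooth[OF t1]]])
        also have "\<dots> = partial i (partial i \<rho>) (x - y)"
          using partial_affine[OF smooth_differentiable[OF test_smooth[OF t1]],
            where a = x and c = "-1" and x = y] by simp
        finally show ?thesis .
      qed
      have "(\<Sum>i\<in>UNIV. ?FF i x) = (LINT y|lborel. f y * laplacian ?q y)"
        unfolding laplacian_def p2 sum_distrib_left conv_def
        by (rule Bochner_Integration.integral_sum[symmetric]) (rule conv_integrable[OF f t2])
      also have "\<dots> = 0" using harm test_reflect[OF \<rho>, of x] by simp
      finally show ?thesis .
    qed
    have "(LINT x|lborel. (\<Sum>i\<in>UNIV. (?F i x)\<^sup>2)) = (LINT x|lborel. (\<Sum>i\<in>UNIV. (?F i x)\<^sup>2 + conv f \<rho> x * ?FF i x))"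
      by (simp add: sum.distrib sum_distrib_left[symmetric] lap0)
    also have "\<dots> = (\<Sum>i\<in>UNIV. LINT x|lborel. (?F i x)\<^sup>2 + conv f \<rho> x * ?FF i x)"
      by (rule Bochner_Integration.integral_sum) (intro Bochner_Integration.integrable_add int1 int2)
    also have "\<dots> = 0" by (simp only: div0 sum.neutral_const)
    finally have "(LINT x|lborel. (\<Sum>i\<in>UNIV. (?F i x)\<^sup>2)) = 0" .
    moreover have "integrable lborel (\<lambda>x. \<Sum>i\<in>UNIV. (?F i x)\<^sup>2)"
      by (rule Bochner_Integration.integrable_sum[OF int1])
    ultimately have "AE x in lborel. (\<Sum>i\<in>UNIV. (?F i x)\<^sup>2) = 0"
      by (subst (asm) integral_nonneg_eq_0_iff_AE) (auto intro!: AE_I2 sum_nonneg)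
    then have "(\<Sum>i\<in>UNIV. (?F i x)\<^sup>2) = 0" for x
      by (rule continuous_AE_zero[rotated]) (intro continuous_intros continuous_conv f t1)
    then have grad0: "?F i x = 0" for i x
      by (simp add: sum_nonneg_eq_0_iff)
    have const: "conv f \<rho> (y + s *\<^sub>R axis i 1) = conv f \<rho> y" for y s and i :: 3
    proof -
      have "((\<lambda>s. conv f \<rho> (y + s *\<^sub>R axis i 1)) has_real_derivative 0) (at s)" for s
        using DERIV_conv[OF f \<rho>, of y i s] by (simp add: grad0)
      then have "conv f \<rho> (y + s *\<^sub>R axis i 1) = conv f \<rho> (y + 0 *\<^sub>R axis i 1)"
        by (rule DERIV_isconst_all[rule_format])
      then show ?thesis by simp
    qed
    have const0: "conv f \<rho> y = conv f \<rho> 0" for y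
    proof -
      have "y = 0 + y $ 1 *\<^sub>R axis 1 1 + y $ 2 *\<^sub>R axis 2 1 + y $ 3 *\<^sub>R axis 3 1"
        by (simp add: vec_eq_iff forall_3 axis_def)
      then have "conv f \<rho> y = conv f \<rho> (0 + y $ 1 *\<^sub>R axis 1 1 + y $ 2 *\<^sub>R axis 2 1 + y $ 3 *\<^sub>R axis 3 1)"
        by (rule arg_cong)
      then show ?thesis unfolding const .
    qed
    define a where "a = conv f \<rho> 0"
    have const_a: "conv f \<rho> y = a" for y unfolding a_def by (rule const0)
    \<comment> \<open>The whole space has infinite measure, so an integrable constant is
      zero.\<close>
    have "integrable lborel (\<lambda>x::vec3. a\<^sup>2)"
      using L2_integrable_norm[OF conv_L2[OF f \<rho>]] by (simp add: const_a)
    then have "a = 0"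
      by (auto simp: integrable_iff_bounded emeasure_lborel_UNIV ennreal_mult_top split: if_splits)
    then show ?thesis by (simp add: const_a)
  qed
  have "AE x in lborel. x \<in> UNIV \<longrightarrow> f x = 0"
  proof (rule fundamental_lemma[OF open_UNIV L2_on_imp_L1_loc[OF f]])
    fix \<psi> assume \<psi>: "\<psi> \<in> test_functions UNIV"
    \<comment> \<open>Evaluating at the origin with the reflected test function gives back the plain
      pairing of \<open>f\<close> with \<open>\<psi>\<close>.\<close>
    have "conv f (\<lambda>y. \<psi> (0 - y)) 0 = 0" by (rule conv0[OF test_reflect[OF \<psi>]])
    then show "(LINT x:UNIV|lborel. f x * \<psi> x) = 0"
      by (simp add: conv_def set_lebesgue_integral_def)
  qed
  then show ?thesis by simp
qed

text \<open>A limit of curls is orthogonal to gradients; by hypothesis it is also orthogonal to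
  double curls, since the curl of a test field is a divergence-free test field. Together these are
  all componentwise Laplacians, and the Liouville theorem applies to each component.\<close>

lemma orthogonal_curl_space_zero:
  assumes g: "g \<in> closure (curl_class ` test_fields UNIV)"
    and orth: "\<And>v. v \<in> curl_space \<Longrightarrow> g \<bullet> v = 0"
  shows "g = 0"
proof -
  obtain v where v: "L2_on UNIV v" "g = toL2 v" using L2field_rep by blast
  obtain G where G: "\<forall>n. G n \<in> curl_class ` test_fields UNIV" "G \<longlonglongrightarrow> g"
    using g unfolding closure_sequential by blast
  have grad_orth: "g \<bullet> toL2 (grad p) = 0" if p: "p \<in> test_functions UNIV" for p
  proof -
    have "G n \<bullet> toL2 (grad p) = 0" for n
    proof -
      obtain \<psi> where \<psi>: "\<psi> \<in> test_fields UNIV" "G n = curl_class \<psi>" using G(1) by blast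
      have "(LINT x|lborel. grad p x \<bullet> curl \<psi> x) = 0"
        using integral_curl_by_parts[OF smooth_grad[OF test_smooth[OF p]] \<psi>(1)]
        by (simp add: curl_grad[OF test_smooth[OF p]])
      then show ?thesis
        using \<psi> curl_L2[OF \<psi>(1)] test_field_L2[OF grad_test_field[OF p]]
        by (simp add: curl_class_def toL2_inner inner_commute)
    qed
    then have "(\<lambda>n. 0) \<longlonglongrightarrow> g \<bullet> toL2 (grad p)"
      using tendsto_inner[OF G(2) tendsto_const, of "toL2 (grad p)"] by simp
    then show ?thesis by (simp add: LIMSEQ_const_iff)
  qed
  have comp: "AE x in lborel. v x $ i = 0" for i
  proof (rule weakly_harmonic_L2_imp_zero)
    show "L2_on UNIV (\<lambda>x. v x $ i)" using v(1) unfolding L2_components by blast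
    fix q assume q: "q \<in> test_functions UNIV"
    define \<theta> where "\<theta> x = axis i (q x)" for x
    have \<theta>_comp: "(\<lambda>x. \<theta> x $ j) = (if j = i then q else (\<lambda>x. 0))" for j
      by (auto simp: \<theta>_def axis_def)
    have \<theta>: "\<theta> \<in> test_fields UNIV"
      unfolding test_fields_iff \<theta>_comp using q test_zero by auto
    note s\<theta> = test_smooth_field[OF \<theta>]
    have lap_zero: "laplacian (\<lambda>x. 0) x = 0" for x
      by (simp add: laplacian_def partial_def[abs_def])
    \<comment> \<open>With a single nonzero component \<open>q\<close> in \<theta>, the identity for
      the double curl isolates the Laplacian of \<open>q\<close> in that component.\<close>
    have lap: "grad (divergence \<theta>) x - curl (curl \<theta>) x = axis i (laplacian q x)" for x
      unfolding vec_eq_iff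
    proof
      fix j
      have "(grad (divergence \<theta>) x - curl (curl \<theta>) x) $ j = laplacian (\<lambda>y. \<theta> y $ j) x"
        by (simp add: grad_nth curl_curl[OF s\<theta>])
      then show "(grad (divergence \<theta>) x - curl (curl \<theta>) x) $ j = axis i (laplacian q x) $ j"
        by (simp add: \<theta>_comp lap_zero axis_def)
    qed
    have ct: "curl \<theta> \<in> div_free_test_fields"
      unfolding div_free_test_fields_def using curl_test_field[OF \<theta>] divergence_curl[OF s\<theta>] by blast
    have "curl_class (curl \<theta>) \<in> curl_space"
      unfolding curl_space_def by (rule subsetD[OF closure_subset imageI[OF ct]])
    then have "g \<bullet> curl_class (curl \<theta>) = 0" by (rule orth)
    then have 1: "(LINT x|lborel. v x \<bullet> curl (curl \<theta>) x) = 0"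
      using curl_L2[OF curl_test_field[OF \<theta>]] v by (simp add: curl_class_def toL2_inner)
    have L2g: "L2_on UNIV (grad (divergence \<theta>))"
      by (rule test_field_L2[OF grad_test_field[OF divergence_test[OF \<theta>]]])
    have 2: "(LINT x|lborel. v x \<bullet> grad (divergence \<theta>) x) = 0"
      using grad_orth[OF divergence_test[OF \<theta>]] L2g v by (simp add: toL2_inner)
    have "(LINT x|lborel. v x \<bullet> (grad (divergence \<theta>) x - curl (curl \<theta>) x)) = 0"
      using 1 2 L2_inner_integrable[OF v(1) L2g] L2_inner_integrable[OF v(1) curl_L2[OF curl_test_field[OF \<theta>]]]
      by (simp add: inner_diff_right)
    then show "(LINT x|lborel. v x $ i * laplacian q x) = 0"
      by (simp add: lap inner_axis)
  qed
  have "AE x in lborel. v x = 0"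
    using comp[of 1] comp[of 2] comp[of 3] by eventually_elim (simp add: vec_eq_iff forall_3)
  then have "toL2 v = toL2 (\<lambda>x. 0)" using v(1) by (simp add: toL2_eq_iff)
  then show ?thesis using v(2) by (simp add: zero_L2field_def)
qed

text \<open>The residual of the orthogonal projection onto \<open>curl_space\<close> is orthogonal
  to that space and still a limit of curls of test fields, hence zero.\<close>

theorem curl_class_in_curl_space:
  assumes "w \<in> closure (curl_class ` test_fields UNIV)"
  shows "w \<in> curl_space"
proof -
  let ?T = "curl_class ` test_fields UNIV"
  obtain p where p: "p \<in> curl_space" "\<forall>v\<in>curl_space. (w - p) \<bullet> v = 0"
    using ex_orthogonal_projection[OF subspace_curl_space closed_curl_space, of w] by blast
  have "curl_space \<subseteq> closure ?T"
    unfolding curl_space_def by (intro closure_mono image_mono) (auto dest: div_freeD)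
  then have "p \<in> closure ?T" using p(1) by blast
  then obtain P where P: "\<forall>n. P n \<in> ?T" "P \<longlonglongrightarrow> p" unfolding closure_sequential by blast
  obtain X where X: "\<forall>n. X n \<in> ?T" "X \<longlonglongrightarrow> w" using assms unfolding closure_sequential by blast
  have "X n - P n \<in> ?T" for n
  proof -
    obtain f g where fg: "f \<in> test_fields UNIV" "X n = curl_class f" "g \<in> test_fields UNIV" "P n = curl_class g"
      using X(1) P(1) by blast
    then have "X n - P n = curl_class (\<lambda>x. f x - g x)"
      by (simp add: curl_class_diff[OF fg(1,3)])
    then show ?thesis using test_fields_diff[OF fg(1,3)] by (simp only: imageI)
  qed
  then have "w - p \<in> closure ?T"
    unfolding closure_sequential
    using tendsto_diff[OF X(2) P(2)] by (intro exI[of _ "\<lambda>n. X n - P n"]) auto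
  from orthogonal_curl_space_zero[OF this] show ?thesis using p by simp
qed

section \<open>Comparison of the perturbed and the limit equation\<close>

context two_phase_law
begin

lemma A_L2:
  assumes S: "S \<in> sets borel" and g: "L2_on UNIV g" and w: "L2_on UNIV w"
  shows "L2_on UNIV (\<lambda>x. A S x (w x + g x) - A S x (g x))"
proof (rule L2_dominated[OF w])
  show "(\<lambda>x. A S x (w x + g x) - A S x (g x)) \<in> borel_measurable borel"
    using L2_measurable[OF w] L2_measurable[OF g]
    by (intro borel_measurable_diff A_measurable S borel_measurable_add)
  show "norm (A S x (w x + g x) - A S x (g x)) \<le> c2 * norm (w x)" for x
    using A_lip[of S x "w x + g x" "g x"] by simp
qed

lemma jump_L2:
  assumes \<omega>: "open \<omega>" "bounded \<omega>" and g: "L2_on UNIV g"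
  shows "L2_on UNIV (\<lambda>x. indicator \<omega> x *\<^sub>R (a1 (g x) - a2 (g x)))"
proof -
  have \<omega>_borel: "\<omega> \<in> sets borel" using \<omega>(1) by simp
  have gm: "g \<in> borel_measurable borel" by (rule L2_measurable[OF g])
  \<comment> \<open>Subtracting the values at 0 leaves a field bounded by
    \<open>2 * c2 * norm (g x)\<close>; the constant difference is restored afterwards, where
    boundedness of \<omega> makes it square integrable.\<close>
  have "L2_on UNIV (\<lambda>x. indicator \<omega> x *\<^sub>R (a1 (g x) - a1 0 - (a2 (g x) - a2 0)))"
  proof (rule L2_dominated[OF g])
    show "(\<lambda>x. indicator \<omega> x *\<^sub>R (a1 (g x) - a1 0 - (a2 (g x) - a2 0))) \<in> borel_measurable borel"
      using measurable_compose[OF gm borel_measurable_continuous_onI[OF continuous_law(1)]]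
        measurable_compose[OF gm borel_measurable_continuous_onI[OF continuous_law(2)]] \<omega>_borel
      by (intro borel_measurable_scaleR borel_measurable_indicator borel_measurable_diff) auto
    have "norm (a1 y - a1 0 - (a2 y - a2 0)) \<le> (2 * c2) * norm y" for y
      using norm_triangle_ineq4[of "a1 y - a1 0" "a2 y - a2 0"] a1_lip[of y 0] a2_lip[of y 0] by simp
    then show "norm (indicator \<omega> x *\<^sub>R (a1 (g x) - a1 0 - (a2 (g x) - a2 0))) \<le> (2 * c2) * norm (g x)" for x
      using c2 by (auto simp: indicator_def)
  qed
  from L2_add[OF this L2_indicator_const[OF \<omega>, of "a1 0 - a2 0"]]
  moreover have "indicator \<omega> x *\<^sub>R (a1 (g x) - a1 0 - (a2 (g x) - a2 0)) + indicator \<omega> x *\<^sub>R (a1 0 - a2 0)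
      = indicator \<omega> x *\<^sub>R (a1 (g x) - a2 (g x))" for x
    by (cases "x \<in> \<omega>") simp_all
  ultimately show ?thesis by (simp only:)
qed

text \<open>Strong monotonicity is applied at \<open>W + g\<close> and \<open>\<psi> + g\<close>, where both
  the perturbed equation and the limit equation are tested with \<open>W - \<psi>\<close>.\<close>

lemma corrector_estimate:
  fixes W g \<psi> w :: "vec3 \<Rightarrow> vec3"
  assumes \<omega>: "open \<omega>" "bounded \<omega>" and S: "S \<in> sets borel"
    and L2: "L2_on UNIV W" "L2_on UNIV g" "L2_on UNIV \<psi>" "L2_on UNIV w"
    and \<omega>_B: "\<omega> \<subseteq> cball 0 r" and \<psi>_B: "\<And>x. x \<notin> cball 0 r \<Longrightarrow> \<psi> x = 0"
    and S_\<omega>: "\<And>x. x \<in> cball 0 r \<Longrightarrow> x \<in> S \<longleftrightarrow> x \<in> \<omega>"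
    and near: "AE x in lborel. x \<in> cball 0 r \<longrightarrow> norm (g x - U) \<le> \<eta>"
    and pert: "(LINT x|lborel. (A S x (W x + g x) - A S x (g x) + indicator \<omega> x *\<^sub>R (a1 (g x) - a2 (g x)))
      \<bullet> (W x - \<psi> x)) = 0"
    and limit: "toL2 (flux \<omega> U w) \<bullet> (toL2 W - toL2 \<psi>) = 0"
  shows "c1\<^sup>2 * (norm (toL2 W - toL2 \<psi>))\<^sup>2
    \<le> 2 * c2\<^sup>2 * (norm (toL2 w - toL2 \<psi>))\<^sup>2 + 32 * c2\<^sup>2 * \<eta>\<^sup>2 * measure lborel (cball (0::vec3) r)"
proof -
  define P where "P x = A S x (W x + g x) - A S x (g x) + indicator \<omega> x *\<^sub>R (a1 (g x) - a2 (g x))" for x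
  define Q where "Q x = A S x (W x + g x) - A S x (\<psi> x + g x)" for x
  \<comment> \<open>\<open>P\<close> and the flux are both orthogonal to \<open>W - \<psi>\<close>,
    so \<open>R\<close> may replace \<open>Q\<close> in the pairing. In \<open>Q x - P x\<close> the
    terms with \<open>W x\<close> cancel, hence \<open>R\<close> can be estimated without any
    knowledge of \<open>W\<close>.\<close>
  define R where "R x = Q x - P x + flux \<omega> U w x" for x
  note v = L2_diff[OF L2(1,3)]
  have LP: "L2_on UNIV P" unfolding P_def[abs_def] by (intro L2_add A_L2 jump_L2 \<omega> S L2)
  have LF: "L2_on UNIV (flux \<omega> U w)" by (rule flux_L2[OF \<omega> L2(4)])
  have LQ: "L2_on UNIV Q"
  proof -
    have "L2_on UNIV (\<lambda>x. (A S x (W x + g x) - A S x (g x)) - (A S x (\<psi> x + g x) - A S x (g x)))"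
      by (intro L2_diff A_L2 S L2)
    then show ?thesis by (simp add: Q_def[abs_def])
  qed
  have LR: "L2_on UNIV R" unfolding R_def[abs_def] by (intro L2_add L2_diff LP LQ LF)
  have mono: "c1 * (norm (toL2 W - toL2 \<psi>))\<^sup>2 \<le> toL2 Q \<bullet> (toL2 W - toL2 \<psi>)"
  proof -
    have "c1 * (norm (toL2 W - toL2 \<psi>))\<^sup>2 = (LINT x|lborel. c1 * (norm (W x - \<psi> x))\<^sup>2)"
      using v L2 by (simp add: toL2_diff[symmetric] toL2_norm_power2)
    also have "\<dots> \<le> (LINT x|lborel. Q x \<bullet> (W x - \<psi> x))"
    proof (rule integral_mono)
      show "integrable lborel (\<lambda>x. c1 * (norm (W x - \<psi> x))\<^sup>2)"
        by (intro integrable_mult_right L2_integrable_norm v)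
      show "integrable lborel (\<lambda>x. Q x \<bullet> (W x - \<psi> x))" by (rule L2_inner_integrable[OF LQ v])
      show "c1 * (norm (W x - \<psi> x))\<^sup>2 \<le> Q x \<bullet> (W x - \<psi> x)" for x
        using A_mono[of "W x + g x" "\<psi> x + g x" S x] by (simp add: Q_def)
    qed
    also have "\<dots> = toL2 Q \<bullet> (toL2 W - toL2 \<psi>)"
      using v L2 LQ by (simp add: toL2_diff[symmetric] toL2_inner)
    finally show ?thesis .
  qed
  have "toL2 P \<bullet> (toL2 W - toL2 \<psi>) = 0"
    using pert v L2 LP by (simp add: toL2_diff[symmetric] toL2_inner P_def)
  moreover have "toL2 R = toL2 Q - toL2 P + toL2 (flux \<omega> U w)"
    unfolding R_def[abs_def] using LP LQ LF by (simp add: toL2_add toL2_diff L2_diff)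
  ultimately have "toL2 Q \<bullet> (toL2 W - toL2 \<psi>) = toL2 R \<bullet> (toL2 W - toL2 \<psi>)"
    using limit by (simp add: inner_add_left inner_diff_left)
  also have "\<dots> \<le> norm (toL2 R) * norm (toL2 W - toL2 \<psi>)" by (rule norm_cauchy_schwarz)
  finally have "c1 * (norm (toL2 W - toL2 \<psi>))\<^sup>2 \<le> norm (toL2 R) * norm (toL2 W - toL2 \<psi>)"
    using mono by simp
  then have "c1 * norm (toL2 W - toL2 \<psi>) \<le> norm (toL2 R)"
    by (cases "toL2 W - toL2 \<psi> = 0") (auto simp: power2_eq_square)
  then have "(c1 * norm (toL2 W - toL2 \<psi>))\<^sup>2 \<le> (norm (toL2 R))\<^sup>2"
    using c1 by (intro power_mono) auto
  also have "\<dots> = (LINT x|lborel. (norm (R x))\<^sup>2)" by (rule toL2_norm_power2[OF LR])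
  also have "\<dots> \<le> (LINT x|lborel. 2 * c2\<^sup>2 * (norm (w x - \<psi> x))\<^sup>2 + 32 * c2\<^sup>2 * \<eta>\<^sup>2 * indicator (cball (0::vec3) r) x)"
  proof (rule integral_mono_AE)
    show "integrable lborel (\<lambda>x. (norm (R x))\<^sup>2)" by (rule L2_integrable_norm[OF LR])
    show "integrable lborel (\<lambda>x. 2 * c2\<^sup>2 * (norm (w x - \<psi> x))\<^sup>2 + 32 * c2\<^sup>2 * \<eta>\<^sup>2 * indicator (cball (0::vec3) r) x)"
      by (intro Bochner_Integration.integrable_add integrable_mult_right L2_integrable_norm L2_diff L2
          integrable_real_indicator emeasure_compact_finite) auto
    show "AE x in lborel. (norm (R x))\<^sup>2
        \<le> 2 * c2\<^sup>2 * (norm (w x - \<psi> x))\<^sup>2 + 32 * c2\<^sup>2 * \<eta>\<^sup>2 * indicator (cball (0::vec3) r) x"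
      using near
    proof eventually_elim
      fix x assume near: "x \<in> cball 0 r \<longrightarrow> norm (g x - U) \<le> \<eta>"
      \<comment> \<open>Replacing \<open>g x\<close> by \<open>U\<close> costs
        \<open>c2 * \<eta>\<close> four times: twice in the composite law and once for each of
        \<open>a1\<close> and \<open>a2\<close> in the jump. Squaring with the factor 2 gives
        \<open>2 * 16 = 32\<close>.\<close>
      have "norm (R x) \<le> c2 * norm (w x - \<psi> x) + 4 * c2 * \<eta> * indicator (cball (0::vec3) r) x"
      proof (cases "x \<in> cball 0 r")
        case True
        have AS: "A S x y = A \<omega> x y" for y using S_\<omega>[OF True] by (simp add: two_phase_def)
        have n: "norm (U - g x) \<le> \<eta>" "norm (g x - U) \<le> \<eta>" using near True by (auto simp: norm_minus_commute)
        have "R x = (A \<omega> x (w x + U) - A \<omega> x (\<psi> x + U)) + (A \<omega> x (\<psi> x + U) - A \<omega> x (\<psi> x + g x))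
          + (A \<omega> x (g x) - A \<omega> x U) + indicator \<omega> x *\<^sub>R ((a1 U - a1 (g x)) + (a2 (g x) - a2 U))"
          unfolding R_def Q_def P_def flux_def AS by (simp add: scaleR_diff_right scaleR_add_right)
        also have "norm \<dots> \<le> c2 * norm (w x - \<psi> x) + c2 * \<eta> + c2 * \<eta> + (c2 * \<eta> + c2 * \<eta>)"
        proof (intro order_trans[OF norm_triangle_ineq] add_mono)
          show "norm (A \<omega> x (w x + U) - A \<omega> x (\<psi> x + U)) \<le> c2 * norm (w x - \<psi> x)"
            using A_lip[of \<omega> x "w x + U" "\<psi> x + U"] by simp
          have l: "c2 * norm (U - g x) \<le> c2 * \<eta>" "c2 * norm (g x - U) \<le> c2 * \<eta>"
            using n c2 by (auto intro: mult_left_mono)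
          show "norm (A \<omega> x (\<psi> x + U) - A \<omega> x (\<psi> x + g x)) \<le> c2 * \<eta>"
            using A_lip[of \<omega> x "\<psi> x + U" "\<psi> x + g x"] l by simp
          show "norm (A \<omega> x (g x) - A \<omega> x U) \<le> c2 * \<eta>"
            using A_lip[of \<omega> x "g x" U] l by simp
          have "norm ((a1 U - a1 (g x)) + (a2 (g x) - a2 U)) \<le> c2 * \<eta> + c2 * \<eta>"
            using norm_triangle_ineq[of "a1 U - a1 (g x)" "a2 (g x) - a2 U"] a1_lip[of U "g x"] a2_lip[of "g x" U] l
            by linarith
          moreover have "0 \<le> c2 * \<eta> + c2 * \<eta>" using order_trans[OF norm_ge_zero n(1)] c2 by simp
          ultimately show "norm (indicator \<omega> x *\<^sub>R ((a1 U - a1 (g x)) + (a2 (g x) - a2 U))) \<le> c2 * \<eta> + c2 * \<eta>"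
            by (auto simp: indicator_def)
        qed
        finally show ?thesis using True by (simp add: algebra_simps)
      next
        case False
        \<comment> \<open>Off the ball \<open>S\<close> may differ from \<omega>, but with
          \<open>\<psi> x = 0\<close> the two terms involving \<open>S\<close> cancel. What is left
          is controlled by \<open>norm (w x)\<close>, which here is the approximation error.\<close>
        then have "x \<notin> \<omega>" "\<psi> x = 0" using \<omega>_B \<psi>_B by auto
        then have "R x = A \<omega> x (w x + U) - A \<omega> x U"
          unfolding R_def Q_def P_def flux_def by simp
        then show ?thesis using False A_lip[of \<omega> x "w x + U" U] \<open>\<psi> x = 0\<close> by simp
      qed
      then have "(norm (R x))\<^sup>2 \<le> (c2 * norm (w x - \<psi> x) + 4 * c2 * \<eta> * indicator (cball (0::vec3) r) x)\<^sup>2"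
        by (rule power_mono) simp
      also have "\<dots> \<le> 2 * (c2 * norm (w x - \<psi> x))\<^sup>2 + 2 * (4 * c2 * \<eta> * indicator (cball (0::vec3) r) x)\<^sup>2"
        using norm_add_sq_le[of "c2 * norm (w x - \<psi> x)" "4 * c2 * \<eta> * indicator (cball (0::vec3) r) x"] by simp
      also have "\<dots> = 2 * c2\<^sup>2 * (norm (w x - \<psi> x))\<^sup>2 + 32 * c2\<^sup>2 * \<eta>\<^sup>2 * indicator (cball (0::vec3) r) x"
        by (simp add: power_mult_distrib indicator_def)
      finally show "(norm (R x))\<^sup>2 \<le> 2 * c2\<^sup>2 * (norm (w x - \<psi> x))\<^sup>2 + 32 * c2\<^sup>2 * \<eta>\<^sup>2 * indicator (cball (0::vec3) r) x" .
    qed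
  qed
  also have "\<dots> = 2 * c2\<^sup>2 * (norm (toL2 w - toL2 \<psi>))\<^sup>2 + 32 * c2\<^sup>2 * \<eta>\<^sup>2 * measure lborel (cball (0::vec3) r)"
  proof -
    have "integrable lborel (\<lambda>x. (norm (w x - \<psi> x))\<^sup>2)" by (intro L2_integrable_norm L2_diff L2)
    moreover have "integrable lborel (indicator (cball (0::vec3) r) :: vec3 \<Rightarrow> real)"
      by (intro integrable_real_indicator emeasure_compact_finite) auto
    moreover have "(norm (toL2 w - toL2 \<psi>))\<^sup>2 = (LINT x|lborel. (norm (w x - \<psi> x))\<^sup>2)"
      using L2 by (simp add: toL2_diff[symmetric] toL2_norm_power2 L2_diff)
    ultimately show ?thesis by simp
  qed
  finally show ?thesis by (simp add: power_mult_distrib)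
qed

end

section \<open>Fields on the domain\<close>

lemma tendsto_L2_cong:
  assumes lim: "tendsto_L2 S f g F" and g': "L2_on S g'" and eq: "AE x in lborel. x \<in> S \<longrightarrow> g x = g' x"
  shows "tendsto_L2 S f g' F"
proof -
  have g: "L2_on S g" using lim by (simp add: tendsto_L2_iff)
  have "sq_int S (\<lambda>x. f i x - g' x) = sq_int S (\<lambda>x. f i x - g x)" if f: "L2_on S (f i)" for i
    unfolding sq_int_def set_lebesgue_integral_def
  proof (rule integral_cong_AE)
    show "(\<lambda>x. indicator S x *\<^sub>R (norm (f i x - g' x))\<^sup>2) \<in> borel_measurable lborel"
      using L2_on_integrable[OF L2_on_diff[OF f g']] by (auto simp: set_integrable_def)
    show "(\<lambda>x. indicator S x *\<^sub>R (norm (f i x - g x))\<^sup>2) \<in> borel_measurable lborel"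
      using L2_on_integrable[OF L2_on_diff[OF f g]] by (auto simp: set_integrable_def)
    show "AE x in lborel. indicator S x *\<^sub>R (norm (f i x - g' x))\<^sup>2 = indicator S x *\<^sub>R (norm (f i x - g x))\<^sup>2"
      using eq by eventually_elim (auto simp: indicator_def)
  qed
  then have "\<forall>\<^sub>F i in F. sq_int S (\<lambda>x. f i x - g x) = sq_int S (\<lambda>x. f i x - g' x)"
    using lim[unfolded tendsto_L2_iff, THEN conjunct1] by (auto elim: eventually_mono)
  with lim g' show ?thesis
    unfolding tendsto_L2_iff by (auto elim: Lim_transform_eventually)
qed

lemma L2_on_inner_integrable:
  assumes "L2_on S f" "L2_on S g"
  shows "set_integrable lborel S (\<lambda>x. f x \<bullet> g x)"
proof -
  have "integrable lborel (\<lambda>x. (indicator S x *\<^sub>R f x) \<bullet> (indicator S x *\<^sub>R g x))"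
    using assms by (intro L2_inner_integrable) (simp_all add: L2_on_iff_indicator[of S])
  moreover have "(indicator S x *\<^sub>R f x) \<bullet> (indicator S x *\<^sub>R g x) = indicator S x *\<^sub>R (f x \<bullet> g x)" for x
    by (simp add: indicator_def)
  ultimately show ?thesis by (simp only: set_integrable_def)
qed

lemma L2_on_component:
  fixes u :: "vec3 \<Rightarrow> vec3"
  shows "L2_on S u \<longleftrightarrow> (\<forall>i. L2_on S (\<lambda>x. u x $ i))"
  unfolding L2_on_iff_indicator[of S] L2_components[of "\<lambda>x. indicator S x *\<^sub>R u x"]
  by (simp add: indicator_def if_distrib[of "\<lambda>v. v $ _"] cong: if_cong)

lemma sq_int_triple:
  assumes "L2_on S a" "L2_on S b" "L2_on S c" "L2_on S h"
    and le: "\<And>x. (norm (h x))\<^sup>2 \<le> 2 * ((norm (a x))\<^sup>2 + (norm (b x))\<^sup>2 + (norm (c x))\<^sup>2)"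
  shows "sq_int S h \<le> 2 * (sq_int S a + sq_int S b + sq_int S c)"
proof -
  have int: "integrable lborel (\<lambda>x. indicator S x * (norm (a x))\<^sup>2)"
    "integrable lborel (\<lambda>x. indicator S x * (norm (b x))\<^sup>2)"
    "integrable lborel (\<lambda>x. indicator S x * (norm (c x))\<^sup>2)"
    "integrable lborel (\<lambda>x. indicator S x * (norm (h x))\<^sup>2)"
    using assms(1-4)[THEN L2_on_integrable] by (simp_all add: set_integrable_def)
  have "(LINT x|lborel. indicator S x * (norm (h x))\<^sup>2)
      \<le> (LINT x|lborel. 2 * (indicator S x * (norm (a x))\<^sup>2 + indicator S x * (norm (b x))\<^sup>2 + indicator S x * (norm (c x))\<^sup>2))"
    using int le by (intro integral_mono) (auto simp: indicator_def)
  then show ?thesis using int by (simp add: sq_int_def set_lebesgue_integral_def)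
qed

section \<open>Approximation by test fields and the regular decomposition\<close>

lemma H1_0_approx:
  assumes "f \<in> H1_0 D"
  shows "\<exists>p. (\<forall>n::nat. p n \<in> test_functions D) \<and> tendsto_L2 D p f sequentially \<and>
    tendsto_L2 D (\<lambda>n. grad (p n)) (weak_grad D f) sequentially"
  using assms by (auto simp: H1_0_def)

lemma L2_on_test_function: "f \<in> test_functions S \<Longrightarrow> T \<in> sets borel \<Longrightarrow> L2_on T f"
  by (rule L2_imp_L2_on[OF test_L2])

lemma L2_on_test_field: "f \<in> test_fields S \<Longrightarrow> T \<in> sets borel \<Longrightarrow> L2_on T f"
  by (rule L2_imp_L2_on[OF test_field_L2])

lemma sum_tendsto_zero:
  fixes a b c :: "nat \<Rightarrow> real"
  assumes "a \<longlonglongrightarrow> 0" "b \<longlonglongrightarrow> 0" "c \<longlonglongrightarrow> 0"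
  shows "(\<lambda>n. 2 * (a n + b n + c n)) \<longlonglongrightarrow> 0"
proof -
  have "(\<lambda>n. 2 * (a n + b n + c n)) \<longlonglongrightarrow> 2 * (0 + 0 + 0)" by (intro tendsto_intros assms)
  then show ?thesis by simp
qed

text \<open>The components are approximated separately and reassembled. The limit \<open>c\<close>
  of the curls is only asserted to exist; it is identified with a weak curl later, for the field
  whose regular part is \<open>us\<close>.\<close>

lemma H1_0_vec_approx:
  assumes D: "open D" and us: "us \<in> H1_0_vec D"
  shows "\<exists>\<psi> c. (\<forall>n::nat. \<psi> n \<in> test_fields D) \<and> tendsto_L2 D \<psi> us sequentially \<and>
    tendsto_L2 D (\<lambda>n. curl (\<psi> n)) c sequentially"
proof -
  have DB: "D \<in> sets borel" using D by simp
  have "\<forall>i. \<exists>p. (\<forall>n::nat. p n \<in> test_functions D) \<and> tendsto_L2 D p (\<lambda>x. us x $ i) sequentially \<and>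
    tendsto_L2 D (\<lambda>n. grad (p n)) (weak_grad D (\<lambda>x. us x $ i)) sequentially"
    using us H1_0_approx by (simp add: H1_0_vec_def)
  from choice[OF this] obtain p where p: "\<And>i n::nat. p i n \<in> test_functions D"
    "\<And>i. tendsto_L2 D (p i) (\<lambda>x. us x $ i) sequentially"
    "\<And>i. tendsto_L2 D (\<lambda>n. grad (p i n)) (weak_grad D (\<lambda>x. us x $ i)) sequentially" by blast
  define G where "G i = weak_grad D (\<lambda>x. us x $ i)" for i
  define \<psi> where "\<psi> n x = (\<chi> i. p i n x)" for n x
  \<comment> \<open>\<open>G i x $ j\<close> plays the role of the j-th partial derivative of the
    i-th component, so \<open>c\<close> is the curl formula with weak derivatives.\<close>
  define c where "c x = (vector [G 3 x $ 2 - G 2 x $ 3, G 1 x $ 3 - G 3 x $ 1, G 2 x $ 1 - G 1 x $ 2] :: vec3)" for x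
  have \<psi>: "\<psi> n \<in> test_fields D" for n
    unfolding test_fields_iff \<psi>_def using p(1) by simp
  have Lp: "L2_on D (p i n)" "L2_on D (grad (p i n))" for i n
    using L2_on_test_function[OF p(1) DB] L2_on_test_field[OF grad_test_field[OF p(1)] DB] by auto
  have Lus: "L2_on D (\<lambda>x. us x $ i)" and LG: "L2_on D (G i)" for i
    using p(2,3)[of i] by (auto simp: tendsto_L2_iff G_def)
  have Lus': "L2_on D us" unfolding L2_on_component using Lus by blast
  have LGc: "L2_on D (\<lambda>x. G i x $ j)" for i j using LG L2_on_component by blast
  have Lc: "L2_on D c"
    unfolding L2_on_component forall_3 c_def by (simp add: L2_on_diff LGc)
  have lim_p: "(\<lambda>n. sq_int D (\<lambda>x. p i n x - us x $ i)) \<longlonglongrightarrow> 0"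
    and lim_g: "(\<lambda>n. sq_int D (\<lambda>x. grad (p i n) x - G i x)) \<longlonglongrightarrow> 0" for i
    using p(2,3)[of i] by (auto simp: tendsto_L2_iff G_def)
  have "tendsto_L2 D \<psi> us sequentially"
  proof (rule tendsto_L2_bound)
    show "sq_int D (\<lambda>x. \<psi> n x - us x) \<le> 2 * (sq_int D (\<lambda>x. p 1 n x - us x $ 1)
        + sq_int D (\<lambda>x. p 2 n x - us x $ 2) + sq_int D (\<lambda>x. p 3 n x - us x $ 3))" for n
    proof (rule sq_int_triple)
      show "(norm (\<psi> n x - us x))\<^sup>2 \<le> 2 * ((norm (p 1 n x - us x $ 1))\<^sup>2 + (norm (p 2 n x - us x $ 2))\<^sup>2
          + (norm (p 3 n x - us x $ 3))\<^sup>2)" for x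
        by (simp add: norm_power2_3 \<psi>_def)
    qed (intro L2_on_diff Lp Lus Lus' L2_on_test_field[OF \<psi>] DB)+
  qed (use L2_on_test_field[OF \<psi> DB] Lus' sum_tendsto_zero[OF lim_p lim_p lim_p] in auto)
  moreover have "tendsto_L2 D (\<lambda>n. curl (\<psi> n)) c sequentially"
  proof (rule tendsto_L2_bound)
    show "sq_int D (\<lambda>x. curl (\<psi> n) x - c x) \<le> 2 * (sq_int D (\<lambda>x. grad (p 1 n) x - G 1 x)
        + sq_int D (\<lambda>x. grad (p 2 n) x - G 2 x) + sq_int D (\<lambda>x. grad (p 3 n) x - G 3 x))" for n
    proof (rule sq_int_triple)
      fix x
      have sq: "((a - b) - (a' - b'))\<^sup>2 \<le> 2 * (a - a')\<^sup>2 + 2 * (b - b')\<^sup>2" for a b a' b' :: real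
        using norm_diff_sq_le[of "a - a'" "b - b'"] by (simp add: algebra_simps)
      have c_nth: "c x $ 1 = G 3 x $ 2 - G 2 x $ 3" "c x $ 2 = G 1 x $ 3 - G 3 x $ 1" "c x $ 3 = G 2 x $ 1 - G 1 x $ 2"
        by (simp_all add: c_def)
      have "(norm (curl (\<psi> n) x - c x))\<^sup>2 \<le> 2 * (partial 2 (p 3 n) x - G 3 x $ 2)\<^sup>2 + 2 * (partial 3 (p 2 n) x - G 2 x $ 3)\<^sup>2
        + (2 * (partial 3 (p 1 n) x - G 1 x $ 3)\<^sup>2 + 2 * (partial 1 (p 3 n) x - G 3 x $ 1)\<^sup>2)
        + (2 * (partial 1 (p 2 n) x - G 2 x $ 1)\<^sup>2 + 2 * (partial 2 (p 1 n) x - G 1 x $ 2)\<^sup>2)"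
        unfolding norm_power2_3 vector_minus_component curl_nth c_nth
        by (intro add_mono) (simp_all add: \<psi>_def sq)
      also have "\<dots> \<le> 2 * ((norm (grad (p 1 n) x - G 1 x))\<^sup>2 + (norm (grad (p 2 n) x - G 2 x))\<^sup>2
          + (norm (grad (p 3 n) x - G 3 x))\<^sup>2)"
        unfolding norm_power2_3 by (simp add: grad_nth)
      finally show "(norm (curl (\<psi> n) x - c x))\<^sup>2 \<le> 2 * ((norm (grad (p 1 n) x - G 1 x))\<^sup>2
          + (norm (grad (p 2 n) x - G 2 x))\<^sup>2 + (norm (grad (p 3 n) x - G 3 x))\<^sup>2)" .
    qed (intro L2_on_diff Lp LG Lc L2_on_test_field[OF curl_test_field[OF \<psi>]] DB)+
  qed (use L2_on_test_field[OF curl_test_field[OF \<psi>] DB] Lc sum_tendsto_zero[OF lim_g lim_g lim_g] in auto)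
  ultimately show ?thesis using \<psi> by blast
qed

text \<open>The approximants vanish outside \<open>D\<close>, so no boundary term arises and \<zeta>
  may be supported anywhere.\<close>

lemma has_weak_curl_limit_on:
  assumes D: "open D" and \<psi>: "\<And>n::nat. \<psi> n \<in> test_fields D"
    and lim: "tendsto_L2 D \<psi> u sequentially" "tendsto_L2 D (\<lambda>n. curl (\<psi> n)) c sequentially"
    and \<zeta>: "\<zeta> \<in> test_fields T"
  shows "(LINT x:D|lborel. u x \<bullet> curl \<zeta> x) = (LINT x:D|lborel. c x \<bullet> \<zeta> x)"
proof -
  have "(\<lambda>n. LINT x:D|lborel. \<psi> n x \<bullet> curl \<zeta> x) \<longlonglongrightarrow> (LINT x:D|lborel. u x \<bullet> curl \<zeta> x)"
    by (rule tendsto_L2_inner[OF lim(1) curl_L2[OF \<zeta>]])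
  moreover have "(\<lambda>n. LINT x:D|lborel. curl (\<psi> n) x \<bullet> \<zeta> x) \<longlonglongrightarrow> (LINT x:D|lborel. c x \<bullet> \<zeta> x)"
    by (rule tendsto_L2_inner[OF lim(2) test_field_L2[OF \<zeta>]])
  moreover have "(LINT x:D|lborel. \<psi> n x \<bullet> curl \<zeta> x) = (LINT x:D|lborel. curl (\<psi> n) x \<bullet> \<zeta> x)" for n
  proof -
    have "(LINT x:D|lborel. \<psi> n x \<bullet> curl \<zeta> x) = (LINT x|lborel. \<psi> n x \<bullet> curl \<zeta> x)"
      by (rule set_integral_eq_integral) (simp add: test_field_zero_outside[OF \<psi>])
    also have "\<dots> = (LINT x|lborel. curl (\<psi> n) x \<bullet> \<zeta> x)"
      by (rule integral_curl_by_parts[OF test_smooth_field[OF \<psi>] \<zeta>])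
    also have "\<dots> = (LINT x:D|lborel. curl (\<psi> n) x \<bullet> \<zeta> x)"
      by (rule set_integral_eq_integral[symmetric]) (simp add: test_field_zero_outside[OF curl_test_field[OF \<psi>]])
    finally show ?thesis .
  qed
  ultimately show ?thesis using LIMSEQ_unique by simp
qed

lemma weak_grad_curl_free:
  assumes \<phi>: "\<phi> \<in> H1_0 D" and \<zeta>: "\<zeta> \<in> test_fields D"
  shows "(LINT x:D|lborel. weak_grad D \<phi> x \<bullet> curl \<zeta> x) = 0"
proof -
  obtain p where p: "\<And>n::nat. p n \<in> test_functions D" "tendsto_L2 D (\<lambda>n. grad (p n)) (weak_grad D \<phi>) sequentially"
    using H1_0_approx[OF \<phi>] by blast
  have "(\<lambda>n. LINT x:D|lborel. grad (p n) x \<bullet> curl \<zeta> x) \<longlonglongrightarrow> (LINT x:D|lborel. weak_grad D \<phi> x \<bullet> curl \<zeta> x)"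
    by (rule tendsto_L2_inner[OF p(2) curl_L2[OF \<zeta>]])
  moreover have "(LINT x:D|lborel. grad (p n) x \<bullet> curl \<zeta> x) = 0" for n
  proof -
    have "(LINT x:D|lborel. grad (p n) x \<bullet> curl \<zeta> x) = (LINT x|lborel. grad (p n) x \<bullet> curl \<zeta> x)"
      by (rule set_integral_eq_integral) (simp add: test_field_zero_outside[OF curl_test_field[OF \<zeta>]])
    also have "\<dots> = 0"
      using integral_curl_by_parts[OF smooth_grad[OF test_smooth[OF p(1)]] \<zeta>, of n]
      by (simp add: curl_grad[OF test_smooth[OF p(1)]])
    finally show ?thesis .
  qed
  ultimately show ?thesis by (simp add: LIMSEQ_const_iff)
qed

lemma H_curl_weak_curl:
  assumes D: "open D" and u: "u \<in> H_curl D"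
  shows "L2_on D u" "has_weak_curl D u (weak_curl D u)" "L2_on D (weak_curl D u)"
proof -
  obtain w where w: "L2_on D u" "L2_on D w" "has_weak_curl D u w" using u by (auto simp: H_curl_def)
  show "L2_on D u" by (rule w(1))
  show wc: "has_weak_curl D u (weak_curl D u)" by (rule has_weak_curl_weak_curl[OF w(3)])
  have meas: "(\<lambda>x. indicator D x *\<^sub>R weak_curl D u x) \<in> borel_measurable borel"
    by (rule L1_loc_indicator_measurable[OF D]) (use wc in \<open>simp add: has_weak_curl_def\<close>)
  have "AE x in lborel. indicator D x *\<^sub>R w x = indicator D x *\<^sub>R weak_curl D u x"
    using weak_curl_AE[OF D w(3)] by eventually_elim (auto simp: indicator_def)
  from L2_cong_AE[OF _ meas this] w(2) show "L2_on D (weak_curl D u)"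
    by (simp add: L2_on_iff_indicator[of D])
qed

lemma has_weak_curlI_L2:
  assumes "L2_on D u" "L2_on D w"
    and "\<And>\<psi>. \<psi> \<in> test_fields D \<Longrightarrow> (LINT x:D|lborel. u x \<bullet> curl \<psi> x) = (LINT x:D|lborel. w x \<bullet> \<psi> x)"
  shows "has_weak_curl D u w"
  unfolding has_weak_curl_def using assms by (auto intro: L2_on_imp_L1_loc)

text \<open>The gradient part is a limit of gradients of test functions and thus contributes no
  curl. Therefore the curls of the fields approximating the regular part converge to the weak curl
  of \<open>u\<close> itself.\<close>

lemma decomposition_approx:
  assumes D: "open D" and u: "u \<in> H_curl D" and dec: "regular_decomposition D u \<phi> us"
  shows "\<exists>\<psi>. (\<forall>n::nat. \<psi> n \<in> test_fields D) \<and> tendsto_L2 D \<psi> us sequentially \<and>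
    tendsto_L2 D (\<lambda>n. curl (\<psi> n)) (weak_curl D u) sequentially"
proof -
  have DB: "D \<in> sets borel" using D by simp
  have d: "\<phi> \<in> H1_0 D" "us \<in> H1_0_vec D" "AE x in lborel. x \<in> D \<longrightarrow> u x = weak_grad D \<phi> x + us x"
    using dec by (auto simp: regular_decomposition_def)
  obtain \<psi> c where \<psi>: "\<And>n::nat. \<psi> n \<in> test_fields D" "tendsto_L2 D \<psi> us sequentially"
    "tendsto_L2 D (\<lambda>n. curl (\<psi> n)) c sequentially"
    using H1_0_vec_approx[OF D d(2)] by blast
  have Lc: "L2_on D c" and Lus: "L2_on D us" using \<psi> by (auto simp: tendsto_L2_iff)
  have Lg: "L2_on D (weak_grad D \<phi>)"
    using H1_0_approx[OF d(1)] by (auto simp: tendsto_L2_iff)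
  note Lu = H_curl_weak_curl(1)[OF D u]
  have "has_weak_curl D u c"
  proof (rule has_weak_curlI_L2[OF Lu Lc])
    fix \<zeta> assume \<zeta>: "\<zeta> \<in> test_fields D"
    note Lcurl = L2_on_test_field[OF curl_test_field[OF \<zeta>] DB]
    have int: "set_integrable lborel D (\<lambda>x. weak_grad D \<phi> x \<bullet> curl \<zeta> x)" "set_integrable lborel D (\<lambda>x. us x \<bullet> curl \<zeta> x)"
      "set_integrable lborel D (\<lambda>x. u x \<bullet> curl \<zeta> x)"
      by (intro L2_on_inner_integrable Lg Lus Lu Lcurl)+
    have "(LINT x:D|lborel. u x \<bullet> curl \<zeta> x) = (LINT x:D|lborel. weak_grad D \<phi> x \<bullet> curl \<zeta> x + us x \<bullet> curl \<zeta> x)"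
      unfolding set_lebesgue_integral_def
    proof (rule integral_cong_AE)
      show "(\<lambda>x. indicator D x *\<^sub>R (u x \<bullet> curl \<zeta> x)) \<in> borel_measurable lborel"
        using int(3) by (auto simp: set_integrable_def)
      show "(\<lambda>x. indicator D x *\<^sub>R (weak_grad D \<phi> x \<bullet> curl \<zeta> x + us x \<bullet> curl \<zeta> x)) \<in> borel_measurable lborel"
        using set_integral_add(1)[OF int(1,2)] by (auto simp: set_integrable_def)
      show "AE x in lborel. indicator D x *\<^sub>R (u x \<bullet> curl \<zeta> x) =
          indicator D x *\<^sub>R (weak_grad D \<phi> x \<bullet> curl \<zeta> x + us x \<bullet> curl \<zeta> x)"
        using d(3) by eventually_elim (auto simp: indicator_def inner_add_left)
    qed
    also have "\<dots> = (LINT x:D|lborel. us x \<bullet> curl \<zeta> x)"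
      using set_integral_add(2)[OF int(1,2)] weak_grad_curl_free[OF d(1) \<zeta>] by simp
    also have "\<dots> = (LINT x:D|lborel. c x \<bullet> \<zeta> x)"
      by (rule has_weak_curl_limit_on[OF D \<psi> \<zeta>])
    finally show "(LINT x:D|lborel. u x \<bullet> curl \<zeta> x) = (LINT x:D|lborel. c x \<bullet> \<zeta> x)" .
  qed
  from weak_curl_AE[OF D this] have "AE x in lborel. x \<in> D \<longrightarrow> c x = weak_curl D u x"
    by eventually_elim auto
  from tendsto_L2_cong[OF \<psi>(3) H_curl_weak_curl(3)[OF D u] this] show ?thesis using \<psi> by blast
qed

text \<open>The condition in \<open>H0_curl\<close> mentions \<open>weak_curl\<close> of fields in
  \<open>H1_vec\<close>. Since that is a choice, it carries meaning only once a weak curl is known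
  to exist.\<close>

lemma H1_vec_H_curl:
  assumes D: "open D" and v: "v \<in> H1_vec D"
  shows "v \<in> H_curl D"
proof -
  have DB: "D \<in> sets borel" using D by simp
  have "\<forall>i. \<exists>g. L2_on D (\<lambda>x. v x $ i) \<and> L2_on D g \<and> has_weak_grad D (\<lambda>x. v x $ i) g"
    using v by (auto simp: H1_vec_def H1_def)
  from choice[OF this] obtain G where G: "\<And>i. L2_on D (\<lambda>x. v x $ i)" "\<And>i. L2_on D (G i)"
    "\<And>i. has_weak_grad D (\<lambda>x. v x $ i) (G i)" by blast
  have Lv: "L2_on D v" unfolding L2_on_component using G(1) by blast
  have LGc: "L2_on D (\<lambda>x. G i x $ j)" for i j using G(2) L2_on_component by blast
  define c where "c x = (vector [G 3 x $ 2 - G 2 x $ 3, G 1 x $ 3 - G 3 x $ 1, G 2 x $ 1 - G 1 x $ 2] :: vec3)" for x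
  have c_nth: "c x $ 1 = G 3 x $ 2 - G 2 x $ 3" "c x $ 2 = G 1 x $ 3 - G 3 x $ 1" "c x $ 3 = G 2 x $ 1 - G 1 x $ 2" for x
    by (simp_all add: c_def)
  have Lc: "L2_on D c"
    unfolding L2_on_component forall_3 c_nth by (simp add: L2_on_diff LGc)
  have ibp: "(LINT x:D|lborel. v x $ i * partial j q x) = - (LINT x:D|lborel. G i x $ j * q x)"
    if q: "q \<in> test_functions D" for q i j
  proof -
    \<comment> \<open>The weak gradient is defined through divergences of test fields; a field with
      one nonzero component extracts a single partial derivative.\<close>
    define \<theta> where "\<theta> x = axis j (q x)" for x
    have \<theta>_comp: "(\<lambda>x. \<theta> x $ k) = (if k = j then q else (\<lambda>x. 0))" for k
      by (auto simp: \<theta>_def axis_def)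
    have \<theta>: "\<theta> \<in> test_fields D" unfolding test_fields_iff \<theta>_comp using q test_zero by auto
    have p0: "partial k (\<lambda>x. 0) x = 0" for k x by (simp add: partial_def)
    have "divergence \<theta> x = (\<Sum>k\<in>UNIV. if k = j then partial k q x else 0)" for x
      unfolding divergence_def \<theta>_comp by (rule sum.cong) (auto simp: p0)
    then have "divergence \<theta> x = partial j q x" for x by simp
    moreover have "(LINT x:D|lborel. v x $ i * divergence \<theta> x) = - (LINT x:D|lborel. G i x \<bullet> \<theta> x)"
      using G(3)[of i] \<theta> unfolding has_weak_grad_def by blast
    ultimately show ?thesis by (simp add: \<theta>_def inner_axis)
  qed
  have "has_weak_curl D v c"
  proof (rule has_weak_curlI_L2[OF Lv Lc])
    fix \<zeta> assume \<zeta>: "\<zeta> \<in> test_fields D"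
    note t = test_fields_component[OF \<zeta>]
    have int: "set_integrable lborel D (\<lambda>x. v x $ i * partial j (\<lambda>y. \<zeta> y $ k) x)"
      "set_integrable lborel D (\<lambda>x. G i x $ j * \<zeta> x $ k)" for i j k
      using L2_on_inner_integrable[OF G(1)[of i] L2_on_test_function[OF test_partial[OF t] DB]]
        L2_on_inner_integrable[OF LGc[of i j] L2_on_test_function[OF t DB]] by simp_all
    note sd = set_integral_diff[of lborel D] and sa = set_integral_add[of lborel D]
    have "(LINT x:D|lborel. v x \<bullet> curl \<zeta> x) =
        (LINT x:D|lborel. (v x $ 1 * partial 2 (\<lambda>y. \<zeta> y $ 3) x - v x $ 1 * partial 3 (\<lambda>y. \<zeta> y $ 2) x)
        + (v x $ 2 * partial 3 (\<lambda>y. \<zeta> y $ 1) x - v x $ 2 * partial 1 (\<lambda>y. \<zeta> y $ 3) x)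
        + (v x $ 3 * partial 1 (\<lambda>y. \<zeta> y $ 2) x - v x $ 3 * partial 2 (\<lambda>y. \<zeta> y $ 1) x))"
      by (simp add: inner_3 curl_nth right_diff_distrib)
    also have "\<dots> = (LINT x:D|lborel. v x $ 1 * partial 2 (\<lambda>y. \<zeta> y $ 3) x) - (LINT x:D|lborel. v x $ 1 * partial 3 (\<lambda>y. \<zeta> y $ 2) x)
        + ((LINT x:D|lborel. v x $ 2 * partial 3 (\<lambda>y. \<zeta> y $ 1) x) - (LINT x:D|lborel. v x $ 2 * partial 1 (\<lambda>y. \<zeta> y $ 3) x))
        + ((LINT x:D|lborel. v x $ 3 * partial 1 (\<lambda>y. \<zeta> y $ 2) x) - (LINT x:D|lborel. v x $ 3 * partial 2 (\<lambda>y. \<zeta> y $ 1) x))"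
      by (simp only: sd sa int)
    also have "\<dots> = ((LINT x:D|lborel. G 3 x $ 2 * \<zeta> x $ 1) - (LINT x:D|lborel. G 2 x $ 3 * \<zeta> x $ 1))
        + ((LINT x:D|lborel. G 1 x $ 3 * \<zeta> x $ 2) - (LINT x:D|lborel. G 3 x $ 1 * \<zeta> x $ 2))
        + ((LINT x:D|lborel. G 2 x $ 1 * \<zeta> x $ 3) - (LINT x:D|lborel. G 1 x $ 2 * \<zeta> x $ 3))"
      by (simp add: ibp[OF t])
    also have "\<dots> = (LINT x:D|lborel. (G 3 x $ 2 * \<zeta> x $ 1 - G 2 x $ 3 * \<zeta> x $ 1)
        + (G 1 x $ 3 * \<zeta> x $ 2 - G 3 x $ 1 * \<zeta> x $ 2) + (G 2 x $ 1 * \<zeta> x $ 3 - G 1 x $ 2 * \<zeta> x $ 3))"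
      by (simp only: sd sa int)
    also have "\<dots> = (LINT x:D|lborel. c x \<bullet> \<zeta> x)"
      by (simp add: inner_3 c_nth left_diff_distrib)
    finally show "(LINT x:D|lborel. v x \<bullet> curl \<zeta> x) = (LINT x:D|lborel. c x \<bullet> \<zeta> x)" .
  qed
  then show ?thesis unfolding H_curl_def using Lv Lc by blast
qed

lemma set_integral_diff_inner:
  assumes "L2_on D f" "L2_on D g" "L2_on D h"
  shows "(LINT x:D|lborel. (f x - g x) \<bullet> h x) = (LINT x:D|lborel. f x \<bullet> h x) - (LINT x:D|lborel. g x \<bullet> h x)"
  using set_integral_diff(2)[OF L2_on_inner_integrable[OF assms(1,3)] L2_on_inner_integrable[OF assms(2,3)]]
  by (simp add: inner_diff_left)

lemma set_integral_inner_cong_AE: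
  assumes "L2_on D f" "L2_on D f'" "L2_on D h" "AE x in lborel. x \<in> D \<longrightarrow> f x = f' x"
  shows "(LINT x:D|lborel. f x \<bullet> h x) = (LINT x:D|lborel. f' x \<bullet> h x)"
  unfolding set_lebesgue_integral_def
proof (rule integral_cong_AE)
  show "(\<lambda>x. indicator D x *\<^sub>R (f x \<bullet> h x)) \<in> borel_measurable lborel"
    "(\<lambda>x. indicator D x *\<^sub>R (f' x \<bullet> h x)) \<in> borel_measurable lborel"
    using L2_on_inner_integrable[OF assms(1,3)] L2_on_inner_integrable[OF assms(2,3)]
    by (auto simp: set_integrable_def)
  show "AE x in lborel. indicator D x *\<^sub>R (f x \<bullet> h x) = indicator D x *\<^sub>R (f' x \<bullet> h x)"
    using assms(4) by eventually_elim (auto simp: indicator_def)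
qed

section \<open>The space of divergence-free fields with vanishing tangential trace\<close>

lemma V_space_H_curl: "u \<in> V_space D \<Longrightarrow> u \<in> H_curl D"
  by (simp add: V_space_def H0_curl_def)

lemma has_weak_curl_diff:
  assumes D: "open D" and u: "u \<in> H_curl D" and v: "v \<in> H_curl D"
  shows "has_weak_curl D (\<lambda>x. u x - v x) (\<lambda>x. weak_curl D u x - weak_curl D v x)"
proof (rule has_weak_curlI_L2)
  note U = H_curl_weak_curl[OF D u] and V = H_curl_weak_curl[OF D v]
  show "L2_on D (\<lambda>x. u x - v x)" "L2_on D (\<lambda>x. weak_curl D u x - weak_curl D v x)"
    by (intro L2_on_diff U V)+
  fix \<psi> assume \<psi>: "\<psi> \<in> test_fields D"
  have DB: "D \<in> sets borel" using D by simp
  note L = L2_on_test_field[OF \<psi> DB] L2_on_test_field[OF curl_test_field[OF \<psi>] DB]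
  show "(LINT x:D|lborel. (u x - v x) \<bullet> curl \<psi> x) = (LINT x:D|lborel. (weak_curl D u x - weak_curl D v x) \<bullet> \<psi> x)"
    using has_weak_curlD[OF U(2) \<psi>] has_weak_curlD[OF V(2) \<psi>]
    by (simp add: set_integral_diff_inner U V L)
qed

text \<open>The chosen weak curl of a difference agrees with the difference of the chosen weak curls
  only almost everywhere, so linearity has to pass through integrals over \<open>D\<close>.\<close>

lemma V_space_diff:
  assumes D: "open D" and u: "u \<in> V_space D" and v: "v \<in> V_space D"
  shows "(\<lambda>x. u x - v x) \<in> V_space D"
proof -
  have DB: "D \<in> sets borel" using D by simp
  note Hu = V_space_H_curl[OF u] and Hv = V_space_H_curl[OF v]
  note U = H_curl_weak_curl[OF D Hu] and V = H_curl_weak_curl[OF D Hv]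
  note hd = has_weak_curl_diff[OF D Hu Hv]
  have H: "(\<lambda>x. u x - v x) \<in> H_curl D"
    unfolding H_curl_def using hd L2_on_diff[OF U(1) V(1)] L2_on_diff[OF U(3) V(3)] by blast
  note UV = H_curl_weak_curl[OF D H]
  have "(LINT x:D|lborel. weak_curl D (\<lambda>x. u x - v x) x \<bullet> p x) = (LINT x:D|lborel. (u x - v x) \<bullet> weak_curl D p x)"
    if p: "p \<in> H1_vec D" for p
  proof -
    note P = H_curl_weak_curl[OF D H1_vec_H_curl[OF D p]]
    have "(LINT x:D|lborel. weak_curl D (\<lambda>x. u x - v x) x \<bullet> p x)
        = (LINT x:D|lborel. (weak_curl D u x - weak_curl D v x) \<bullet> p x)"
      by (rule set_integral_inner_cong_AE[OF UV(3) L2_on_diff[OF U(3) V(3)] P(1) weak_curl_AE[OF D hd]])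
    also have "\<dots> = (LINT x:D|lborel. (u x - v x) \<bullet> weak_curl D p x)"
      using u v p by (simp add: set_integral_diff_inner U V P V_space_def H0_curl_def)
    finally show ?thesis .
  qed
  moreover have "(LINT x:D|lborel. (u x - v x) \<bullet> grad \<psi> x) = 0" if \<psi>: "\<psi> \<in> test_functions D" for \<psi>
    using u v \<psi> L2_on_test_field[OF grad_test_field[OF \<psi>] DB]
    by (simp add: set_integral_diff_inner U V V_space_def weakly_div_free_def)
  ultimately show ?thesis
    using H L2_on_imp_L1_loc[OF UV(1)] by (simp add: V_space_def H0_curl_def weakly_div_free_def)
qed

lemma test_field_has_weak_curl:
  assumes D: "open D" and \<phi>: "\<phi> \<in> test_fields D"
  shows "has_weak_curl D \<phi> (curl \<phi>)"
proof (rule has_weak_curlI_L2)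
  have DB: "D \<in> sets borel" using D by simp
  show "L2_on D \<phi>" "L2_on D (curl \<phi>)"
    using L2_on_test_field[OF \<phi> DB] L2_on_test_field[OF curl_test_field[OF \<phi>] DB] by auto
  fix \<psi> assume \<psi>: "\<psi> \<in> test_fields D"
  show "(LINT x:D|lborel. \<phi> x \<bullet> curl \<psi> x) = (LINT x:D|lborel. curl \<phi> x \<bullet> \<psi> x)"
    using integral_curl_by_parts[OF test_smooth_field[OF \<phi>] \<psi>]
    by (simp add: set_integral_eq_integral test_field_zero_outside[OF \<phi>] test_field_zero_outside[OF curl_test_field[OF \<phi>]])
qed

text \<open>For a test field the boundary condition is just the definition of the weak curl of the
  other factor, tested with \<phi>.\<close>

lemma div_free_in_V_space:
  assumes D: "open D" and \<phi>: "\<phi> \<in> test_fields D" and div: "\<And>x. divergence \<phi> x = 0"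
  shows "\<phi> \<in> V_space D"
proof -
  have DB: "D \<in> sets borel" using D by simp
  note L = L2_on_test_field[OF \<phi> DB] L2_on_test_field[OF curl_test_field[OF \<phi>] DB]
  note wc = test_field_has_weak_curl[OF D \<phi>]
  have H: "\<phi> \<in> H_curl D" unfolding H_curl_def using L wc by blast
  note W = H_curl_weak_curl[OF D H]
  have "(LINT x:D|lborel. weak_curl D \<phi> x \<bullet> p x) = (LINT x:D|lborel. \<phi> x \<bullet> weak_curl D p x)"
    if p: "p \<in> H1_vec D" for p
  proof -
    note P = H_curl_weak_curl[OF D H1_vec_H_curl[OF D p]]
    have "(LINT x:D|lborel. weak_curl D \<phi> x \<bullet> p x) = (LINT x:D|lborel. curl \<phi> x \<bullet> p x)"
      by (rule set_integral_inner_cong_AE[OF W(3) L(2) P(1) weak_curl_AE[OF D wc]])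
    also have "\<dots> = (LINT x:D|lborel. p x \<bullet> curl \<phi> x)" by (simp add: inner_commute)
    also have "\<dots> = (LINT x:D|lborel. weak_curl D p x \<bullet> \<phi> x)" by (rule has_weak_curlD[OF P(2) \<phi>])
    finally show ?thesis by (simp add: inner_commute)
  qed
  moreover have "(LINT x:D|lborel. \<phi> x \<bullet> grad \<psi> x) = 0" if \<psi>: "\<psi> \<in> test_functions D" for \<psi>
  proof -
    have "(LINT x:D|lborel. \<phi> x \<bullet> grad \<psi> x) = (LINT x|lborel. grad \<psi> x \<bullet> \<phi> x)"
      by (simp add: set_integral_eq_integral test_field_zero_outside[OF \<phi>] inner_commute)
    also have "\<dots> = 0" using integral_grad_by_parts[OF test_smooth[OF \<psi>] \<phi>] by (simp add: div)
    finally show ?thesis .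
  qed
  ultimately show ?thesis
    using H L2_on_imp_L1_loc[OF L(1)] by (simp add: V_space_def H0_curl_def weakly_div_free_def)
qed

section \<open>Dilation, extension by zero and the rescaled difference\<close>

lemma sq_int_scale:
  assumes h: "L2_on UNIV h" and c: "c \<noteq> 0"
  shows "L2_on UNIV (\<lambda>x. h (c *\<^sub>R x))" "sq_int UNIV (\<lambda>x. h (c *\<^sub>R x)) = (1 / \<bar>c\<bar>^3) * sq_int UNIV h"
proof -
  have m: "h \<in> borel_measurable borel" by (rule L2_measurable[OF h])
  have "(\<lambda>x. h (c *\<^sub>R x)) \<in> borel_measurable borel"
    by (rule measurable_compose[OF _ m]) simp
  then show "L2_on UNIV (\<lambda>x. h (c *\<^sub>R x))"
    using integrable_affine[OF c L2_integrable_norm[OF h], of 0] by (simp add: L2_on_UNIV_iff)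
  show "sq_int UNIV (\<lambda>x. h (c *\<^sub>R x)) = (1 / \<bar>c\<bar>^3) * sq_int UNIV h"
    using integral_affine[OF c, of "\<lambda>x. (norm (h x))\<^sup>2" 0] m
    by (simp add: sq_int_def set_lebesgue_integral_def)
qed

lemma tendsto_L2_scale:
  assumes lim: "tendsto_L2 UNIV f g F" and c: "c \<noteq> 0"
  shows "tendsto_L2 UNIV (\<lambda>n x. f n (c *\<^sub>R x)) (\<lambda>x. g (c *\<^sub>R x)) F"
proof -
  have g: "L2_on UNIV g" and f: "\<forall>\<^sub>F n in F. L2_on UNIV (f n)"
    and 0: "((\<lambda>n. sq_int UNIV (\<lambda>x. f n x - g x)) \<longlongrightarrow> 0) F"
    using lim by (auto simp: tendsto_L2_iff)
  have "((\<lambda>n. (1 / \<bar>c\<bar>^3) * sq_int UNIV (\<lambda>x. f n x - g x)) \<longlongrightarrow> (1 / \<bar>c\<bar>^3) * 0) F"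
    by (intro tendsto_mult tendsto_const 0)
  moreover have "\<forall>\<^sub>F n in F. (1 / \<bar>c\<bar>^3) * sq_int UNIV (\<lambda>x. f n x - g x) = sq_int UNIV (\<lambda>x. f n (c *\<^sub>R x) - g (c *\<^sub>R x))"
    using f by eventually_elim (rule sq_int_scale(2)[OF L2_diff[OF _ g] c, symmetric])
  ultimately have "((\<lambda>n. sq_int UNIV (\<lambda>x. f n (c *\<^sub>R x) - g (c *\<^sub>R x))) \<longlongrightarrow> (1 / \<bar>c\<bar>^3) * 0) F"
    by (rule Lim_transform_eventually)
  then show ?thesis
    unfolding tendsto_L2_iff using f sq_int_scale(1)[OF g c] sq_int_scale(1)[OF _ c]
    by (auto intro: eventually_mono[OF f])
qed

text \<open>Approximants that vanish outside \<open>D\<close> turn convergence on the domain into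
  convergence on the whole space towards the extension by zero.\<close>

lemma tendsto_L2_extend:
  assumes lim: "tendsto_L2 D f g F" and f: "\<And>n x. x \<notin> D \<Longrightarrow> f n x = 0"
  shows "tendsto_L2 UNIV f (\<lambda>x. indicator D x *\<^sub>R g x) F"
proof -
  have f_eq: "f n = (\<lambda>x. indicator D x *\<^sub>R f n x)" for n
    using f by (auto simp: indicator_def fun_eq_iff)
  have "sq_int UNIV (\<lambda>x. f n x - indicator D x *\<^sub>R g x) = sq_int D (\<lambda>x. f n x - g x)" for n
    unfolding sq_int_def set_lebesgue_integral_def
    by (rule Bochner_Integration.integral_cong) (use f in \<open>auto simp: indicator_def\<close>)
  moreover have "L2_on D (f n) \<longleftrightarrow> L2_on UNIV (f n)" for n
    unfolding L2_on_iff_indicator[of D] f_eq[symmetric] ..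
  ultimately show ?thesis using lim by (simp add: tendsto_L2_iff L2_on_iff_indicator[of D g])
qed

lemma tendsto_L2_diff:
  fixes f f' :: "nat \<Rightarrow> vec3 \<Rightarrow> vec3"
  assumes "tendsto_L2 UNIV f g sequentially" "tendsto_L2 UNIV f' g' sequentially"
    and "\<And>n. L2_on UNIV (f n)" "\<And>n. L2_on UNIV (f' n)"
  shows "tendsto_L2 UNIV (\<lambda>n x. f n x - f' n x) (\<lambda>x. g x - g' x) sequentially"
proof -
  have g: "L2_on UNIV g" "L2_on UNIV g'" using assms(1,2) by (auto simp: tendsto_L2_iff)
  have "(\<lambda>n. toL2 (f n)) \<longlonglongrightarrow> toL2 g" "(\<lambda>n. toL2 (f' n)) \<longlonglongrightarrow> toL2 g'"
    using assms g by (auto simp: tendsto_toL2_iff tendsto_L2_def set_lebesgue_integral_def)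
  then have "(\<lambda>n. toL2 (f n) - toL2 (f' n)) \<longlonglongrightarrow> toL2 g - toL2 g'" by (rule tendsto_diff)
  then have "(\<lambda>n. toL2 (\<lambda>x. f n x - f' n x)) \<longlonglongrightarrow> toL2 (\<lambda>x. g x - g' x)"
    using assms(3,4) g by (simp add: toL2_diff)
  then show ?thesis
    using assms(3,4) g
    by (simp add: tendsto_toL2_iff tendsto_L2_def set_lebesgue_integral_def L2_diff)
qed

lemma tendsto_L2_subset:
  assumes "tendsto_L2 UNIV f g F" "C \<in> sets borel"
  shows "tendsto_L2 C f g F"
proof -
  have g: "L2_on UNIV g" and f: "\<forall>\<^sub>F n in F. L2_on UNIV (f n)"
    and 0: "((\<lambda>n. sq_int UNIV (\<lambda>x. f n x - g x)) \<longlongrightarrow> 0) F"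
    using assms by (auto simp: tendsto_L2_iff)
  have "\<forall>\<^sub>F n in F. sq_int C (\<lambda>x. f n x - g x) \<le> sq_int UNIV (\<lambda>x. f n x - g x)"
    using f
  proof eventually_elim
    fix n assume fn: "L2_on UNIV (f n)"
    have d: "L2_on UNIV (\<lambda>x. f n x - g x)" by (rule L2_diff[OF fn g])
    show "sq_int C (\<lambda>x. f n x - g x) \<le> sq_int UNIV (\<lambda>x. f n x - g x)"
      unfolding sq_int_def set_lebesgue_integral_def
      using L2_on_integrable[OF d] L2_on_integrable[OF L2_imp_L2_on[OF d assms(2)]]
      by (intro integral_mono) (auto simp: set_integrable_def indicator_def)
  qed
  then have "((\<lambda>n. sq_int C (\<lambda>x. f n x - g x)) \<longlongrightarrow> 0) F"
    by (rule real_tendsto_sandwich[OF _ _ tendsto_const 0, rotated]) (auto intro: always_eventually)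
  then show ?thesis
    unfolding tendsto_L2_iff using f L2_imp_L2_on[OF g assms(2)] L2_imp_L2_on[OF _ assms(2)]
    by (auto intro: eventually_mono[OF f])
qed

text \<open>Differences of test fields approximating the two regular parts, extended by zero and
  rescaled, approximate \<open>K_star\<close> together with their curls. They are not
  divergence-free, so membership of the limit in \<open>curl_space\<close> is exactly where the
  density theorem enters.\<close>

lemma K_star_weak_curl:
  assumes D: "open D" and \<epsilon>: "\<epsilon> > 0"
    and u: "u \<epsilon> \<in> H_curl D" "u 0 \<in> H_curl D"
    and dec: "regular_decomposition D (u \<epsilon>) (\<phi> \<epsilon>) (us \<epsilon>)" "regular_decomposition D (u 0) (\<phi> 0) (us 0)"
  defines "W \<equiv> \<lambda>x. indicator D (\<epsilon> *\<^sub>R x) *\<^sub>R (weak_curl D (u \<epsilon>) (\<epsilon> *\<^sub>R x) - weak_curl D (u 0) (\<epsilon> *\<^sub>R x))"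
  shows "has_weak_curl UNIV (K_star D us \<epsilon>) W" "L2_on UNIV W" "toL2 W \<in> curl_space"
proof -
  obtain \<psi> where \<psi>: "\<And>n::nat. \<psi> n \<in> test_fields D" "tendsto_L2 D \<psi> (us \<epsilon>) sequentially"
    "tendsto_L2 D (\<lambda>n. curl (\<psi> n)) (weak_curl D (u \<epsilon>)) sequentially"
    using decomposition_approx[OF D u(1) dec(1)] by blast
  obtain \<psi>0 where \<psi>0: "\<And>n::nat. \<psi>0 n \<in> test_fields D" "tendsto_L2 D \<psi>0 (us 0) sequentially"
    "tendsto_L2 D (\<lambda>n. curl (\<psi>0 n)) (weak_curl D (u 0)) sequentially"
    using decomposition_approx[OF D u(2) dec(2)] by blast
  define \<Psi> where "\<Psi> n x = \<psi> n x - \<psi>0 n x" for n x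
  \<comment> \<open>The prefactor \<open>1 / \<epsilon>\<close> compensates the factor \<epsilon>
    produced by differentiating the dilation, so the curl is merely composed with it.\<close>
  define \<Theta> where "\<Theta> n x = (1 / \<epsilon>) *\<^sub>R \<Psi> n (\<epsilon> *\<^sub>R x)" for n x
  have \<Psi>: "\<Psi> n \<in> test_fields UNIV" for n
    unfolding \<Psi>_def[abs_def] using test_fields_mono[OF test_fields_diff[OF \<psi>(1) \<psi>0(1)]] by simp
  have \<Psi>s: "(\<lambda>x. \<Psi> n (\<epsilon> *\<^sub>R x)) \<in> test_fields UNIV" for n
    using test_fields_affine[OF \<Psi>, of \<epsilon> 0 UNIV] \<epsilon> by simp
  have \<Theta>: "\<Theta> n \<in> test_fields UNIV" for n
    unfolding \<Theta>_def[abs_def] by (rule test_fields_scaleR[OF \<Psi>s])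
  have curl_\<Theta>: "curl (\<Theta> n) x = curl (\<psi> n) (\<epsilon> *\<^sub>R x) - curl (\<psi>0 n) (\<epsilon> *\<^sub>R x)" for n x
  proof -
    have "curl (\<Theta> n) x = (1 / \<epsilon>) *\<^sub>R curl (\<lambda>x. \<Psi> n (\<epsilon> *\<^sub>R x)) x"
      unfolding \<Theta>_def[abs_def] by (rule curl_scaleR[OF test_smooth_field[OF \<Psi>s]])
    also have "curl (\<lambda>x. \<Psi> n (\<epsilon> *\<^sub>R x)) x = \<epsilon> *\<^sub>R curl (\<Psi> n) (\<epsilon> *\<^sub>R x)"
      using curl_affine[OF test_smooth_field[OF \<Psi>], of n 0 \<epsilon> x] by simp
    also have "curl (\<Psi> n) (\<epsilon> *\<^sub>R x) = curl (\<psi> n) (\<epsilon> *\<^sub>R x) - curl (\<psi>0 n) (\<epsilon> *\<^sub>R x)"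
      unfolding \<Psi>_def[abs_def] by (rule curl_diff[OF test_smooth_field[OF \<psi>(1)] test_smooth_field[OF \<psi>0(1)]])
    finally show ?thesis using \<epsilon> by simp
  qed
  have lim_\<Psi>: "tendsto_L2 UNIV \<Psi> (\<lambda>x. indicator D x *\<^sub>R us \<epsilon> x - indicator D x *\<^sub>R us 0 x) sequentially"
    unfolding \<Psi>_def[abs_def]
    by (intro tendsto_L2_diff tendsto_L2_extend \<psi>(2) \<psi>0(2) test_field_zero_outside[OF \<psi>(1)]
        test_field_zero_outside[OF \<psi>0(1)] test_field_L2[OF \<psi>(1)] test_field_L2[OF \<psi>0(1)])
  have lim_curl: "tendsto_L2 UNIV (\<lambda>n x. curl (\<psi> n) x - curl (\<psi>0 n) x)
      (\<lambda>x. indicator D x *\<^sub>R weak_curl D (u \<epsilon>) x - indicator D x *\<^sub>R weak_curl D (u 0) x) sequentially"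
    by (intro tendsto_L2_diff tendsto_L2_extend \<psi>(3) \<psi>0(3) test_field_zero_outside[OF curl_test_field[OF \<psi>(1)]]
        test_field_zero_outside[OF curl_test_field[OF \<psi>0(1)]] curl_L2[OF \<psi>(1)] curl_L2[OF \<psi>0(1)])
  have \<epsilon>0: "\<epsilon> \<noteq> 0" using \<epsilon> by simp
  have lim_W: "tendsto_L2 UNIV (\<lambda>n. curl (\<Theta> n)) W sequentially"
    using tendsto_L2_scale[OF lim_curl \<epsilon>0] unfolding curl_\<Theta>[abs_def] W_def by (simp add: scaleR_diff_right)
  have K_eq: "K_star D us \<epsilon> = (\<lambda>x. (1 / \<epsilon>) *\<^sub>R (indicator D (\<epsilon> *\<^sub>R x) *\<^sub>R us \<epsilon> (\<epsilon> *\<^sub>R x) - indicator D (\<epsilon> *\<^sub>R x) *\<^sub>R us 0 (\<epsilon> *\<^sub>R x)))"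
    by (auto simp: K_star_def extend_by_zero_def indicator_def fun_eq_iff)
  have lim_K: "tendsto_L2 UNIV \<Theta> (K_star D us \<epsilon>) sequentially"
    unfolding tendsto_L2_iff
  proof (intro conjI)
    note s = tendsto_L2_scale[OF lim_\<Psi> \<epsilon>0, unfolded tendsto_L2_iff]
    show "\<forall>\<^sub>F n in sequentially. L2_on UNIV (\<Theta> n)" using test_field_L2[OF \<Theta>] by simp
    show "L2_on UNIV (K_star D us \<epsilon>)" unfolding K_eq by (rule L2_scaleR) (use s in blast)
    have "sq_int UNIV (\<lambda>x. \<Theta> n x - K_star D us \<epsilon> x) = (1 / \<epsilon>)\<^sup>2 * sq_int UNIV (\<lambda>x. \<Psi> n (\<epsilon> *\<^sub>R x) -
        (indicator D (\<epsilon> *\<^sub>R x) *\<^sub>R us \<epsilon> (\<epsilon> *\<^sub>R x) - indicator D (\<epsilon> *\<^sub>R x) *\<^sub>R us 0 (\<epsilon> *\<^sub>R x)))" for n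
      unfolding K_eq \<Theta>_def scaleR_diff_right[symmetric]
      by (simp add: sq_int_def set_lebesgue_integral_def power_mult_distrib power_divide)
    then show "(\<lambda>n. sq_int UNIV (\<lambda>x. \<Theta> n x - K_star D us \<epsilon> x)) \<longlonglongrightarrow> 0"
      using tendsto_mult[OF tendsto_const[of "(1 / \<epsilon>)\<^sup>2"] s[THEN conjunct2, THEN conjunct2]] by simp
  qed
  show LW: "L2_on UNIV W" using lim_W by (simp add: tendsto_L2_iff)
  have cl: "(\<lambda>n. curl_class (\<Theta> n)) \<longlonglongrightarrow> toL2 W"
    using lim_W curl_L2[OF \<Theta>] LW
    by (simp add: curl_class_def tendsto_toL2_iff tendsto_L2_def set_lebesgue_integral_def)
  then have "toL2 W \<in> closure (curl_class ` test_fields UNIV)"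
    unfolding closure_sequential using \<Theta> by (intro exI[of _ "\<lambda>n. curl_class (\<Theta> n)"]) auto
  then show "toL2 W \<in> curl_space" by (rule curl_class_in_curl_space)
  show "has_weak_curl UNIV (K_star D us \<epsilon>) W"
  proof (rule weak_curl_of_limit[OF \<Theta> _ _ LW cl, where c = "\<lambda>_. 0"])
    show "L1_loc UNIV (K_star D us \<epsilon>)"
      using lim_K by (intro L2_on_imp_L1_loc) (simp add: tendsto_L2_iff)
    show "tendsto_L2 C (\<lambda>n x. \<Theta> n x + 0) (K_star D us \<epsilon>) sequentially" if "compact C" for C
      using tendsto_L2_subset[OF lim_K borel_compact[OF that]] by simp
  qed
qed

section \<open>The perturbed state equation and convergence\<close>

context two_phase_law
begin

text \<open>Boundedness of \<open>D\<close> makes the values of the law at 0 square integrable; the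
  Lipschitz bound handles the rest.\<close>

lemma A_L2_on:
  assumes D: "open D" "bounded D" and S: "S \<in> sets borel" and w: "L2_on D w"
  shows "L2_on D (\<lambda>x. A S x (w x))"
proof -
  have DB: "D \<in> sets borel" using D by simp
  let ?w = "\<lambda>x. indicator D x *\<^sub>R w x"
  have w': "L2_on UNIV ?w" using w by (simp add: L2_on_iff_indicator[of D])
  define M where "M = norm (a1 0) + norm (a2 0)"
  have "L2_on (closure D) (\<lambda>x. M)" using D by (intro L2_on_const) (simp add: compact_closure)
  then have "L2_on D (\<lambda>x. M)" by (rule L2_on_subset) (use DB closure_subset in auto)
  then have M: "L2_on UNIV (\<lambda>x. indicator D x *\<^sub>R M)" by (simp add: L2_on_iff_indicator[of D])
  have "L2_on UNIV (\<lambda>x. indicator D x *\<^sub>R A S x 0)"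
  proof (rule L2_dominated[OF M, of _ 1])
    show "(\<lambda>x. indicator D x *\<^sub>R A S x 0) \<in> borel_measurable borel"
      by (intro borel_measurable_scaleR borel_measurable_indicator DB A_measurable S) simp
    show "norm (indicator D x *\<^sub>R A S x 0) \<le> 1 * norm (indicator D x *\<^sub>R M)" for x
      by (auto simp: indicator_def two_phase_def M_def)
  qed
  then have "L2_on D (\<lambda>x. A S x 0)" by (simp add: L2_on_iff_indicator[of D])
  moreover have "L2_on D (\<lambda>x. A S x (?w x + 0) - A S x 0)"
    by (rule L2_imp_L2_on[OF A_diff_L2[OF S w'] DB])
  ultimately have "L2_on D (\<lambda>x. (A S x (?w x + 0) - A S x 0) + A S x 0)" by (rule L2_on_add[rotated])
  then have "L2_on D (\<lambda>x. A S x (?w x))" by simp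
  moreover have "indicator D x *\<^sub>R A S x (?w x) = indicator D x *\<^sub>R A S x (w x)" for x
    by (simp add: indicator_def)
  ultimately show ?thesis unfolding L2_on_iff_indicator[of D] by (simp only:)
qed

lemma state_difference:
  assumes D: "open D" "bounded D" and S: "S1 \<in> sets borel" "S2 \<in> sets borel"
    and u1: "state_solution a1 a2 D \<Omega>1 \<Omega>2 J M S1 u1" and u2: "state_solution a1 a2 D \<Omega>1 \<Omega>2 J M S2 u2"
    and v: "v \<in> V_space D"
  shows "(LINT x:D|lborel. (A S1 x (weak_curl D u1 x) - A S2 x (weak_curl D u2 x)) \<bullet> weak_curl D v x) = 0"
proof -
  have V: "u1 \<in> V_space D" "u2 \<in> V_space D" using u1 u2 by (auto simp: state_solution_def)
  note L = H_curl_weak_curl(3)[OF D(1) V_space_H_curl]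
  have "(LINT x:D|lborel. A S1 x (weak_curl D u1 x) \<bullet> weak_curl D v x)
      = (LINT x:D|lborel. A S2 x (weak_curl D u2 x) \<bullet> weak_curl D v x)"
    using u1 u2 v by (simp add: state_solution_def)
  then show ?thesis
    using set_integral_diff_inner[OF A_L2_on[OF D S(1) L[OF V(1)]] A_L2_on[OF D S(2) L[OF V(2)]] L[OF v]] by simp
qed

text \<open>The state equations for both inclusions have the same right-hand side and are
  subtracted, tested with a field whose rescaled curl is \<open>W - curl f\<close>, and transformed
  to the variable \<open>x / \<epsilon>\<close>. There the change of the material law becomes the
  jump term on \<omega>.\<close>

lemma perturbed_equation:
  assumes D: "open D" "bounded D" and \<Omega>: "open \<Omega>" and \<omega>: "open \<omega>"
    and \<epsilon>: "\<epsilon> > 0" and disj: "\<And>x. x \<in> \<omega> \<Longrightarrow> \<epsilon> *\<^sub>R x \<notin> \<Omega>"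
    and ue: "state_solution a1 a2 D \<Omega>1 \<Omega>2 J M (perturbed_set \<Omega> 0 \<omega> \<epsilon>) (u \<epsilon>)"
    and u0: "state_solution a1 a2 D \<Omega>1 \<Omega>2 J M \<Omega> (u 0)"
    and f: "f \<in> div_free_test_fields" "(\<lambda>x. \<epsilon> *\<^sub>R f ((1 / \<epsilon>) *\<^sub>R x)) \<in> test_fields D"
  defines "W \<equiv> \<lambda>x. indicator D (\<epsilon> *\<^sub>R x) *\<^sub>R (weak_curl D (u \<epsilon>) (\<epsilon> *\<^sub>R x) - weak_curl D (u 0) (\<epsilon> *\<^sub>R x))"
    and "g \<equiv> \<lambda>x. indicator D (\<epsilon> *\<^sub>R x) *\<^sub>R weak_curl D (u 0) (\<epsilon> *\<^sub>R x)"
    and "S \<equiv> {x. \<epsilon> *\<^sub>R x \<in> \<Omega>} \<union> \<omega>"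
  shows "(LINT x|lborel. (A S x (W x + g x) - A S x (g x) + indicator \<omega> x *\<^sub>R (a1 (g x) - a2 (g x)))
      \<bullet> (W x - curl f x)) = 0"
proof -
  have DB: "D \<in> sets borel" using D by simp
  let ?f = "\<lambda>x. \<epsilon> *\<^sub>R f ((1 / \<epsilon>) *\<^sub>R x)" and ?S = "perturbed_set \<Omega> 0 \<omega> \<epsilon>"
  let ?wu = "weak_curl D (u \<epsilon>)" and ?w0 = "weak_curl D (u 0)"
  have V: "u \<epsilon> \<in> V_space D" "u 0 \<in> V_space D" using ue u0 by (auto simp: state_solution_def)
  note sf = test_smooth_field[OF div_freeD[OF f(1)]]
  have sfs: "smooth_field (\<lambda>x. f ((1 / \<epsilon>) *\<^sub>R x))"
    using sf smooth_affine[of _ 0 "1 / \<epsilon>"] by (auto simp: smooth_field_def)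
  have curl_f: "curl ?f x = curl f ((1 / \<epsilon>) *\<^sub>R x)" for x
    using curl_scaleR[OF sfs, of \<epsilon> x] curl_affine[OF sf, of 0 "1 / \<epsilon>" x] \<epsilon> by simp
  have div_f: "divergence ?f x = 0" for x
  proof -
    have "divergence (\<lambda>x. f ((1 / \<epsilon>) *\<^sub>R x)) x = (1 / \<epsilon>) * divergence f ((1 / \<epsilon>) *\<^sub>R x)"
      unfolding divergence_3
      using partial_affine[OF smooth_differentiable[OF smooth_fieldD[OF sf]], where a = 0 and c = "1 / \<epsilon>" and x = x]
      by (simp add: distrib_left)
    then show ?thesis using divergence_scaleR[OF sfs, of \<epsilon> x] div_free_divergence[OF f(1)] by simp
  qed
  have Vf: "?f \<in> V_space D" by (rule div_free_in_V_space[OF D(1) f(2) div_f])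
  \<comment> \<open>The regular parts have the same curls as the states, but it is the states that
    lie in \<open>V_space D\<close>. The test field is therefore built from them.\<close>
  let ?v = "\<lambda>x. (u \<epsilon> x - u 0 x) - ?f x"
  have Vd: "(\<lambda>x. u \<epsilon> x - u 0 x) \<in> V_space D" by (rule V_space_diff[OF D(1) V])
  have Vv: "?v \<in> V_space D" by (rule V_space_diff[OF D(1) Vd Vf])
  have wv: "AE x in lborel. x \<in> D \<longrightarrow> weak_curl D ?v x = ?wu x - ?w0 x - curl ?f x"
    using weak_curl_AE[OF D(1) has_weak_curl_diff[OF D(1) V_space_H_curl[OF Vd] V_space_H_curl[OF Vf]]]
      weak_curl_AE[OF D(1) has_weak_curl_diff[OF D(1) V_space_H_curl[OF V(1)] V_space_H_curl[OF V(2)]]]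
      weak_curl_AE[OF D(1) test_field_has_weak_curl[OF D(1) f(2)]]
    by eventually_elim simp
  have SB: "?S \<in> sets borel" "\<Omega> \<in> sets borel"
  proof -
    have "open (scaled_inclusion 0 \<omega> \<epsilon>)"
      using open_scaling[of \<epsilon> \<omega>] \<omega> \<epsilon> by (simp add: scaled_inclusion_def)
    then show "?S \<in> sets borel" "\<Omega> \<in> sets borel" using \<Omega> by (auto simp: perturbed_set_def)
  qed
  note L = H_curl_weak_curl(3)[OF D(1) V_space_H_curl]
  have Lflux: "L2_on D (\<lambda>x. A ?S x (?wu x) - A \<Omega> x (?w0 x))"
    by (rule L2_on_diff[OF A_L2_on[OF D SB(1) L[OF V(1)]] A_L2_on[OF D SB(2) L[OF V(2)]]])
  have Lv: "L2_on D (\<lambda>x. ?wu x - ?w0 x - curl ?f x)"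
    by (intro L2_on_diff L V L2_on_test_field[OF curl_test_field[OF f(2)] DB])
  define H where "H x = indicator D x *\<^sub>R ((?wu x - ?w0 x - curl ?f x) \<bullet> (A ?S x (?wu x) - A \<Omega> x (?w0 x)))" for x
  have "(LINT x:D|lborel. (?wu x - ?w0 x - curl ?f x) \<bullet> (A ?S x (?wu x) - A \<Omega> x (?w0 x)))
      = (LINT x:D|lborel. weak_curl D ?v x \<bullet> (A ?S x (?wu x) - A \<Omega> x (?w0 x)))"
    by (rule set_integral_inner_cong_AE[OF Lv L[OF Vv] Lflux]) (use wv in \<open>eventually_elim, simp\<close>)
  also have "\<dots> = 0"
    using state_difference[OF D SB ue u0 Vv] by (simp add: inner_commute)
  finally have H0: "(LINT x|lborel. H x) = 0" by (simp add: H_def set_lebesgue_integral_def)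
  have "H \<in> borel_measurable borel"
    using L2_on_inner_integrable[OF Lv Lflux] unfolding H_def set_integrable_def by auto
  \<comment> \<open>The Jacobian factor \<open>1 / \<epsilon>^3\<close> multiplies an integral that
    is zero.\<close>
  from integral_affine[OF _ this, of \<epsilon> 0] \<epsilon> H0 have "(LINT x|lborel. H (\<epsilon> *\<^sub>R x)) = 0" by simp
  moreover have "H (\<epsilon> *\<^sub>R x) = (A S x (W x + g x) - A S x (g x) + indicator \<omega> x *\<^sub>R (a1 (g x) - a2 (g x)))
      \<bullet> (W x - curl f x)" for x
  proof (cases "\<epsilon> *\<^sub>R x \<in> D")
    case True
    have "\<epsilon> *\<^sub>R x \<in> scaled_inclusion 0 \<omega> \<epsilon> \<longleftrightarrow> x \<in> \<omega>"
      using \<epsilon> by (auto simp: scaled_inclusion_def)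
    then have mem: "\<epsilon> *\<^sub>R x \<in> ?S \<longleftrightarrow> x \<in> S"
      using \<epsilon> by (simp add: perturbed_set_def S_def)
    have Wg: "W x + g x = ?wu (\<epsilon> *\<^sub>R x)" "g x = ?w0 (\<epsilon> *\<^sub>R x)" "W x = ?wu (\<epsilon> *\<^sub>R x) - ?w0 (\<epsilon> *\<^sub>R x)"
      using True by (auto simp: W_def g_def)
    \<comment> \<open>On \<omega> the rescaled point avoids \<Omega>, so the unperturbed law is
      \<open>a2\<close> while \<open>S\<close> prescribes \<open>a1\<close>; elsewhere the two laws
      agree.\<close>
    have "A \<Omega> (\<epsilon> *\<^sub>R x) y = A S x y - indicator \<omega> x *\<^sub>R (a1 y - a2 y)" for y
      using disj[of x] by (auto simp: two_phase_def S_def)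
    moreover have "A ?S (\<epsilon> *\<^sub>R x) y = A S x y" for y
      using mem by (simp add: two_phase_def)
    moreover have "curl ?f (\<epsilon> *\<^sub>R x) = curl f x" using curl_f[of "\<epsilon> *\<^sub>R x"] \<epsilon> by simp
    ultimately show ?thesis using True \<epsilon>
      by (simp add: H_def Wg inner_commute diff_diff_eq2 diff_add_eq)
  next
    case False
    then have "curl ?f (\<epsilon> *\<^sub>R x) = 0" by (rule test_field_zero_outside[OF curl_test_field[OF f(2)]])
    then have "curl f x = 0" using curl_f[of "\<epsilon> *\<^sub>R x"] \<epsilon> by simp
    then show ?thesis using False by (simp add: H_def W_def)
  qed
  ultimately show ?thesis by simp
qed

end

text \<open>Concentrating the field near the origin brings its support into the domain. The factor
  \<epsilon> in front keeps the size of the curl unchanged.\<close>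

lemma scaled_test_field:
  assumes f: "f \<in> test_fields UNIV" and \<epsilon>: "\<epsilon> > 0"
    and supp: "\<And>x. x \<notin> cball 0 r \<Longrightarrow> f x = 0" and D: "cball 0 (\<epsilon> * r) \<subseteq> D"
  shows "(\<lambda>x. \<epsilon> *\<^sub>R f ((1 / \<epsilon>) *\<^sub>R x)) \<in> test_fields D"
proof -
  have "(\<lambda>x. f x $ i) \<in> test_functions (cball 0 r)" for i
    by (rule test_functionsI[OF smooth_fieldD[OF test_smooth_field[OF f]] compact_cball order_refl])
       (simp add: supp)
  then have "f \<in> test_fields (cball 0 r)" by (simp add: test_fields_iff)
  then have "(\<lambda>x. f (0 + (1 / \<epsilon>) *\<^sub>R x)) \<in> test_fields D"
  proof (rule test_fields_affine)
    show "1 / \<epsilon> \<noteq> 0" using \<epsilon> by simp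
    fix x :: vec3 assume "0 + (1 / \<epsilon>) *\<^sub>R x \<in> cball 0 r"
    then have "norm x \<le> \<epsilon> * r" using \<epsilon> by (simp add: field_simps)
    then show "x \<in> D" using D by auto
  qed
  from test_fields_scaleR[OF this, of \<epsilon>] show ?thesis by simp
qed

theorem theorem1:
  fixes D \<Omega> \<omega> \<Omega>1 \<Omega>2 :: "(real^3) set"
    and z U0 :: "real^3"
    and a1 a2 J M :: "real^3 \<Rightarrow> real^3"
    and a1' a2' :: "real^3 \<Rightarrow> ((real^3) \<Rightarrow>\<^sub>L (real^3))"
    and c1 c2 c3 \<alpha> \<delta> :: real
    and u us :: "real \<Rightarrow> real^3 \<Rightarrow> real^3"
    and \<phi> :: "real \<Rightarrow> real^3 \<Rightarrow> real"
    and w0 :: "real^3 \<Rightarrow> real^3"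
  assumes D: "lipschitz_domain D" "bounded D" "simply_connected D"
    and \<Omega>: "open \<Omega>" "compact (closure \<Omega>)" "closure \<Omega> \<subseteq> D"
    and z: "z = 0" "z \<in> D - closure \<Omega>"
    and \<omega>: "open \<omega>" "bounded \<omega>" "0 \<in> \<omega>"
    and c: "c1 > 0" "c2 > 0" "c3 > 0"
    and a1_C1: "\<forall>x. (a1 has_derivative blinfun_apply (a1' x)) (at x)" "continuous_on UNIV a1'"
    and a2_C1: "\<forall>x. (a2 has_derivative blinfun_apply (a2' x)) (at x)" "continuous_on UNIV a2'"
    and a1_monotone: "\<forall>x y. (a1 x - a1 y) \<bullet> (x - y) \<ge> c1 * (norm (x - y))\<^sup>2"
    and a2_monotone: "\<forall>x y. (a2 x - a2 y) \<bullet> (x - y) \<ge> c1 * (norm (x - y))\<^sup>2"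
    and a1_lipschitz: "\<forall>x y. norm (a1 x - a1 y) \<le> c2 * norm (x - y)"
    and a2_lipschitz: "\<forall>x y. norm (a2 x - a2 y) \<le> c2 * norm (x - y)"
    and a1'_lipschitz: "\<forall>x y. norm (a1' x - a1' y) \<le> c3 * norm (x - y)"
    and a2'_lipschitz: "\<forall>x y. norm (a2' x - a2' y) \<le> c3 * norm (x - y)"
    and sources: "open \<Omega>1" "\<Omega>1 \<subseteq> D" "open \<Omega>2" "\<Omega>2 \<subseteq> D" "L2_on D J" "L2_on D M"
    and state: "\<forall>\<epsilon>\<in>admissible D z \<omega>.
      state_solution a1 a2 D \<Omega>1 \<Omega>2 J M (perturbed_set \<Omega> z \<omega> \<epsilon>) (u \<epsilon>)"
    and decomposition: "\<forall>\<epsilon>\<in>admissible D z \<omega>. regular_decomposition D (u \<epsilon>) (\<phi> \<epsilon>) (us \<epsilon>)"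
    and holder: "\<delta> > 0" "cball z \<delta> \<subseteq> D" "0 < \<alpha>" "\<alpha> < 1" "holder_on \<alpha> (cball z \<delta>) w0"
      "AE x in lborel. x \<in> cball z \<delta> \<longrightarrow> weak_curl D (u 0) x = w0 x"
    and U0: "U0 = w0 z"
  shows "(\<exists>!X. X \<in> BLC_dot \<and> (\<forall>K\<in>X. corrector_equation a1 a2 \<omega> U0 K)) \<and>
    (\<forall>X\<in>BLC_dot. (\<forall>K\<in>X. corrector_equation a1 a2 \<omega> U0 K) \<longrightarrow>
       (\<forall>K\<in>X. tendsto_L2 UNIV (\<lambda>\<epsilon>. weak_curl UNIV (K_star D us \<epsilon>)) (weak_curl UNIV K) (at_right 0)))"
proof -
  interpret two_phase_law a1 a2 c1 c2
    by unfold_locales (use c a1_monotone a2_monotone a1_lipschitz a2_lipschitz in auto)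
  have openD: "open D" using D(1) by (simp add: lipschitz_domain_def)
  have adm0: "0 \<in> admissible D z \<omega>" by (simp add: admissible_def)
  have st0: "state_solution a1 a2 D \<Omega>1 \<Omega>2 J M \<Omega> (u 0)"
    using state adm0 by (auto simp: perturbed_set_def)
  obtain C where C: "\<And>x y. x \<in> cball 0 \<delta> \<Longrightarrow> y \<in> cball 0 \<delta> \<Longrightarrow> norm (w0 x - w0 y) \<le> C * norm (x - y) powr \<alpha>"
    using holder(5) unfolding holder_on_def z(1) by blast
  have "0 \<in> - closure \<Omega>" "open (- closure \<Omega>)" using z by auto
  \<comment> \<open>Within this radius the rescaled inclusion cannot meet \<Omega>.\<close>
  then obtain \<rho> where \<rho>: "\<rho> > 0" "cball 0 \<rho> \<subseteq> - closure \<Omega>"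
    using open_contains_cball by blast
  have conv: "tendsto_L2 UNIV (\<lambda>\<epsilon>. weak_curl UNIV (K_star D us \<epsilon>)) (weak_curl UNIV K) (at_right 0)"
    if K: "K \<in> BLC" and eq: "corrector_equation a1 a2 \<omega> U0 K" for K
  proof -
    define w where "w = weak_curl UNIV K"
    note Kw = BLC_weak_curl[OF K, folded w_def]
    define Wt where "Wt \<epsilon> = weak_curl UNIV (K_star D us \<epsilon>)" for \<epsilon>
    have key: "\<forall>\<^sub>F \<epsilon> in at_right 0. L2_on UNIV (Wt \<epsilon>) \<and> sqrt (sq_int UNIV (\<lambda>x. Wt \<epsilon> x - w x)) < e"
      if e: "e > 0" for e
    proof -
      \<comment> \<open>The bound \<open>e / 2\<close> serves the final triangle inequality; the
        other makes the first error term in the estimate at most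
        \<open>c1^2 e^2 / 32\<close>.\<close>
      define \<tau> where "\<tau> = min (e / 2) (c1 * e / (8 * c2))"
      have \<tau>: "\<tau> > 0" using e c by (simp add: \<tau>_def)
      obtain f where f: "f \<in> div_free_test_fields" "norm (curl_class f - toL2 w) < \<tau>"
      proof -
        obtain y where "y \<in> curl_class ` div_free_test_fields" "dist y (toL2 w) < \<tau>"
          using Kw(3) \<tau> unfolding curl_space_def closure_approachable by blast
        then show ?thesis using that by (auto simp: dist_norm)
      qed
      note tf = div_freeD[OF f(1)]
      obtain Cs where Cs: "compact Cs" "\<forall>x. x \<notin> Cs \<longrightarrow> f x = 0 \<and> curl f x = 0"
        using test_fields_support[OF tf] by metis
      have "bounded (Cs \<union> \<omega>)" using compact_imp_bounded[OF Cs(1)] \<omega>(2) by simp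
      \<comment> \<open>One ball, fixed before \<epsilon>, contains the inclusion and the support of
        \<open>f\<close>.\<close>
      then obtain r where r: "r > 0" "Cs \<union> \<omega> \<subseteq> cball 0 r"
        unfolding bounded_pos by (auto simp: subset_eq)
      have f0: "f x = 0" "curl f x = 0" if "x \<notin> cball 0 r" for x using that r Cs(2) by blast+
      define V where "V = measure lborel (cball (0::vec3) r)"
      have V: "V \<ge> 0" by (simp add: V_def)
      \<comment> \<open>Chosen so that the second error term is \<open>c1^2 e^2 / 32\<close> times
        \<open>V / (V + 1)^2\<close>; the summand 1 guarantees that this quotient is at most 1 and
        the denominator positive.\<close>
      define \<eta> where "\<eta> = c1 * e / (32 * c2 * (V + 1))"
      have \<eta>: "\<eta> > 0" using e c V by (simp add: \<eta>_def)
      \<comment> \<open>The last entry solves the Holder bound for \<eta>. The Holder constant has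
        no known sign, whence \<open>\<bar>C\<bar> + 1\<close>.\<close>
      define s where "s = min (min \<delta> \<rho>) ((\<eta> / (\<bar>C\<bar> + 1)) powr (1 / \<alpha>))"
      have s: "s > 0" "s \<le> \<delta>" "s \<le> \<rho>" using holder(1) \<rho>(1) \<eta> by (auto simp: s_def)
      have Cs_\<eta>: "\<bar>C\<bar> * s powr \<alpha> \<le> \<eta>"
      proof -
        have "s powr \<alpha> \<le> ((\<eta> / (\<bar>C\<bar> + 1)) powr (1 / \<alpha>)) powr \<alpha>"
          using s(1) holder(3) by (intro powr_mono2) (auto simp: s_def)
        also have "\<dots> = \<eta> / (\<bar>C\<bar> + 1)" using holder(3) \<eta> by (simp add: powr_powr)
        finally have "\<bar>C\<bar> * s powr \<alpha> \<le> \<bar>C\<bar> * (\<eta> / (\<bar>C\<bar> + 1))" by (rule mult_left_mono) simp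
        also have "\<dots> \<le> \<eta>" using \<eta> by (simp add: field_simps)
        finally show ?thesis .
      qed
      \<comment> \<open>For these \<epsilon> the dilation maps the ball of radius \<open>r\<close>
        into the ball of radius \<open>s\<close>, inside the region of Holder continuity and away
        from \<Omega>.\<close>
      have small: "L2_on UNIV (Wt \<epsilon>) \<and> sqrt (sq_int UNIV (\<lambda>x. Wt \<epsilon> x - w x)) < e"
        if \<epsilon>: "0 < \<epsilon>" "\<epsilon> < s / r" for \<epsilon>
      proof -
        have \<epsilon>r: "\<epsilon> * r \<le> s" using \<epsilon> r(1) by (simp add: field_simps)
        have scale: "norm (\<epsilon> *\<^sub>R x) \<le> s" if "x \<in> cball 0 r" for x
        proof -
          have "\<epsilon> * norm x \<le> \<epsilon> * r" using that \<epsilon> by (intro mult_left_mono) auto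
          with \<epsilon>r have "\<epsilon> * norm x \<le> s" by linarith
          then show ?thesis using \<epsilon> by simp
        qed
        have scale_D: "\<epsilon> *\<^sub>R x \<in> D" "\<epsilon> *\<^sub>R x \<in> cball 0 \<delta>" "\<epsilon> *\<^sub>R x \<notin> \<Omega>" if "x \<in> cball 0 r" for x
        proof -
          show *: "\<epsilon> *\<^sub>R x \<in> cball 0 \<delta>" using scale[OF that] s(2) by simp
          then show "\<epsilon> *\<^sub>R x \<in> D" using holder(2) z(1) by blast
          have "\<epsilon> *\<^sub>R x \<in> cball 0 \<rho>" using scale[OF that] s(3) by simp
          then show "\<epsilon> *\<^sub>R x \<notin> \<Omega>" using \<rho>(2) closure_subset by blast
        qed
        have adm: "\<epsilon> \<in> admissible D z \<omega>"
          using \<epsilon>(1) scale_D(1) r(2) z(1) by (auto simp: admissible_def scaled_inclusion_def)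
        have ste: "state_solution a1 a2 D \<Omega>1 \<Omega>2 J M (perturbed_set \<Omega> 0 \<omega> \<epsilon>) (u \<epsilon>)"
          using state adm z(1) by blast
        have Vu: "u \<epsilon> \<in> V_space D" "u 0 \<in> V_space D" using ste st0 by (auto simp: state_solution_def)
        define W where "W x = indicator D (\<epsilon> *\<^sub>R x) *\<^sub>R (weak_curl D (u \<epsilon>) (\<epsilon> *\<^sub>R x) - weak_curl D (u 0) (\<epsilon> *\<^sub>R x))" for x
        define g where "g x = indicator D (\<epsilon> *\<^sub>R x) *\<^sub>R weak_curl D (u 0) (\<epsilon> *\<^sub>R x)" for x
        define S where "S = {x. \<epsilon> *\<^sub>R x \<in> \<Omega>} \<union> \<omega>"
        have dec: "regular_decomposition D (u \<epsilon>) (\<phi> \<epsilon>) (us \<epsilon>)" "regular_decomposition D (u 0) (\<phi> 0) (us 0)"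
          using decomposition adm adm0 by auto
        note KW = K_star_weak_curl[OF openD \<epsilon>(1) V_space_H_curl[OF Vu(1)] V_space_H_curl[OF Vu(2)] dec,
            folded W_def[abs_def]]
        have \<epsilon>0: "\<epsilon> \<noteq> 0" using \<epsilon> by simp
        have Lg: "L2_on UNIV g"
          unfolding g_def[abs_def]
          by (rule sq_int_scale(1)[OF _ \<epsilon>0, of "\<lambda>x. indicator D x *\<^sub>R weak_curl D (u 0) x"])
             (use H_curl_weak_curl(3)[OF openD V_space_H_curl[OF Vu(2)]] in \<open>simp add: L2_on_iff_indicator[of D]\<close>)
        have SB: "S \<in> sets borel"
        proof -
          have "open {x. \<epsilon> *\<^sub>R x \<in> \<Omega>}"
            using open_vimage[OF \<Omega>(1), of "\<lambda>x. \<epsilon> *\<^sub>R x"] by (simp add: vimage_def continuous_intros)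
          then show ?thesis using \<omega>(1) by (simp add: S_def)
        qed
        have "cball 0 (\<epsilon> * r) \<subseteq> D" using \<epsilon>r s(2) holder(2) z(1) by (force simp: subset_eq)
        note ft = scaled_test_field[OF tf \<epsilon>(1) f0(1) this]
        have disj: "\<epsilon> *\<^sub>R x \<notin> \<Omega>" if "x \<in> \<omega>" for x using scale_D(3) that r(2) by blast
        have pert: "(LINT x|lborel. (A S x (W x + g x) - A S x (g x) + indicator \<omega> x *\<^sub>R (a1 (g x) - a2 (g x)))
            \<bullet> (W x - curl f x)) = 0"
          unfolding W_def g_def S_def
          by (rule perturbed_equation[OF openD D(2) \<Omega>(1) \<omega>(1) \<epsilon>(1) disj ste st0 f(1) ft])
        \<comment> \<open>The weak curl of \<open>u 0\<close> is only almost everywhere equal to its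
          Holder continuous version \<open>w0\<close>; the exceptional set is pulled back along the
          dilation.\<close>
        have near: "AE x in lborel. x \<in> cball 0 r \<longrightarrow> norm (g x - U0) \<le> \<eta>"
          using AE_affine[OF \<epsilon>0 holder(6), of 0]
        proof eventually_elim
          fix x assume *: "0 + \<epsilon> *\<^sub>R x \<in> cball z \<delta> \<longrightarrow> weak_curl D (u 0) (0 + \<epsilon> *\<^sub>R x) = w0 (0 + \<epsilon> *\<^sub>R x)"
          show "x \<in> cball 0 r \<longrightarrow> norm (g x - U0) \<le> \<eta>"
          proof
            assume x: "x \<in> cball 0 r"
            have "norm (g x - U0) = norm (w0 (\<epsilon> *\<^sub>R x) - w0 0)"
              using * scale_D(1,2)[OF x] by (simp add: g_def U0 z(1))
            also have "\<dots> \<le> C * norm (\<epsilon> *\<^sub>R x - 0) powr \<alpha>"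
              by (rule C[OF scale_D(2)[OF x]]) (use holder(1) in simp)
            also have "\<dots> \<le> \<bar>C\<bar> * norm (\<epsilon> *\<^sub>R x) powr \<alpha>" by (simp add: mult_right_mono)
            also have "\<dots> \<le> \<bar>C\<bar> * s powr \<alpha>"
              using scale[OF x] holder(3) by (intro mult_left_mono powr_mono2) auto
            also have "\<dots> \<le> \<eta>" by (rule Cs_\<eta>)
            finally show "norm (g x - U0) \<le> \<eta>" .
          qed
        qed
        have fc: "curl_class f \<in> curl_space"
          unfolding curl_space_def by (rule subsetD[OF closure_subset imageI[OF f(1)]])
        have "toL2 W - toL2 (curl f) \<in> curl_space"
          using subspace_diff[OF subspace_curl_space KW(3) fc] by (simp add: curl_class_def)
        then have limit: "toL2 (flux \<omega> U0 w) \<bullet> (toL2 W - toL2 (curl f)) = 0"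
          using eq corrector_equation_iff[OF \<omega>(1,2) K] unfolding w_def by blast
        have S_\<omega>: "x \<in> S \<longleftrightarrow> x \<in> \<omega>" if "x \<in> cball 0 r" for x
          using scale_D(3)[OF that] by (simp add: S_def)
        have "\<omega> \<subseteq> cball 0 r" using r(2) by blast
        note est = corrector_estimate[OF \<omega>(1,2) SB KW(2) Lg curl_L2[OF tf] Kw(1) this f0(2) S_\<omega> near pert limit,
            folded V_def]
        have "2 * c2\<^sup>2 * (norm (toL2 w - toL2 (curl f)))\<^sup>2 \<le> c1\<^sup>2 * e\<^sup>2 / 32"
        proof -
          have "norm (toL2 w - toL2 (curl f)) \<le> c1 * e / (8 * c2)"
            using f(2) by (simp add: \<tau>_def curl_class_def norm_minus_commute)
          then have "(norm (toL2 w - toL2 (curl f)))\<^sup>2 \<le> (c1 * e / (8 * c2))\<^sup>2" by (rule power_mono) simp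
          then have "2 * c2\<^sup>2 * (norm (toL2 w - toL2 (curl f)))\<^sup>2 \<le> 2 * c2\<^sup>2 * (c1 * e / (8 * c2))\<^sup>2"
            by (rule mult_left_mono) simp
          also have "\<dots> = c1\<^sup>2 * e\<^sup>2 / 32" using c by (simp add: power_mult_distrib power_divide)
          finally show ?thesis .
        qed
        moreover have "32 * c2\<^sup>2 * \<eta>\<^sup>2 * V \<le> c1\<^sup>2 * e\<^sup>2 / 32"
        proof -
          have "32 * c2\<^sup>2 * \<eta>\<^sup>2 * V = c1\<^sup>2 * e\<^sup>2 / 32 * (V / (V + 1)\<^sup>2)"
            using c V by (simp add: \<eta>_def power_mult_distrib power_divide)
          also have "\<dots> \<le> c1\<^sup>2 * e\<^sup>2 / 32 * 1"
          proof (rule mult_left_mono)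
            have "V \<le> (V + 1)\<^sup>2" using V by (simp add: power2_eq_square algebra_simps)
            then show "V / (V + 1)\<^sup>2 \<le> 1" using V by (simp add: divide_le_eq_1)
          qed simp
          finally show ?thesis by simp
        qed
        \<comment> \<open>The two error terms add up to \<open>c1^2 e^2 / 16\<close>, so the
          distance to \<open>curl f\<close> is at most \<open>e / 4\<close>; with at most
          \<open>e / 2\<close> for the approximation of \<open>w\<close> the total stays below
          \<open>e\<close>.\<close>
        ultimately have "c1\<^sup>2 * (norm (toL2 W - toL2 (curl f)))\<^sup>2 \<le> c1\<^sup>2 * e\<^sup>2 / 16" using est by simp
        then have "(norm (toL2 W - toL2 (curl f)))\<^sup>2 \<le> (e / 4)\<^sup>2"
          using c by (simp add: power_divide)
        then have Wf: "norm (toL2 W - toL2 (curl f)) \<le> e / 4"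
          by (rule power2_le_imp_le) (use e in simp)
        have "norm (toL2 W - toL2 w) \<le> norm (toL2 W - toL2 (curl f)) + norm (toL2 (curl f) - toL2 w)"
          using norm_triangle_ineq[of "toL2 W - toL2 (curl f)" "toL2 (curl f) - toL2 w"] by simp
        also have "\<dots> < e" using Wf f(2) e by (simp add: \<tau>_def curl_class_def)
        finally have Ww: "norm (toL2 W - toL2 w) < e" .
        \<comment> \<open>The representative chosen by \<open>weak_curl\<close> must be identified
          with \<open>W\<close> almost everywhere before the estimate applies to it.\<close>
        have wcK: "has_weak_curl UNIV (K_star D us \<epsilon>) (Wt \<epsilon>)"
          unfolding Wt_def by (rule has_weak_curl_weak_curl[OF KW(1)])
        have meas: "Wt \<epsilon> \<in> borel_measurable borel"
          using L1_loc_indicator_measurable[OF open_UNIV, of "Wt \<epsilon>"] wcK by (simp add: has_weak_curl_def)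
        have AE: "AE x in lborel. W x = Wt \<epsilon> x"
          using has_weak_curl_unique[OF open_UNIV KW(1) wcK] by simp
        have LWt: "L2_on UNIV (Wt \<epsilon>)" by (rule L2_cong_AE[OF KW(2) meas AE])
        have "toL2 W = toL2 (Wt \<epsilon>)" using toL2_eq_iff[OF KW(2) LWt] AE by simp
        then have "sqrt (sq_int UNIV (\<lambda>x. Wt \<epsilon> x - w x)) = norm (toL2 W - toL2 w)"
          using LWt Kw(1) by (simp add: sq_int_UNIV L2_diff toL2_diff)
        then show ?thesis using LWt Ww by simp
      qed
      show ?thesis
        unfolding eventually_at_right_field
        by (rule exI[of _ "s / r"]) (use s(1) r(1) small in auto)
    qed
    show ?thesis
      unfolding tendsto_L2_def
    proof (intro conjI)
      show "\<forall>\<^sub>F \<epsilon> in at_right 0. L2_on UNIV (weak_curl UNIV (K_star D us \<epsilon>))"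
        using key[of 1] unfolding Wt_def by (auto elim: eventually_mono)
      show "L2_on UNIV (weak_curl UNIV K)" using Kw(1) by (simp add: w_def)
      show "((\<lambda>\<epsilon>. sqrt (LINT x:UNIV|lborel. (norm (weak_curl UNIV (K_star D us \<epsilon>) x - weak_curl UNIV K x))\<^sup>2))
          \<longlongrightarrow> 0) (at_right 0)"
      proof (rule tendstoI)
        fix e :: real assume "e > 0"
        from key[OF this] show "\<forall>\<^sub>F \<epsilon> in at_right 0.
          dist (sqrt (LINT x:UNIV|lborel. (norm (weak_curl UNIV (K_star D us \<epsilon>) x - weak_curl UNIV K x))\<^sup>2)) 0 < e"
          by eventually_elim (simp add: Wt_def w_def sq_int_def[symmetric])
      qed
    qed
  qed
  have "K \<in> BLC" if "X \<in> BLC_dot" "K \<in> X" for X K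
    using that unfolding BLC_dot_def by (auto elim!: quotientE simp: BLC_rel_def)
  with conv corrector_class[OF \<omega>(1,2), of U0] show ?thesis by blast
qed

end
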